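(* Let $X$ be a Stein manifold and let $\theta:\mathbb{R}_+\times X\rightarrow X$ be a continuous semigroup action of $(\mathbb{R}_+,+)$ on $X$ such that $\theta(t,\cdot)=\theta_t:X\rightarrow X$ is holomorphic for each $t\geq 0$. Then there exist a Stein manifold $\tilde X$, a continuous $(\mathbb{R},+)$-action $\tilde\theta:\mathbb{R}\times\tilde X\rightarrow\tilde X$ and an injective holomorphic map $f:X\rightarrow\tilde X$ such that $\tilde\theta_t\circ f=f\circ\theta_t$ on $X$ for all $t\geq 0$.
   Context: $\mathbb{R}_+=[0,\infty)$; a semigroup action of $(\mathbb{R}_+,+)$ satisfies $\theta_0=\mathrm{id}$ and $\theta_{s+t}=\theta_s\circ\theta_t$ for $s,t\ge 0$. $\tilde\theta_t=\tilde\theta(t,\cdot)$. *)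

theory Defs
  imports "HOL-Analysis.Analysis"
begin

section \<open>Holomorphic maps between open subsets of complex coordinate spaces\<close>

text \<open>
  The coordinate space of complex dimension \<open>n\<close> is encoded, like the library's
  \<^const>\<open>Euclidean_space\<close>, as the set of sequences vanishing from index \<open>n\<close> on. This keeps the
  dimension a natural number rather than a type, so that it can be bound by a quantifier.
\<close>

definition Complex_space :: "nat \<Rightarrow> (nat \<Rightarrow> complex) topology"
  where "Complex_space n =
    subtopology (product_topology (\<lambda>_. euclidean) UNIV) {z. \<forall>i\<ge>n. z i = 0}"

definition cnorm :: "nat \<Rightarrow> (nat \<Rightarrow> complex) \<Rightarrow> real"
  where "cnorm n z = L2_set (\<lambda>i. cmod (z i)) {..<n}"

text \<open>
  Complex differentiability at every point of an open set; \<open>a\<close> lists the complex partial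
  derivatives at \<open>z\<close>.
\<close>

definition holo_fun :: "nat \<Rightarrow> (nat \<Rightarrow> complex) set \<Rightarrow> ((nat \<Rightarrow> complex) \<Rightarrow> complex) \<Rightarrow> bool"
  where "holo_fun n U f \<longleftrightarrow>
    openin (Complex_space n) U \<and>
    (\<forall>z\<in>U. \<exists>a :: nat \<Rightarrow> complex.
      ((\<lambda>w. (f w - f z - (\<Sum>i<n. a i * (w i - z i))) / of_real (cnorm n (\<lambda>i. w i - z i)))
        \<longlongrightarrow> 0) (at z within U))"

definition holo_map ::
    "nat \<Rightarrow> nat \<Rightarrow> (nat \<Rightarrow> complex) set \<Rightarrow> ((nat \<Rightarrow> complex) \<Rightarrow> (nat \<Rightarrow> complex)) \<Rightarrow> bool"
  where "holo_map n m U g \<longleftrightarrow>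
    openin (Complex_space n) U \<and> g ` U \<subseteq> topspace (Complex_space m) \<and>
    (\<forall>j<m. holo_fun n U (\<lambda>z. g z j))"

section \<open>Complex manifolds\<close>

text \<open>
  A chart is a pair of its domain and its coordinate map; values of the coordinate map outside the
  domain are irrelevant. The atlas need not be maximal. Manifolds are Hausdorff, second countable
  and of pure dimension, but not necessarily connected.
\<close>

record 'a complex_mfd =
  mfd_top :: "'a topology"
  mfd_dim :: nat
  mfd_atlas :: "('a set \<times> ('a \<Rightarrow> (nat \<Rightarrow> complex))) set"

abbreviation points :: "'a complex_mfd \<Rightarrow> 'a set"
  where "points M \<equiv> topspace (mfd_top M)"

definition complex_manifold :: "'a complex_mfd \<Rightarrow> bool"
  where "complex_manifold M \<longleftrightarrow>
    Hausdorff_space (mfd_top M) \<and>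
    second_countable (mfd_top M) \<and>
    (\<forall>(U, \<phi>) \<in> mfd_atlas M.
      openin (mfd_top M) U \<and>
      openin (Complex_space (mfd_dim M)) (\<phi> ` U) \<and>
      homeomorphic_map (subtopology (mfd_top M) U)
        (subtopology (Complex_space (mfd_dim M)) (\<phi> ` U)) \<phi>) \<and>
    points M = (\<Union>(U, \<phi>) \<in> mfd_atlas M. U) \<and>
    (\<forall>(U, \<phi>) \<in> mfd_atlas M. \<forall>(V, \<psi>) \<in> mfd_atlas M.
      holo_map (mfd_dim M) (mfd_dim M) (\<phi> ` (U \<inter> V)) (\<psi> \<circ> inv_into U \<phi>))"

definition holomorphic_function :: "'a complex_mfd \<Rightarrow> ('a \<Rightarrow> complex) \<Rightarrow> bool"
  where "holomorphic_function M f \<longleftrightarrow>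
    (\<forall>(U, \<phi>) \<in> mfd_atlas M. holo_fun (mfd_dim M) (\<phi> ` U) (f \<circ> inv_into U \<phi>))"

definition holomorphic_map :: "'a complex_mfd \<Rightarrow> 'b complex_mfd \<Rightarrow> ('a \<Rightarrow> 'b) \<Rightarrow> bool"
  where "holomorphic_map M N f \<longleftrightarrow>
    continuous_map (mfd_top M) (mfd_top N) f \<and>
    (\<forall>(U, \<phi>) \<in> mfd_atlas M. \<forall>(V, \<psi>) \<in> mfd_atlas N.
      holo_map (mfd_dim M) (mfd_dim N) (\<phi> ` {x \<in> U. f x \<in> V}) (\<psi> \<circ> f \<circ> inv_into U \<phi>))"

section \<open>Stein manifolds\<close>

definition holomorphic_hull :: "'a complex_mfd \<Rightarrow> 'a set \<Rightarrow> 'a set"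
  where "holomorphic_hull M K =
    {x \<in> points M. \<forall>f. holomorphic_function M f \<longrightarrow> cmod (f x) \<le> (SUP y\<in>K. cmod (f y))}"

text \<open>
  The supremum of the empty set of reals is unspecified, hence the restriction to nonempty compact
  sets.
\<close>

definition holomorphically_convex :: "'a complex_mfd \<Rightarrow> bool"
  where "holomorphically_convex M \<longleftrightarrow>
    (\<forall>K. compactin (mfd_top M) K \<and> K \<noteq> {} \<longrightarrow> compactin (mfd_top M) (holomorphic_hull M K))"

definition holomorphically_separable :: "'a complex_mfd \<Rightarrow> bool"
  where "holomorphically_separable M \<longleftrightarrow>
    (\<forall>x\<in>points M. \<forall>y\<in>points M. x \<noteq> y \<longrightarrow> (\<exists>f. holomorphic_function M f \<and> f x \<noteq> f y))"

definition stein_manifold :: "'a complex_mfd \<Rightarrow> bool"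
  where "stein_manifold M \<longleftrightarrow>
    complex_manifold M \<and> holomorphically_convex M \<and> holomorphically_separable M"

section \<open>Continuous actions of additive monoids of reals\<close>

text \<open>
  Used for \<open>T = {0..}\<close> (semigroup actions) and \<open>T = UNIV\<close> (group actions).
\<close>

definition continuous_action :: "real set \<Rightarrow> 'a topology \<Rightarrow> (real \<Rightarrow> 'a \<Rightarrow> 'a) \<Rightarrow> bool"
  where "continuous_action T X \<theta> \<longleftrightarrow>
    continuous_map (prod_topology (top_of_set T) X) X (\<lambda>(t, x). \<theta> t x) \<and>
    (\<forall>x\<in>topspace X. \<theta> 0 x = x) \<and>
    (\<forall>s\<in>T. \<forall>t\<in>T. \<forall>x\<in>topspace X. \<theta> (s + t) x = \<theta> s (\<theta> t x))"

end

theory Submission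
  imports Defs "HOL-Complex_Analysis.Cauchy_Integral_Formula"
begin

text \<open>
  Small times act close to the identity in coordinates, so by Cauchy's estimates every \<open>\<theta> t\<close> is locally
  biholomorphic, and then injective: two points cannot merge at a first positive time. Hence the copies
  \<open>X\<^sub>t\<close> of \<open>X\<close> for real \<open>t\<close>, glued by \<open>\<theta> (t - s) : X\<^sub>s \<rightarrow> X\<^sub>t\<close> for \<open>s \<le> t\<close>, form an increasing union of
  open subsets of a manifold on which translation of the index is a group action.

  The range of \<open>g \<mapsto> g \<circ> \<theta> t\<close> is dense in the holomorphic functions (Runge property): with
  \<open>T g = g \<circ> \<theta> h\<close> and \<open>N h = r\<close> small, \<open>T\<^sup>N (2 - T)\<^sup>N g = (1 - (T - 1)\<^sup>2)\<^sup>N g\<close> tends to \<open>g\<close> as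
  \<open>N\<close> grows, since \<open>(T - 1)\<^sup>m g\<close> is of order \<open>(C h m)\<^sup>m\<close>. A telescoping series then approximates functions
  on \<open>X\<^sub>t\<close> by functions on the union, which gives separation of points, and shows that hulls taken
  in the union and in \<open>X\<^sub>t\<close> agree within \<open>X\<^sub>t\<close>. That a hull cannot leave \<open>X\<^sub>t\<close> follows by moving it with
  the group action.
\<close>

section \<open>Complex analysis on open subsets of coordinate spaces\<close>

text \<open>The action is only continuous in time, so no generating vector field is at hand and a
  displacement of order \<open>h\<close> at time \<open>h\<close> must itself be proved; it follows
  from holomorphy in space (\<open>flow_displacement\<close>). Differences of order \<open>m\<close>
  are then controlled by bounds for \<open>g\<close> alone: the radius is cut into \<open>m\<close>
  rings, and each difference costs one Cauchy estimate of size \<open>m / R\<close> and gains a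
  factor \<open>h\<close>. The factor \<open>2 - T\<close> is the first-order expansion of
  \<open>1 / T\<close> at \<open>T = 1\<close>, so each of the \<open>N\<close> steps has an error
  of order \<open>h^2\<close>, in total \<open>N h^2 = r^2 / N\<close>. With \<open>1\<close> in its
  place the error would be of order \<open>N h = r\<close>, which does not tend to 0. The terms
  \<open>(N choose j) (2 C h j)^(2 j)\<close> with \<open>j\<close> near \<open>N\<close> are small
  only if \<open>C r\<close> is small; long times are therefore composed of short ones, over the
  compact set swept out by the flow. Injectivity makes each copy embed in the union: points of two
  copies that merge at some later time merge at every time from the larger index on. Openness of the
  maps \<open>\<theta> t\<close> makes the copies open.\<close>

text \<open>\<open>Cn n\<close> is \<open>n\<close>-dimensional complex space with its maximum distance \<open>dn n\<close>, and \<open>pd n a r\<close> an open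
  polydisc in it; \<open>cd n f z\<close> is complex differentiability at \<open>z\<close>, and \<open>cdd n f z a\<close> says moreover that
  \<open>a\<close> lists the partial derivatives.\<close>

definition Cn :: "nat \<Rightarrow> (nat \<Rightarrow> complex) set"
  where "Cn n = {z. \<forall>i\<ge>n. z i = 0}"

definition dn :: "nat \<Rightarrow> (nat \<Rightarrow> complex) \<Rightarrow> (nat \<Rightarrow> complex) \<Rightarrow> real"
  where "dn n z w = Max (insert 0 ((\<lambda>i. cmod (z i - w i)) ` {..<n}))"

definition pd :: "nat \<Rightarrow> (nat \<Rightarrow> complex) \<Rightarrow> real \<Rightarrow> (nat \<Rightarrow> complex) set"
  where "pd n a r = {z \<in> Cn n. dn n z a < r}"

definition cdd :: "nat \<Rightarrow> ((nat \<Rightarrow> complex) \<Rightarrow> complex) \<Rightarrow> (nat \<Rightarrow> complex) \<Rightarrow> (nat \<Rightarrow> complex) \<Rightarrow> bool"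
  where "cdd n f z a \<longleftrightarrow> (\<forall>\<epsilon>>0. \<exists>\<delta>>0. \<forall>w\<in>Cn n. dn n w z < \<delta> \<longrightarrow>
    cmod (f w - f z - (\<Sum>i<n. a i * (w i - z i))) \<le> \<epsilon> * dn n w z)"

definition cd :: "nat \<Rightarrow> ((nat \<Rightarrow> complex) \<Rightarrow> complex) \<Rightarrow> (nat \<Rightarrow> complex) \<Rightarrow> bool"
  where "cd n f z \<longleftrightarrow> (\<exists>a. cdd n f z a)"

section \<open>Polydiscs and the topology of coordinate space\<close>

lemma dn_less_iff: "0 < r \<Longrightarrow> dn n z w < r \<longleftrightarrow> (\<forall>i<n. cmod (z i - w i) < r)"
  by (auto simp: dn_def)

lemma dn_le_iff: "0 \<le> r \<Longrightarrow> dn n z w \<le> r \<longleftrightarrow> (\<forall>i<n. cmod (z i - w i) \<le> r)"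
  by (auto simp: dn_def)

lemma dn_nonneg [simp]: "0 \<le> dn n z w"
  by (auto simp: dn_def)

lemma cmod_le_dn: "i < n \<Longrightarrow> cmod (z i - w i) \<le> dn n z w"
  by (auto simp: dn_def intro!: Max_ge)

lemma dn_commute: "dn n z w = dn n w z"
  by (simp add: dn_def norm_minus_commute)

lemma dn_same [simp]: "dn n z z = 0"
  by (rule antisym) (auto simp: dn_le_iff)

lemma dn_triangle: "dn n z w \<le> dn n z u + dn n u w"
proof (subst dn_le_iff, simp, intro allI impI)
  fix i assume "i < n"
  have "cmod (z i - w i) \<le> cmod (z i - u i) + cmod (u i - w i)"
    by (metis dist_norm dist_triangle)
  then show "cmod (z i - w i) \<le> dn n z u + dn n u w"
    using cmod_le_dn[OF \<open>i < n\<close>, of z u] cmod_le_dn[OF \<open>i < n\<close>, of u w] by linarith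
qed

lemma dn_eq_0: "z \<in> Cn n \<Longrightarrow> w \<in> Cn n \<Longrightarrow> dn n z w = 0 \<longleftrightarrow> z = w"
proof
  assume *: "z \<in> Cn n" "w \<in> Cn n" "dn n z w = 0"
  show "z = w"
  proof
    fix i show "z i = w i"
      using * cmod_le_dn[of i n z w] by (cases "i < n") (auto simp: Cn_def)
  qed
qed auto

lemma pd_subset: "pd n a r \<subseteq> Cn n"
  by (auto simp: pd_def)

lemma pd_mono: "r \<le> s \<Longrightarrow> pd n a r \<subseteq> pd n a s"
  by (auto simp: pd_def)

lemma centre_in_pd: "a \<in> Cn n \<Longrightarrow> 0 < r \<Longrightarrow> a \<in> pd n a r"
  by (auto simp: pd_def)

lemma topspace_Complex_space [simp]: "topspace (Complex_space n) = Cn n"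
  by (auto simp: Complex_space_def Cn_def)

lemma openin_Complex_space_iff_open:
  "openin (Complex_space n) U \<longleftrightarrow> (\<exists>T. open T \<and> U = T \<inter> Cn n)"
  unfolding Complex_space_def euclidean_product_topology openin_subtopology Cn_def
  by (simp only: open_openin)

text \<open>Coordinates from \<open>n\<close> on vanish identically on \<open>Cn n\<close>, so a
  basic product neighbourhood constrains only the first \<open>n\<close> of them, and the least of
  their radii gives a polydisc.\<close>

lemma openin_Complex_space:
  "openin (Complex_space n) U \<longleftrightarrow> U \<subseteq> Cn n \<and> (\<forall>z\<in>U. \<exists>r>0. pd n z r \<subseteq> U)"
proof -
  note eq = openin_Complex_space_iff_open[of n U]
  show ?thesis
  proof (intro iffI conjI ballI)
    assume "openin (Complex_space n) U"
    then obtain T where T: "open T" "U = T \<inter> Cn n" using eq by auto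
    show "U \<subseteq> Cn n" using T by auto
    fix z assume "z \<in> U"
    then have "z \<in> T" using T by auto
    from product_topology_open_contains_basis[OF T(1)[unfolded open_fun_def] this]
    obtain X where X: "z \<in> Pi\<^sub>E UNIV X" "\<And>i. open (X i)" "finite {i. X i \<noteq> UNIV}" "Pi\<^sub>E UNIV X \<subseteq> T"
      by auto
    have "\<exists>r>0. \<forall>w. dist w (z i) < r \<longrightarrow> w \<in> X i" for i
    proof -
      have "z i \<in> X i" using X(1) by auto
      then show ?thesis using X(2)[of i] unfolding open_dist by auto
    qed
    then obtain r where r: "\<And>i. r i > 0" "\<And>i w. dist w (z i) < r i \<Longrightarrow> w \<in> X i" by metis
    define \<rho> where "\<rho> = Min (insert 1 (r ` {..<n}))"
    have \<rho>: "\<rho> > 0" "\<And>i. i < n \<Longrightarrow> \<rho> \<le> r i" using r(1) by (auto simp: \<rho>_def)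
    have "pd n z \<rho> \<subseteq> U"
    proof
      fix w assume w: "w \<in> pd n z \<rho>"
      have "w i \<in> X i" for i
      proof (cases "i < n")
        case True
        then have "dist (w i) (z i) < r i"
          using w cmod_le_dn[OF True, of w z] \<rho>(2)[OF True] by (auto simp: pd_def dist_norm)
        then show ?thesis using r by auto
      next
        case False
        then have "w i = z i" using w \<open>z \<in> U\<close> T(2) by (auto simp: pd_def Cn_def)
        then show ?thesis using X(1) by auto
      qed
      then have "w \<in> T" using X(4) by auto
      then show "w \<in> U" using T w by (auto simp: pd_def)
    qed
    then show "\<exists>r>0. pd n z r \<subseteq> U" using \<rho>(1) by blast
  next
    assume U: "U \<subseteq> Cn n \<and> (\<forall>z\<in>U. \<exists>r>0. pd n z r \<subseteq> U)"
    then obtain r where r: "\<And>z. z \<in> U \<Longrightarrow> r z > 0" "\<And>z. z \<in> U \<Longrightarrow> pd n z (r z) \<subseteq> U" by metis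
    define T where "T = (\<Union>z\<in>U. {w. \<forall>i\<in>{..<n}. cmod (w i - z i) < r z})"
    have "open {w :: nat \<Rightarrow> complex. \<forall>i\<in>{..<n}. cmod (w i - z i) < r z}" for z
    proof -
      have "open (\<Inter>i\<in>{..<n}. {w :: nat \<Rightarrow> complex. cmod (w i - z i) < r z})"
        by (intro open_INT ballI open_Collect_less continuous_on_norm continuous_on_diff
            continuous_on_product_coordinates continuous_on_const) auto
      also have "(\<Inter>i\<in>{..<n}. {w. cmod (w i - z i) < r z}) = {w. \<forall>i\<in>{..<n}. cmod (w i - z i) < r z}"
        by auto
      finally show ?thesis .
    qed
    then have "open T" unfolding T_def by (intro open_UN) auto
    moreover have "U = T \<inter> Cn n"
    proof
      show "U \<subseteq> T \<inter> Cn n" using U r(1) by (force simp: T_def)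
      show "T \<inter> Cn n \<subseteq> U"
      proof
        fix w assume "w \<in> T \<inter> Cn n"
        then obtain z where z: "z \<in> U" "\<forall>i<n. cmod (w i - z i) < r z" "w \<in> Cn n"
          by (auto simp: T_def)
        then have "w \<in> pd n z (r z)" using r(1) by (auto simp: pd_def dn_less_iff)
        then show "w \<in> U" using r(2) z by auto
      qed
    qed
    ultimately show "openin (Complex_space n) U" using eq by auto
  qed
qed

lemma openin_pd: "openin (Complex_space n) (pd n a r)"
  unfolding openin_Complex_space
proof (intro conjI ballI)
  fix z assume z: "z \<in> pd n a r"
  have "pd n z (r - dn n z a) \<subseteq> pd n a r"
  proof
    fix w assume "w \<in> pd n z (r - dn n z a)"
    then show "w \<in> pd n a r" using dn_triangle[of n w a z] by (auto simp: pd_def)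
  qed
  then show "\<exists>s>0. pd n z s \<subseteq> pd n a r" using z by (auto simp: pd_def intro!: exI[of _ "r - dn n z a"])
qed (rule pd_subset)

text \<open>A closed polydisc is a product of closed discs and, from index \<open>n\<close> on, of
  singletons, so Tychonoff's theorem applies.\<close>

lemma compactin_closed_pd: "compactin (Complex_space n) {z \<in> Cn n. dn n z a \<le> r}"
proof (cases "0 \<le> r")
  case True
  have "compactin (product_topology (\<lambda>_. euclidean) UNIV)
      (Pi\<^sub>E UNIV (\<lambda>i::nat. if i < n then cball (a i) r else {0}))"
    by (subst compactin_PiE) auto
  moreover have "Pi\<^sub>E UNIV (\<lambda>i::nat. if i < n then cball (a i) r else {0}) = {z \<in> Cn n. dn n z a \<le> r}"
    using True by (auto simp: PiE_UNIV_domain Pi_iff Cn_def dn_le_iff dist_norm norm_minus_commute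
      split: if_splits)
  ultimately show ?thesis
    unfolding Complex_space_def compactin_subtopology by (auto simp: Cn_def)
next
  case False
  have "{z \<in> Cn n. dn n z a \<le> r} = {}"
  proof -
    have "\<not> dn n z a \<le> r" for z using False dn_nonneg[of n z a] by linarith
    then show ?thesis by simp
  qed
  then show ?thesis by (metis compactin_empty)
qed

lemma dn_le_cnorm: "dn n w z \<le> cnorm n (\<lambda>i. w i - z i)"
  by (subst dn_le_iff)
    (auto simp: cnorm_def L2_set_nonneg intro!: member_le_L2_set[where f = "\<lambda>i. cmod (w i - z i)"])

lemma cnorm_le_dn: "cnorm n (\<lambda>i. w i - z i) \<le> real n * dn n w z"
proof -
  have "cnorm n (\<lambda>i. w i - z i) \<le> (\<Sum>i<n. cmod (w i - z i))"
    unfolding cnorm_def by (rule L2_set_le_sum) auto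
  also have "\<dots> \<le> (\<Sum>i<n. dn n w z)" by (intro sum_mono cmod_le_dn) auto
  finally show ?thesis by simp
qed

text \<open>Turns the filter in the definition of \<open>holo_fun\<close>, taken in the product
  topology on all sequences, into an epsilon-delta condition on polydiscs.\<close>

lemma eventually_at_within_Cn:
  assumes U: "openin (Complex_space n) U" and z: "z \<in> U"
  shows "eventually P (at z within U) \<longleftrightarrow> (\<exists>\<delta>>0. \<forall>w\<in>Cn n. dn n w z < \<delta> \<longrightarrow> w \<noteq> z \<longrightarrow> P w)"
proof -
  obtain r where r: "r > 0" "pd n z r \<subseteq> U" using assms by (auto simp: openin_Complex_space)
  show ?thesis
  proof
    assume "eventually P (at z within U)"
    then obtain T where T: "open T" "z \<in> T" "\<forall>w\<in>T. w \<noteq> z \<longrightarrow> w \<in> U \<longrightarrow> P w"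
      unfolding eventually_at_topological by blast
    have "openin (Complex_space n) (T \<inter> U)"
    proof -
      have "openin (Complex_space n) (T \<inter> Cn n)"
        using T(1) openin_Complex_space_iff_open by blast
      then show ?thesis
        using U by (metis openin_Int openin_subset topspace_Complex_space inf.absorb_iff2 inf_assoc)
    qed
    then obtain \<delta> where "\<delta> > 0" "pd n z \<delta> \<subseteq> T \<inter> U"
      using T z unfolding openin_Complex_space by blast
    then show "\<exists>\<delta>>0. \<forall>w\<in>Cn n. dn n w z < \<delta> \<longrightarrow> w \<noteq> z \<longrightarrow> P w"
      using T(3) by (intro exI[of _ \<delta>]) (auto simp: pd_def)
  next
    assume "\<exists>\<delta>>0. \<forall>w\<in>Cn n. dn n w z < \<delta> \<longrightarrow> w \<noteq> z \<longrightarrow> P w"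
    then obtain \<delta> where \<delta>: "\<delta> > 0" "\<And>w. w\<in>Cn n \<Longrightarrow> dn n w z < \<delta> \<Longrightarrow> w \<noteq> z \<Longrightarrow> P w" by blast
    obtain T where T: "open T" "pd n z \<delta> = T \<inter> Cn n"
      using openin_pd[of n z \<delta>] openin_Complex_space_iff_open by blast
    have "z \<in> Cn n" using U z by (auto simp: openin_Complex_space)
    then have "z \<in> T" using T(2) centre_in_pd \<delta>(1) by blast
    moreover have "\<forall>w\<in>T. w \<noteq> z \<longrightarrow> w \<in> U \<longrightarrow> P w"
      using \<delta>(2) T(2) U by (fastforce simp: openin_Complex_space pd_def)
    ultimately show "eventually P (at z within U)"
      unfolding eventually_at_topological using T(1) by blast
  qed
qed

text \<open>The L2 norm used by \<open>holo_fun\<close> and the maximum distance bound each other up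
  to the factor \<open>n\<close>, so dividing by either gives the same derivative.\<close>

lemma cd_iff_limit:
  assumes U: "openin (Complex_space n) U" and z: "z \<in> U"
  shows "cd n f z \<longleftrightarrow> (\<exists>a :: nat \<Rightarrow> complex.
      ((\<lambda>w. (f w - f z - (\<Sum>i<n. a i * (w i - z i))) / of_real (cnorm n (\<lambda>i. w i - z i)))
        \<longlongrightarrow> 0) (at z within U))"
proof -
  have zC: "z \<in> Cn n" using U z by (auto simp: openin_Complex_space)
  have "(\<forall>\<epsilon>>0. \<exists>\<delta>>0. \<forall>w\<in>Cn n. dn n w z < \<delta> \<longrightarrow>
      cmod (f w - f z - (\<Sum>i<n. a i * (w i - z i))) \<le> \<epsilon> * dn n w z) \<longleftrightarrow>
      ((\<lambda>w. (f w - f z - (\<Sum>i<n. a i * (w i - z i))) / of_real (cnorm n (\<lambda>i. w i - z i)))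
        \<longlongrightarrow> 0) (at z within U)" (is "?L \<longleftrightarrow> ?R") for a
  proof -
    let ?D = "\<lambda>w. f w - f z - (\<Sum>i<n. a i * (w i - z i))"
    let ?c = "\<lambda>w. cnorm n (\<lambda>i. w i - z i)"
    have pos: "0 < dn n w z" "0 < ?c w" if "w \<in> Cn n" "w \<noteq> z" for w
    proof -
      show *: "0 < dn n w z" using dn_eq_0[OF that(1) zC] that(2) dn_nonneg[of n w z] by linarith
      then show "0 < ?c w" using dn_le_cnorm[of n w z] by linarith
    qed
    have R: "?R \<longleftrightarrow> (\<forall>\<epsilon>>0. \<exists>\<delta>>0. \<forall>w\<in>Cn n. dn n w z < \<delta> \<longrightarrow> w \<noteq> z \<longrightarrow> cmod (?D w) < \<epsilon> * ?c w)"
      unfolding tendsto_iff eventually_at_within_Cn[OF U z]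
      using pos(2) by (fastforce simp: norm_divide pos_divide_less_eq cnorm_def)
    show ?thesis
    proof
      assume L: ?L
      show ?R unfolding R
      proof (intro allI impI)
        fix \<epsilon> :: real assume \<epsilon>: "\<epsilon> > 0"
        then have "\<epsilon>/2 > 0" by simp
        then obtain \<delta> where \<delta>: "\<delta> > 0" "\<And>w. w\<in>Cn n \<Longrightarrow> dn n w z < \<delta> \<Longrightarrow> cmod (?D w) \<le> \<epsilon>/2 * dn n w z"
          using L by blast
        have "cmod (?D w) < \<epsilon> * ?c w" if w: "w\<in>Cn n" "dn n w z < \<delta>" "w \<noteq> z" for w
        proof -
          have "\<epsilon>/2 * dn n w z < \<epsilon> * dn n w z" using \<epsilon> pos(1)[OF w(1,3)] by simp
          also have "\<dots> \<le> \<epsilon> * ?c w" using \<epsilon> dn_le_cnorm[of n w z] by simp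
          finally show ?thesis using \<delta>(2)[OF w(1,2)] by linarith
        qed
        then show "\<exists>\<delta>>0. \<forall>w\<in>Cn n. dn n w z < \<delta> \<longrightarrow> w \<noteq> z \<longrightarrow> cmod (?D w) < \<epsilon> * ?c w"
          using \<delta>(1) by blast
      qed
    next
      assume R': ?R
      show ?L
      proof (intro allI impI)
        fix \<epsilon> :: real assume \<epsilon>: "\<epsilon> > 0"
        \<comment> \<open>The added 1 avoids a division by zero in dimension 0.\<close>
        then have "\<epsilon> / (real n + 1) > 0" by simp
        then obtain \<delta> where \<delta>: "\<delta> > 0"
          "\<And>w. w\<in>Cn n \<Longrightarrow> dn n w z < \<delta> \<Longrightarrow> w \<noteq> z \<Longrightarrow> cmod (?D w) < \<epsilon> / (real n + 1) * ?c w"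
          using R'[unfolded R] by blast
        have "cmod (?D w) \<le> \<epsilon> * dn n w z" if w: "w\<in>Cn n" "dn n w z < \<delta>" for w
        proof (cases "w = z")
          case False
          have "?c w \<le> (real n + 1) * dn n w z"
            using cnorm_le_dn[of n w z] dn_nonneg[of n w z] unfolding distrib_right by linarith
          then have "\<epsilon> / (real n + 1) * ?c w \<le> \<epsilon> / (real n + 1) * ((real n + 1) * dn n w z)"
            using \<epsilon> by (intro mult_left_mono) auto
          also have "\<dots> = \<epsilon> * dn n w z" by (simp add: add_nonneg_eq_0_iff)
          finally show ?thesis using \<delta>(2)[OF w False] by linarith
        qed simp
        then show "\<exists>\<delta>>0. \<forall>w\<in>Cn n. dn n w z < \<delta> \<longrightarrow> cmod (?D w) \<le> \<epsilon> * dn n w z"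
          using \<delta>(1) by blast
      qed
    qed
  qed
  then show ?thesis unfolding cd_def cdd_def by presburger
qed

lemma holo_fun_iff: "holo_fun n U f \<longleftrightarrow> openin (Complex_space n) U \<and> (\<forall>z\<in>U. cd n f z)"
  using cd_iff_limit[of n U _ f] unfolding holo_fun_def by blast

section \<open>Calculus of complex derivatives\<close>

lemma cddD:
  assumes "cdd n f z a" "\<epsilon> > 0"
  obtains \<delta> where "\<delta> > 0" "\<And>w. w \<in> Cn n \<Longrightarrow> dn n w z < \<delta> \<Longrightarrow>
    cmod (f w - f z - (\<Sum>i<n. a i * (w i - z i))) \<le> \<epsilon> * dn n w z"
  using assms unfolding cdd_def by blast

lemma cdd_cong:
  assumes "r > 0" "z \<in> Cn n" "\<And>w. w \<in> pd n z r \<Longrightarrow> f w = g w" "cdd n f z a"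
  shows "cdd n g z a"
  unfolding cdd_def
proof (intro allI impI)
  have fz: "f z = g z" using assms by (auto simp: centre_in_pd)
  fix \<epsilon> :: real assume "\<epsilon> > 0"
  then obtain \<delta> where \<delta>: "\<delta> > 0" "\<And>w. w\<in>Cn n \<Longrightarrow> dn n w z < \<delta> \<Longrightarrow>
    cmod (f w - f z - (\<Sum>i<n. a i * (w i - z i))) \<le> \<epsilon> * dn n w z" using cddD[OF assms(4)] by blast
  have "cmod (g w - g z - (\<Sum>i<n. a i * (w i - z i))) \<le> \<epsilon> * dn n w z"
    if "w \<in> Cn n" "dn n w z < min \<delta> r" for w
    using \<delta>(2)[of w] assms(3)[of w] that fz by (auto simp: pd_def)
  then show "\<exists>\<delta>>0. \<forall>w\<in>Cn n. dn n w z < \<delta> \<longrightarrow>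
    cmod (g w - g z - (\<Sum>i<n. a i * (w i - z i))) \<le> \<epsilon> * dn n w z"
    using \<delta>(1) assms(1) by (intro exI[of _ "min \<delta> r"]) auto
qed

lemma cd_cong:
  assumes "r > 0" "z \<in> Cn n" "\<And>w. w \<in> pd n z r \<Longrightarrow> f w = g w"
  shows "cd n f z \<longleftrightarrow> cd n g z"
  using cdd_cong[of r z n f g] cdd_cong[of r z n g f] assms unfolding cd_def by metis

lemma cdd_lincomb:
  assumes "cdd n f z a" "cdd n g z b"
  shows "cdd n (\<lambda>w. c * f w + d * g w) z (\<lambda>i. c * a i + d * b i)"
  unfolding cdd_def
proof (intro allI impI)
  fix \<epsilon> :: real assume "\<epsilon> > 0"
  define K where "K = 1 + cmod c + cmod d"
  have pos: "K > 0" unfolding K_def by (intro add_pos_nonneg) auto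
  define e where "e = \<epsilon> / K"
  have "e > 0" using \<open>\<epsilon> > 0\<close> pos by (simp add: e_def)
  have Ke: "K * e = \<epsilon>" using pos unfolding e_def by simp
  obtain \<delta>1 where \<delta>1: "\<delta>1 > 0" "\<And>w. w\<in>Cn n \<Longrightarrow> dn n w z < \<delta>1 \<Longrightarrow>
    cmod (f w - f z - (\<Sum>i<n. a i * (w i - z i))) \<le> e * dn n w z" using cddD[OF assms(1) \<open>e > 0\<close>] by blast
  obtain \<delta>2 where \<delta>2: "\<delta>2 > 0" "\<And>w. w\<in>Cn n \<Longrightarrow> dn n w z < \<delta>2 \<Longrightarrow>
    cmod (g w - g z - (\<Sum>i<n. b i * (w i - z i))) \<le> e * dn n w z" using cddD[OF assms(2) \<open>e > 0\<close>] by blast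
  have "cmod (c * f w + d * g w - (c * f z + d * g z) - (\<Sum>i<n. (c * a i + d * b i) * (w i - z i)))
      \<le> \<epsilon> * dn n w z" if w: "w \<in> Cn n" "dn n w z < min \<delta>1 \<delta>2" for w
  proof -
    let ?A = "f w - f z - (\<Sum>i<n. a i * (w i - z i))" and ?B = "g w - g z - (\<Sum>i<n. b i * (w i - z i))"
    have "c * f w + d * g w - (c * f z + d * g z) - (\<Sum>i<n. (c * a i + d * b i) * (w i - z i))
        = c * ?A + d * ?B"
    proof -
      have "(\<Sum>i<n. (c * a i + d * b i) * (w i - z i))
          = c * (\<Sum>i<n. a i * (w i - z i)) + d * (\<Sum>i<n. b i * (w i - z i))"
        by (simp add: sum.distrib sum_distrib_left distrib_right mult.assoc)
      then show ?thesis by (simp only: ring_distribs) simp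
    qed
    then have "cmod (c * f w + d * g w - (c * f z + d * g z) - (\<Sum>i<n. (c * a i + d * b i) * (w i - z i)))
        = cmod (c * ?A + d * ?B)" by (simp only:)
    also have "\<dots> \<le> cmod c * cmod ?A + cmod d * cmod ?B"
      by (rule norm_triangle_mono) (auto simp: norm_mult)
    also have "\<dots> \<le> cmod c * (e * dn n w z) + cmod d * (e * dn n w z)"
    proof (rule add_mono)
      show "cmod c * cmod ?A \<le> cmod c * (e * dn n w z)"
        using w \<delta>1(2)[of w] by (intro mult_left_mono) auto
      show "cmod d * cmod ?B \<le> cmod d * (e * dn n w z)"
        using w \<delta>2(2)[of w] by (intro mult_left_mono) auto
    qed
    also have "\<dots> \<le> K * (e * dn n w z)"
    proof -
      have "0 \<le> e * dn n w z" using \<open>e > 0\<close> by simp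
      then show ?thesis unfolding K_def distrib_right by linarith
    qed
    also have "\<dots> = \<epsilon> * dn n w z" by (simp only: mult.assoc[symmetric] Ke)
    finally show ?thesis .
  qed
  then show "\<exists>\<delta>>0. \<forall>w\<in>Cn n. dn n w z < \<delta> \<longrightarrow> cmod (c * f w + d * g w - (c * f z + d * g z)
      - (\<Sum>i<n. (c * a i + d * b i) * (w i - z i))) \<le> \<epsilon> * dn n w z"
    using \<delta>1(1) \<delta>2(1) by (intro exI[of _ "min \<delta>1 \<delta>2"]) auto
qed

lemma cd_lincomb: "cd n f z \<Longrightarrow> cd n g z \<Longrightarrow> cd n (\<lambda>w. c * f w + d * g w) z"
  using cdd_lincomb unfolding cd_def by blast

lemma cd_diff: "cd n f z \<Longrightarrow> cd n g z \<Longrightarrow> cd n (\<lambda>w. f w - g w) z"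
  using cd_lincomb[of n f z g 1 "-1"] by simp

lemma cd_coordinate: "i < n \<Longrightarrow> cd n (\<lambda>w. w i) z"
  unfolding cd_def cdd_def
proof (intro exI[of _ "\<lambda>j. if j = i then 1 else 0"] allI impI exI[of _ 1] conjI ballI)
  fix \<epsilon> :: real and w :: "nat \<Rightarrow> complex" assume "i < n" "\<epsilon> > 0"
  have "(\<Sum>j<n. (if j = i then 1 else 0) * (w j - z j)) = (\<Sum>j<n. if j = i then w j - z j else 0)"
    by (intro sum.cong) auto
  also have "\<dots> = w i - z i" using \<open>i < n\<close> by simp
  finally show "cmod (w i - z i - (\<Sum>j<n. (if j = i then 1 else 0) * (w j - z j))) \<le> \<epsilon> * dn n w z"
    using \<open>\<epsilon> > 0\<close> by simp
qed auto

lemma cd_lipschitz: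
  assumes "cd n f z"
  shows "\<exists>C>0. \<exists>\<delta>>0. \<forall>w\<in>Cn n. dn n w z < \<delta> \<longrightarrow> cmod (f w - f z) \<le> C * dn n w z"
proof -
  obtain a where a: "cdd n f z a" using assms unfolding cd_def by blast
  obtain \<delta> where \<delta>: "\<delta> > 0" "\<And>w. w\<in>Cn n \<Longrightarrow> dn n w z < \<delta> \<Longrightarrow>
    cmod (f w - f z - (\<Sum>i<n. a i * (w i - z i))) \<le> 1 * dn n w z" using cddD[OF a, of 1] by auto
  let ?C = "1 + (\<Sum>i<n. cmod (a i))"
  have "cmod (f w - f z) \<le> ?C * dn n w z" if w: "w \<in> Cn n" "dn n w z < \<delta>" for w
  proof -
    have "cmod (\<Sum>i<n. a i * (w i - z i)) \<le> (\<Sum>i<n. cmod (a i) * dn n w z)"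
      by (intro sum_norm_le) (auto simp: norm_mult intro!: mult_left_mono cmod_le_dn)
    then have "cmod (\<Sum>i<n. a i * (w i - z i)) \<le> (\<Sum>i<n. cmod (a i)) * dn n w z"
      by (simp add: sum_distrib_right)
    moreover have "cmod (f w - f z) \<le> cmod (f w - f z - (\<Sum>i<n. a i * (w i - z i))) +
       cmod (\<Sum>i<n. a i * (w i - z i))"
      using norm_triangle_ineq[of "f w - f z - (\<Sum>i<n. a i * (w i - z i))" "\<Sum>i<n. a i * (w i - z i)"]
      by simp
    ultimately show ?thesis using \<delta>(2)[OF w] by (simp add: algebra_simps)
  qed
  moreover have "?C > 0" by (intro add_pos_nonneg sum_nonneg) auto
  ultimately show ?thesis using \<delta>(1) by blast
qed

lemma cd_vector_lipschitz:
  assumes "\<And>j. j < m \<Longrightarrow> cd n (\<lambda>w. G w j) z"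
  shows "\<exists>C>0. \<exists>\<delta>>0. \<forall>w\<in>Cn n. dn n w z < \<delta> \<longrightarrow> dn m (G w) (G z) \<le> C * dn n w z"
proof -
  have "\<exists>C \<delta>. C > 0 \<and> \<delta> > 0 \<and> (\<forall>w\<in>Cn n. dn n w z < \<delta> \<longrightarrow> cmod (G w j - G z j) \<le> C * dn n w z)"
    if "j < m" for j
    using cd_lipschitz[OF assms[OF that]] by blast
  then obtain C \<delta> where *: "\<And>j. j < m \<Longrightarrow> C j > 0" "\<And>j. j < m \<Longrightarrow> \<delta> j > 0"
    "\<And>j w. j < m \<Longrightarrow> w \<in> Cn n \<Longrightarrow> dn n w z < \<delta> j \<Longrightarrow> cmod (G w j - G z j) \<le> C j * dn n w z"
    by metis
  define D where "D = 1 + (\<Sum>j<m. C j)"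
  define d where "d = Min (insert 1 (\<delta> ` {..<m}))"
  have sC: "0 \<le> (\<Sum>j<m. C j)" using *(1) by (intro sum_nonneg) (auto intro: less_imp_le)
  have D: "D > 0" "\<And>j. j < m \<Longrightarrow> C j \<le> D"
  proof -
    show "D > 0" using sC by (simp add: D_def)
    fix j assume "j < m"
    then have "C j \<le> (\<Sum>j<m. C j)" using *(1) by (intro member_le_sum) (auto intro: less_imp_le)
    then show "C j \<le> D" by (simp add: D_def)
  qed
  have d: "d > 0" "\<And>j. j < m \<Longrightarrow> d \<le> \<delta> j" using *(2) by (auto simp: d_def)
  have "dn m (G w) (G z) \<le> D * dn n w z" if w: "w \<in> Cn n" "dn n w z < d" for w
  proof (subst dn_le_iff, use D(1) in simp, intro allI impI)
    fix j assume j: "j < m"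
    have "cmod (G w j - G z j) \<le> C j * dn n w z" using *(3)[OF j w(1)] w(2) d(2)[OF j] by linarith
    also have "\<dots> \<le> D * dn n w z" using D(2)[OF j] by (intro mult_right_mono) auto
    finally show "cmod (G w j - G z j) \<le> D * dn n w z" .
  qed
  then show ?thesis using D(1) d(1) by blast
qed

lemma cd_vector_continuous:
  assumes "\<And>j. j < m \<Longrightarrow> cd n (\<lambda>w. G w j) z" "\<epsilon> > 0"
  shows "\<exists>\<delta>>0. \<forall>w\<in>Cn n. dn n w z < \<delta> \<longrightarrow> dn m (G w) (G z) < \<epsilon>"
proof -
  obtain C \<delta> where C: "C > 0" "\<delta> > 0" "\<And>w. w\<in>Cn n \<Longrightarrow> dn n w z < \<delta> \<Longrightarrow> dn m (G w) (G z) \<le> C * dn n w z"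
    using cd_vector_lipschitz[of m n G z] assms(1) by blast
  have "dn m (G w) (G z) < \<epsilon>" if w: "w\<in>Cn n" "dn n w z < min \<delta> (\<epsilon> / C)" for w
  proof -
    have "C * dn n w z < C * (\<epsilon> / C)" using w C(1) by (intro mult_strict_left_mono) auto
    then show ?thesis using C(1) C(3)[of w] w by simp
  qed
  then show ?thesis using C assms(2) by (intro exI[of _ "min \<delta> (\<epsilon> / C)"]) auto
qed

lemma cd_chain:
  assumes "r > 0" and Gm: "\<And>w. w \<in> pd n z r \<Longrightarrow> G w \<in> Cn m"
    and G: "\<And>j. j < m \<Longrightarrow> cd n (\<lambda>w. G w j) z" and f: "cd m f (G z)"
  shows "cd n (\<lambda>w. f (G w)) z"
proof -
  obtain a where a: "cdd m f (G z) a" using f unfolding cd_def by blast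
  obtain b where b: "\<And>j. j < m \<Longrightarrow> cdd n (\<lambda>w. G w j) z (b j)" using G unfolding cd_def by metis
  obtain C \<delta>0 where C: "C > 0" "\<delta>0 > 0"
    "\<And>w. w\<in>Cn n \<Longrightarrow> dn n w z < \<delta>0 \<Longrightarrow> dn m (G w) (G z) \<le> C * dn n w z"
    using cd_vector_lipschitz[of m n G z] G by blast
  define S where "S = 1 + (\<Sum>j<m. cmod (a j))"
  have S: "S > 0" unfolding S_def by (intro add_pos_nonneg sum_nonneg) auto
  have "cdd n (\<lambda>w. f (G w)) z (\<lambda>i. \<Sum>j<m. a j * b j i)"
    unfolding cdd_def
  proof (intro allI impI)
    fix \<epsilon> :: real assume "\<epsilon> > 0"
    \<comment> \<open>Half of the error comes from linearising \<open>f\<close>, scaled by the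
      Lipschitz constant \<open>C\<close> of \<open>G\<close>; the other half from linearising the
      components of \<open>G\<close>, weighted by \<open>S\<close>.\<close>
    have e1: "\<epsilon> / (2 * C) > 0" and e2: "\<epsilon> / (2 * S) > 0" using \<open>\<epsilon> > 0\<close> C S by auto
    obtain \<delta>1 where \<delta>1: "\<delta>1 > 0" "\<And>v. v\<in>Cn m \<Longrightarrow> dn m v (G z) < \<delta>1 \<Longrightarrow>
      cmod (f v - f (G z) - (\<Sum>j<m. a j * (v j - G z j))) \<le> \<epsilon> / (2 * C) * dn m v (G z)"
      using cddD[OF a e1] by blast
    have "\<forall>j. \<exists>\<delta>. j < m \<longrightarrow> \<delta> > 0 \<and> (\<forall>w\<in>Cn n. dn n w z < \<delta> \<longrightarrow>
      cmod (G w j - G z j - (\<Sum>i<n. b j i * (w i - z i))) \<le> \<epsilon> / (2 * S) * dn n w z)"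
      using b e2 unfolding cdd_def by blast
    from choice[OF this] obtain \<delta>2 where \<delta>2: "\<And>j. j < m \<Longrightarrow> \<delta>2 j > 0"
      "\<And>j w. j < m \<Longrightarrow> w\<in>Cn n \<Longrightarrow> dn n w z < \<delta>2 j \<Longrightarrow>
      cmod (G w j - G z j - (\<Sum>i<n. b j i * (w i - z i))) \<le> \<epsilon> / (2 * S) * dn n w z"
      by blast
    define d2 where "d2 = Min (insert 1 (\<delta>2 ` {..<m}))"
    have d2: "d2 > 0" "\<And>j. j < m \<Longrightarrow> d2 \<le> \<delta>2 j" using \<delta>2(1) by (auto simp: d2_def)
    define d where "d = min (min r \<delta>0) (min d2 (\<delta>1 / C))"
    have d: "d > 0" using assms(1) C d2(1) \<delta>1(1) by (auto simp: d_def)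
    have "cmod (f (G w) - f (G z) - (\<Sum>i<n. (\<Sum>j<m. a j * b j i) * (w i - z i))) \<le> \<epsilon> * dn n w z"
      if w: "w \<in> Cn n" "dn n w z < d" for w
    proof -
      let ?F = "f (G w) - f (G z) - (\<Sum>j<m. a j * (G w j - G z j))"
      let ?H = "\<lambda>j. G w j - G z j - (\<Sum>i<n. b j i * (w i - z i))"
      have GC: "dn m (G w) (G z) \<le> C * dn n w z" using C(3)[OF w(1)] w(2) by (simp add: d_def)
      have "C * dn n w z < C * (\<delta>1 / C)" using w C(1) by (intro mult_strict_left_mono) (auto simp: d_def)
      then have G1: "dn m (G w) (G z) < \<delta>1" using GC C(1) by simp
      have "cmod ?F \<le> \<epsilon> / (2 * C) * dn m (G w) (G z)"
        using \<delta>1(2)[OF _ G1] Gm[of w] w by (auto simp: pd_def d_def)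
      also have "\<dots> \<le> \<epsilon> / (2 * C) * (C * dn n w z)" using e1 GC by (intro mult_left_mono) auto
      also have "\<dots> = \<epsilon> / 2 * dn n w z" using C(1) by simp
      finally have F: "cmod ?F \<le> \<epsilon> / 2 * dn n w z" .
      have "cmod (\<Sum>j<m. a j * ?H j) \<le> (\<Sum>j<m. cmod (a j) * (\<epsilon> / (2 * S) * dn n w z))"
      proof (intro sum_norm_le)
        fix j assume "j \<in> {..<m}"
        then have j: "j < m" by simp
        have "dn n w z < \<delta>2 j" using w(2) d2(2)[OF j] by (simp add: d_def)
        then show "cmod (a j * ?H j) \<le> cmod (a j) * (\<epsilon> / (2 * S) * dn n w z)"
          unfolding norm_mult using \<delta>2(2)[OF j w(1)] by (intro mult_left_mono) auto
      qed
      also have "\<dots> = (\<Sum>j<m. cmod (a j)) * (\<epsilon> / (2 * S) * dn n w z)" by (rule sum_distrib_right[symmetric])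
      also have "\<dots> \<le> S * (\<epsilon> / (2 * S) * dn n w z)"
        using e2 by (intro mult_right_mono mult_nonneg_nonneg) (auto simp: S_def)
      also have "\<dots> = \<epsilon> / 2 * dn n w z" using S by simp
      finally have H: "cmod (\<Sum>j<m. a j * ?H j) \<le> \<epsilon> / 2 * dn n w z" .
      have "(\<Sum>i<n. (\<Sum>j<m. a j * b j i) * (w i - z i)) = (\<Sum>j<m. a j * (\<Sum>i<n. b j i * (w i - z i)))"
        by (simp add: sum_distrib_left sum_distrib_right mult.assoc) (rule sum.swap)
      then have "f (G w) - f (G z) - (\<Sum>i<n. (\<Sum>j<m. a j * b j i) * (w i - z i)) = ?F + (\<Sum>j<m. a j * ?H j)"
        by (simp add: right_diff_distrib sum_subtractf)
      then have "cmod (f (G w) - f (G z) - (\<Sum>i<n. (\<Sum>j<m. a j * b j i) * (w i - z i)))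
          = cmod (?F + (\<Sum>j<m. a j * ?H j))" by (simp only:)
      also have "\<dots> \<le> \<epsilon> / 2 * dn n w z + \<epsilon> / 2 * dn n w z" by (rule norm_triangle_mono[OF F H])
      also have "\<dots> = \<epsilon> * dn n w z" by simp
      finally show ?thesis .
    qed
    then show "\<exists>\<delta>>0. \<forall>w\<in>Cn n. dn n w z < \<delta> \<longrightarrow>
      cmod (f (G w) - f (G z) - (\<Sum>i<n. (\<Sum>j<m. a j * b j i) * (w i - z i))) \<le> \<epsilon> * dn n w z"
      using d by blast
  qed
  then show ?thesis unfolding cd_def by blast
qed

section \<open>Cauchy estimates and uniform limits\<close>

definition cline :: "(nat \<Rightarrow> complex) \<Rightarrow> (nat \<Rightarrow> complex) \<Rightarrow> complex \<Rightarrow> nat \<Rightarrow> complex"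
  where "cline z w \<zeta> = (\<lambda>i. z i + \<zeta> * (w i - z i))"

lemma cline_in_Cn: "z \<in> Cn n \<Longrightarrow> w \<in> Cn n \<Longrightarrow> cline z w \<zeta> \<in> Cn n"
  by (auto simp: Cn_def cline_def)

lemma dn_cline: "dn n (cline z w \<zeta>) (cline z w \<xi>) \<le> cmod (\<zeta> - \<xi>) * dn n w z"
proof (subst dn_le_iff, simp, intro allI impI)
  fix i assume "i < n"
  have "cline z w \<zeta> i - cline z w \<xi> i = (\<zeta> - \<xi>) * (w i - z i)"
    by (simp add: cline_def algebra_simps)
  then show "cmod (cline z w \<zeta> i - cline z w \<xi> i) \<le> cmod (\<zeta> - \<xi>) * dn n w z"
    using cmod_le_dn[OF \<open>i < n\<close>, of w z] by (simp add: norm_mult mult_left_mono)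
qed

lemma cline_segment_in_pd:
  assumes "z \<in> pd n a r" "w \<in> pd n a r" "\<zeta> \<in> closed_segment 0 1"
  shows "cline z w \<zeta> \<in> pd n a r"
proof -
  have r: "r > 0" using assms(1) le_less_trans[OF dn_nonneg[of n z a]] by (auto simp: pd_def)
  obtain u where u: "0 \<le> u" "u \<le> 1" "\<zeta> = of_real u"
    using assms(3) by (auto simp: closed_segment_def scaleR_conv_of_real)
  have "cmod (cline z w \<zeta> i - a i) < r" if "i < n" for i
  proof -
    have "z i \<in> ball (a i) r" "w i \<in> ball (a i) r"
      using assms(1,2) that r by (auto simp: pd_def dn_less_iff dist_norm norm_minus_commute)
    moreover have "cline z w \<zeta> i = (1 - u) *\<^sub>R z i + u *\<^sub>R w i"
      by (simp add: cline_def u scaleR_conv_of_real algebra_simps)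
    ultimately have "cline z w \<zeta> i \<in> ball (a i) r"
      using convexD[OF convex_ball, of "z i" "a i" r "w i" "1 - u" u] u by simp
    then show ?thesis by (simp add: dist_norm norm_minus_commute)
  qed
  then show ?thesis using assms r cline_in_Cn[of z n w \<zeta>] by (auto simp: pd_def dn_less_iff)
qed

lemma cd_along_line:
  assumes "z \<in> Cn n" "w \<in> Cn n" "cd n f (cline z w \<zeta>)"
  shows "\<exists>D. ((\<lambda>\<xi>. f (cline z w \<xi>)) has_field_derivative D) (at \<zeta>)"
proof -
  obtain a where a: "cdd n f (cline z w \<zeta>) a" using assms(3) unfolding cd_def by blast
  define D where "D = (\<Sum>i<n. a i * (w i - z i))"
  \<comment> \<open>The added 1 keeps the divisor positive when \<open>z = w\<close>.\<close>
  define d where "d = 1 + dn n w z"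
  have d: "d > 0" "dn n w z \<le> d" using dn_nonneg[of n w z] unfolding d_def by linarith+
  have "((\<lambda>\<xi>. f (cline z w \<xi>)) has_derivative (*) D) (at \<zeta>)"
    unfolding has_derivative_at_alt
  proof (intro conjI allI impI)
    fix e :: real assume "e > 0"
    then have "e / d > 0" using d by simp
    then obtain \<delta> where \<delta>: "\<delta> > 0" "\<And>v. v \<in> Cn n \<Longrightarrow> dn n v (cline z w \<zeta>) < \<delta> \<Longrightarrow>
        cmod (f v - f (cline z w \<zeta>) - (\<Sum>i<n. a i * (v i - cline z w \<zeta> i))) \<le> e / d * dn n v (cline z w \<zeta>)"
      using cddD[OF a] by blast
    have "cmod (f (cline z w \<xi>) - f (cline z w \<zeta>) - D * (\<xi> - \<zeta>)) \<le> e * cmod (\<xi> - \<zeta>)"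
      if \<xi>: "cmod (\<xi> - \<zeta>) < \<delta> / d" for \<xi>
    proof -
      have le: "dn n (cline z w \<xi>) (cline z w \<zeta>) \<le> cmod (\<xi> - \<zeta>) * d"
        using dn_cline[of n z w \<xi> \<zeta>] mult_left_mono[OF d(2), of "cmod (\<xi> - \<zeta>)"] by simp
      also have lt: "cmod (\<xi> - \<zeta>) * d < \<delta>" using \<xi> d by (simp add: pos_less_divide_eq)
      finally have "cmod (f (cline z w \<xi>) - f (cline z w \<zeta>) - (\<Sum>i<n. a i * (cline z w \<xi> i - cline z w \<zeta> i)))
          \<le> e / d * dn n (cline z w \<xi>) (cline z w \<zeta>)"
        using \<delta>(2) cline_in_Cn assms by blast
      also have "\<dots> \<le> e / d * (cmod (\<xi> - \<zeta>) * d)" using le \<open>e / d > 0\<close> by (intro mult_left_mono) auto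
      also have "\<dots> = e * cmod (\<xi> - \<zeta>)" using d by simp
      also have "(\<Sum>i<n. a i * (cline z w \<xi> i - cline z w \<zeta> i)) = D * (\<xi> - \<zeta>)"
        unfolding D_def sum_distrib_right by (intro sum.cong) (auto simp: cline_def algebra_simps)
      finally show ?thesis .
    qed
    then show "\<exists>d>0. \<forall>\<xi>. cmod (\<xi> - \<zeta>) < d \<longrightarrow>
        cmod (f (cline z w \<xi>) - f (cline z w \<zeta>) - D * (\<xi> - \<zeta>)) \<le> e * cmod (\<xi> - \<zeta>)"
      using d \<delta>(1) by (intro exI[of _ "\<delta> / d"]) auto
  qed (rule bounded_linear_mult_right)
  then show ?thesis unfolding has_field_derivative_def by blast
qed

text \<open>Cauchy's estimate for one variable, applied along the complex line through \<open>z\<close> and \<open>w\<close>.\<close>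

lemma cd_bounded_lipschitz:
  assumes f: "\<And>u. u \<in> pd n a R \<Longrightarrow> cd n f u" and M: "\<And>u. u \<in> pd n a R \<Longrightarrow> cmod (f u) \<le> M"
    and z: "z \<in> pd n a r" and w: "w \<in> pd n a r" and "r < R"
  shows "cmod (f w - f z) \<le> M / (R - r) * dn n w z"
proof (cases "w = z")
  case False
  have C: "z \<in> Cn n" "w \<in> Cn n" using z w by (auto simp: pd_def)
  define d where "d = dn n w z"
  have d: "d > 0" using dn_eq_0[OF C(2,1)] False dn_nonneg[of n w z] unfolding d_def by linarith
  \<comment> \<open>A parameter within \<open>\<rho>\<close> of the segment is mapped by the line to
    a point within \<open>R - r\<close> of the polydisc of radius \<open>r\<close>, hence into the
    larger polydisc.\<close>
  define \<rho> where "\<rho> = (R - r) / d"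
  have \<rho>: "\<rho> > 0" using d \<open>r < R\<close> by (simp add: \<rho>_def)
  let ?\<phi> = "\<lambda>\<xi>. f (cline z w \<xi>)"
  have in_pd: "cline z w \<xi> \<in> pd n a R" if "\<zeta> \<in> closed_segment 0 1" "\<xi> \<in> cball \<zeta> \<rho>" for \<zeta> \<xi>
  proof -
    have "cmod (\<xi> - \<zeta>) * d \<le> R - r"
      using that(2) d by (simp add: \<rho>_def dist_norm norm_minus_commute pos_le_divide_eq)
    then have "dn n (cline z w \<xi>) (cline z w \<zeta>) \<le> R - r"
      using dn_cline[of n z w \<xi> \<zeta>] by (simp add: d_def)
    then show ?thesis
      using cline_segment_in_pd[OF z w that(1)] dn_triangle[of n "cline z w \<xi>" a "cline z w \<zeta>"]
        cline_in_Cn[OF C, of \<xi>] by (auto simp: pd_def)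
  qed
  have der: "\<exists>D. (?\<phi> has_field_derivative D) (at \<xi>)"
    if "\<zeta> \<in> closed_segment 0 1" "\<xi> \<in> cball \<zeta> \<rho>" for \<zeta> \<xi>
    using cd_along_line[OF C] f[OF in_pd[OF that]] by blast
  have bound: "cmod (deriv ?\<phi> \<zeta>) \<le> M / \<rho>" if \<zeta>: "\<zeta> \<in> closed_segment 0 1" for \<zeta>
  proof -
    have "?\<phi> holomorphic_on cball \<zeta> \<rho>"
      unfolding holomorphic_on_def field_differentiable_def using der[OF \<zeta>] has_field_derivative_at_within by blast
    then have "cmod ((deriv ^^ 1) ?\<phi> \<zeta>) \<le> fact 1 * M / \<rho> ^ 1"
      using M in_pd[OF \<zeta>] \<rho>
      by (intro Cauchy_inequality holomorphic_on_imp_continuous_on)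
        (auto intro: holomorphic_on_subset simp: dist_norm)
    then show ?thesis by simp
  qed
  have "cmod (?\<phi> 1 - ?\<phi> 0) \<le> M / \<rho> * cmod (1 - 0)"
  proof (rule field_differentiable_bound[of "closed_segment 0 1"])
    fix \<zeta> :: complex assume \<zeta>: "\<zeta> \<in> closed_segment 0 1"
    have "?\<phi> field_differentiable at \<zeta>"
      unfolding field_differentiable_def using der[OF \<zeta>, of \<zeta>] \<rho> by auto
    then show "(?\<phi> has_field_derivative deriv ?\<phi> \<zeta>) (at \<zeta> within closed_segment 0 1)"
      by (simp add: DERIV_deriv_iff_field_differentiable has_field_derivative_at_within)
  qed (use bound in auto)
  moreover have "cline z w 1 = w" "cline z w 0 = z" by (auto simp: cline_def)
  moreover have "M / \<rho> = M / (R - r) * dn n w z" by (simp add: \<rho>_def d_def)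
  ultimately show ?thesis by simp
qed simp

text \<open>Moving only coordinate \<open>i\<close> by a small \<open>t\<close> isolates
  \<open>a i\<close>: the linear part becomes \<open>a i * t\<close>, while the increment of
  \<open>f\<close> is at most \<open>L * t\<close>, up to the differentiability error
  \<open>e * t\<close>.\<close>

lemma cdd_coefficient_bound:
  assumes a: "cdd n f z a" and z: "z \<in> Cn n" and i: "i < n" and "\<delta> > 0" "L \<ge> 0"
    and L: "\<And>w. w \<in> pd n z \<delta> \<Longrightarrow> cmod (f w - f z) \<le> L * dn n w z"
  shows "cmod (a i) \<le> L"
proof (rule field_le_epsilon)
  fix e :: real assume "e > 0"
  then obtain \<eta> where \<eta>: "\<eta> > 0" "\<And>w. w \<in> Cn n \<Longrightarrow> dn n w z < \<eta> \<Longrightarrow>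
      cmod (f w - f z - (\<Sum>i<n. a i * (w i - z i))) \<le> e * dn n w z" using cddD[OF a] by blast
  define t where "t = min \<eta> \<delta> / 2"
  have t: "t > 0" "t < \<eta>" "t < \<delta>" using \<eta>(1) \<open>\<delta> > 0\<close> by (auto simp: t_def)
  define w where "w = z(i := z i + of_real t)"
  have w: "w \<in> Cn n" using z i by (auto simp: w_def Cn_def)
  have dw: "dn n w z = t"
  proof (rule antisym)
    show "dn n w z \<le> t" using t(1) by (auto simp: dn_le_iff w_def)
    show "t \<le> dn n w z" using cmod_le_dn[OF i, of w z] t(1) by (simp add: w_def)
  qed
  have "(\<Sum>j<n. a j * (w j - z j)) = (\<Sum>j<n. if j = i then a i * of_real t else 0)"
    by (intro sum.cong) (auto simp: w_def)
  also have "\<dots> = a i * of_real t" using i by simp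
  finally have s: "(\<Sum>j<n. a j * (w j - z j)) = a i * of_real t" .
  have "cmod (f w - f z - a i * of_real t) \<le> e * t" using \<eta>(2)[OF w] dw t s by simp
  moreover have "cmod (f w - f z) \<le> L * t" using L[of w] w dw t by (simp add: pd_def)
  ultimately have "cmod (a i * of_real t) \<le> L * t + e * t"
    using norm_triangle_sub[of "a i * of_real t" "f w - f z"] by (simp add: norm_minus_commute)
  then have "cmod (a i) * t \<le> (L + e) * t" using t(1) by (simp add: norm_mult distrib_right)
  then show "cmod (a i) \<le> L + e" using t(1) by simp
qed

text \<open>Weierstrass' theorem. The difference of two late approximants is uniformly small, so
  Cauchy's estimate makes its Lipschitz constant small on the half polydisc. This makes the
  coefficients Cauchy sequences and transfers differentiability from one approximant to the
  limit.\<close>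

lemma cd_uniform_limit:
  assumes "R > 0" and a: "a \<in> Cn n" and F: "\<And>k z. z \<in> pd n a R \<Longrightarrow> cd n (F k) z"
    and lim: "uniform_limit (pd n a R) F f sequentially"
  shows "cd n f a"
proof -
  obtain A where A: "\<And>k. cdd n (F k) a (A k)"
    using F centre_in_pd[OF a \<open>R > 0\<close>] unfolding cd_def by metis
  have lip: "cmod ((F k w - F l w) - (F k a - F l a)) \<le> (4 * e / R) * dn n w a"
    if "\<And>z. z \<in> pd n a R \<Longrightarrow> cmod (F k z - f z) \<le> e" "\<And>z. z \<in> pd n a R \<Longrightarrow> cmod (F l z - f z) \<le> e"
      "w \<in> pd n a (R / 2)" for k l e w
  proof -
    have "cmod ((F k w - F l w) - (F k a - F l a)) \<le> (2 * e) / (R - R / 2) * dn n w a"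
    proof (rule cd_bounded_lipschitz[where f = "\<lambda>z. F k z - F l z" and a = a])
      fix u assume u: "u \<in> pd n a R"
      show "cd n (\<lambda>z. F k z - F l z) u" using F[OF u] by (intro cd_diff)
      show "cmod (F k u - F l u) \<le> 2 * e"
        using norm_triangle_ineq4[of "F k u - f u" "F l u - f u"] that(1,2)[OF u] by simp
    qed (use that(3) a \<open>R > 0\<close> in \<open>auto simp: centre_in_pd\<close>)
    then show ?thesis using \<open>R > 0\<close> by (simp add: field_simps)
  qed
  have close: "\<exists>N. \<forall>k\<ge>N. \<forall>z\<in>pd n a R. cmod (F k z - f z) \<le> e" if "e > 0" for e
    using uniform_limitD[OF lim that] unfolding eventually_sequentially dist_norm
    by (meson less_imp_le)
  have coeff: "cmod (A k i - A l i) \<le> 4 * e / R"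
    if "\<And>z. z \<in> pd n a R \<Longrightarrow> cmod (F k z - f z) \<le> e" "\<And>z. z \<in> pd n a R \<Longrightarrow> cmod (F l z - f z) \<le> e"
      "e > 0" "i < n" for k l e i
  proof -
    have "cdd n (\<lambda>w. 1 * F k w + (-1) * F l w) a (\<lambda>i. 1 * A k i + (-1) * A l i)"
      by (intro cdd_lincomb A)
    then have "cdd n (\<lambda>w. F k w - F l w) a (\<lambda>i. A k i - A l i)" by simp
    from cdd_coefficient_bound[OF this a that(4), of "R / 2" "4 * e / R"] show ?thesis
      using lip[OF that(1,2)] \<open>R > 0\<close> that(3) by simp
  qed
  have "Cauchy (\<lambda>k. A k i)" if i: "i < n" for i
    unfolding Cauchy_def dist_norm
  proof (intro allI impI)
    fix e :: real assume "e > 0"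
    then have e': "e * R / 8 > 0" using \<open>R > 0\<close> by simp
    obtain N where N: "\<And>k z. k \<ge> N \<Longrightarrow> z\<in>pd n a R \<Longrightarrow> cmod (F k z - f z) \<le> e * R / 8" using close[OF e'] by blast
    have "cmod (A k i - A l i) < e" if "k \<ge> N" "l \<ge> N" for k l
    proof -
      have "cmod (A k i - A l i) \<le> 4 * (e * R / 8) / R" using coeff[OF N N e' i] that by blast
      also have "\<dots> < e" using \<open>e > 0\<close> \<open>R > 0\<close> by simp
      finally show ?thesis .
    qed
    then show "\<exists>M. \<forall>m\<ge>M. \<forall>n\<ge>M. cmod (A m i - A n i) < e" by blast
  qed
  then have "\<exists>\<alpha>. (\<lambda>k. A k i) \<longlonglongrightarrow> \<alpha>" if "i < n" for i
    using that Cauchy_convergent convergent_def by blast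
  then obtain \<alpha> where \<alpha>: "\<And>i. i < n \<Longrightarrow> (\<lambda>k. A k i) \<longlonglongrightarrow> \<alpha> i" by metis
  have pw: "(\<lambda>k. F k z) \<longlonglongrightarrow> f z" if "z \<in> pd n a R" for z
    using tendsto_uniform_limitI[OF lim that] .
  have "cdd n f a \<alpha>"
    unfolding cdd_def
  proof (intro allI impI)
    fix \<epsilon> :: real assume "\<epsilon> > 0"
    \<comment> \<open>Three contributions to the error: \<open>e\<close> from the differentiability
      of \<open>F N\<close>, \<open>4 * e / R\<close> from the Lipschitz bound for
      \<open>f - F N\<close>, and \<open>n\<close> times the latter from the coefficients.\<close>
    define c where "c = 1 + 4 * (real n + 1) / R"
    have c: "c > 0" using \<open>R > 0\<close> by (auto simp: c_def intro!: add_pos_nonneg)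
    define e where "e = \<epsilon> / c"
    have e: "e > 0" using c \<open>\<epsilon> > 0\<close> by (simp add: e_def)
    have ce: "c * e = \<epsilon>" using c unfolding e_def by simp
    obtain N where N: "\<And>k z. k \<ge> N \<Longrightarrow> z\<in>pd n a R \<Longrightarrow> cmod (F k z - f z) \<le> e" using close[OF e] by blast
    \<comment> \<open>The Lipschitz bound for \<open>F k - F N\<close> survives the limit in
      \<open>k\<close>, although differentiability of \<open>f\<close> is not yet known.\<close>
    have lipN: "cmod ((f w - F N w) - (f a - F N a)) \<le> (4 * e / R) * dn n w a" if w: "w \<in> pd n a (R / 2)" for w
    proof (rule tendsto_upperbound)
      have "w \<in> pd n a R" using w \<open>R > 0\<close> pd_mono[of "R/2" R n a] by auto
      then show "(\<lambda>k. cmod ((F k w - F N w) - (F k a - F N a))) \<longlonglongrightarrow> cmod ((f w - F N w) - (f a - F N a))"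
        using centre_in_pd[OF a \<open>R > 0\<close>] by (intro tendsto_intros pw)
      show "\<forall>\<^sub>F k in sequentially. cmod ((F k w - F N w) - (F k a - F N a)) \<le> (4 * e / R) * dn n w a"
        using lip[OF N N w] by (intro eventually_sequentiallyI[of N]) auto
    qed simp
    have coeffN: "cmod (A N i - \<alpha> i) \<le> 4 * e / R" if "i < n" for i
    proof (rule tendsto_upperbound)
      show "(\<lambda>k. cmod (A N i - A k i)) \<longlonglongrightarrow> cmod (A N i - \<alpha> i)" by (intro tendsto_intros \<alpha> that)
      show "\<forall>\<^sub>F k in sequentially. cmod (A N i - A k i) \<le> 4 * e / R"
        using coeff[OF N N e that] by (intro eventually_sequentiallyI[of N]) auto
    qed simp
    obtain \<delta> where \<delta>: "\<delta> > 0" "\<And>w. w \<in> Cn n \<Longrightarrow> dn n w a < \<delta> \<Longrightarrow>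
        cmod (F N w - F N a - (\<Sum>i<n. A N i * (w i - a i))) \<le> e * dn n w a" using cddD[OF A e] by blast
    have "cmod (f w - f a - (\<Sum>i<n. \<alpha> i * (w i - a i))) \<le> \<epsilon> * dn n w a"
      if w: "w \<in> Cn n" "dn n w a < min \<delta> (R / 2)" for w
    proof -
      let ?P = "(f w - F N w) - (f a - F N a)" and ?Q = "F N w - F N a - (\<Sum>i<n. A N i * (w i - a i))"
      let ?S = "\<Sum>i<n. (A N i - \<alpha> i) * (w i - a i)"
      have "cmod ?S \<le> (\<Sum>i<n. (4 * e / R) * dn n w a)"
        using coeffN cmod_le_dn e \<open>R > 0\<close>
        by (intro sum_norm_le) (simp only: norm_mult, intro mult_mono, auto)
      then have S: "cmod ?S \<le> real n * (4 * e / R) * dn n w a" by simp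
      have P: "cmod ?P \<le> (4 * e / R) * dn n w a" using lipN w by (auto simp: pd_def)
      have Q: "cmod ?Q \<le> e * dn n w a" using \<delta>(2)[OF w(1)] w(2) by simp
      have "f w - f a - (\<Sum>i<n. \<alpha> i * (w i - a i)) = ?P + (?Q + ?S)"
        by (simp add: left_diff_distrib sum_subtractf)
      then have "cmod (f w - f a - (\<Sum>i<n. \<alpha> i * (w i - a i))) \<le> cmod ?P + (cmod ?Q + cmod ?S)"
        using order_trans[OF norm_triangle_ineq[of ?P "?Q + ?S"] add_left_mono[OF norm_triangle_ineq[of ?Q ?S]]]
        by (simp only:)
      also have "\<dots> \<le> (4 * e / R) * dn n w a + (e * dn n w a + real n * (4 * e / R) * dn n w a)"
        using P Q S by linarith
      also have "\<dots> = c * e * dn n w a"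
      proof -
        have "c * e = e + (real n + 1) * (4 * e / R)" by (simp add: c_def distrib_right)
        then show ?thesis by (simp only: distrib_right)
      qed
      also have "\<dots> = \<epsilon> * dn n w a" by (simp only: ce)
      finally show ?thesis .
    qed
    then show "\<exists>\<delta>>0. \<forall>w\<in>Cn n. dn n w a < \<delta> \<longrightarrow>
        cmod (f w - f a - (\<Sum>i<n. \<alpha> i * (w i - a i))) \<le> \<epsilon> * dn n w a"
      using \<delta>(1) \<open>R > 0\<close> by (intro exI[of _ "min \<delta> (R / 2)"]) auto
  qed
  then show ?thesis unfolding cd_def by blast
qed

section \<open>Holomorphic functions on manifolds\<close>

text \<open>Differentiability at the single point \<open>x\<close>, not in a neighbourhood of it. In
  this form holomorphy can be moved point by point between charts and, later, between the copies of
  the manifold.\<close>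

definition holo_at :: "'a complex_mfd \<Rightarrow> ('a \<Rightarrow> complex) \<Rightarrow> 'a \<Rightarrow> bool"
  where "holo_at M f x \<longleftrightarrow>
    (\<forall>(U, \<phi>) \<in> mfd_atlas M. x \<in> U \<longrightarrow> cd (mfd_dim M) (f \<circ> inv_into U \<phi>) (\<phi> x))"

locale cmfd =
  fixes M :: "'a complex_mfd"
  assumes manifold: "complex_manifold M"
begin

abbreviation dm where "dm \<equiv> mfd_dim M"
abbreviation tp where "tp \<equiv> mfd_top M"

lemma Hausdorff: "Hausdorff_space tp" and second_countable: "second_countable tp"
  using manifold by (auto simp: complex_manifold_def)

lemma chart_at:
  assumes "x \<in> points M"
  obtains U \<phi> where "(U, \<phi>) \<in> mfd_atlas M" "x \<in> U"
proof -
  have "x \<in> (\<Union>(U, \<phi>) \<in> mfd_atlas M. U)" using assms manifold unfolding complex_manifold_def by simp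
  then show ?thesis using that by auto
qed

section \<open>Charts\<close>

context
  fixes U \<phi> assumes chart: "(U, \<phi>) \<in> mfd_atlas M"
begin

lemma
  shows chart_open: "openin tp U"
    and chart_image_open: "openin (Complex_space dm) (\<phi> ` U)"
    and chart_homeo: "homeomorphic_map (subtopology tp U)
        (subtopology (Complex_space dm) (\<phi> ` U)) \<phi>"
  using manifold chart by (auto simp: complex_manifold_def)

lemma chart_subset: "U \<subseteq> points M"
  using chart_open openin_subset by blast

lemma chart_topspace: "topspace (subtopology tp U) = U"
  using chart_subset by auto

lemma chart_inj: "inj_on \<phi> U"
  using chart_homeo chart_topspace by (metis homeomorphic_imp_injective_map)

lemma chart_image_subset: "\<phi> ` U \<subseteq> Cn dm"
  using openin_subset[OF chart_image_open] by simp

lemma chart_in_Cn: "x \<in> U \<Longrightarrow> \<phi> x \<in> Cn dm"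
  using chart_image_subset by auto

lemma chart_inv [simp]: "x \<in> U \<Longrightarrow> inv_into U \<phi> (\<phi> x) = x"
  using chart_inj by simp

lemma chart_open_image:
  assumes "openin tp W" "W \<subseteq> U"
  shows "openin (Complex_space dm) (\<phi> ` W)"
proof -
  have "openin (subtopology tp U) W"
    using assms chart_open by (simp add: openin_open_subtopology)
  then have "openin (subtopology (Complex_space dm) (\<phi> ` U)) (\<phi> ` W)"
    using homeomorphic_imp_open_map[OF chart_homeo] by (auto simp: open_map_def)
  then show ?thesis using chart_image_open by (simp add: openin_open_subtopology)
qed

lemma chart_open_vimage:
  assumes "openin (Complex_space dm) B"
  shows "openin tp {x \<in> U. \<phi> x \<in> B}"
proof -
  have "continuous_map (subtopology tp U) (Complex_space dm) \<phi>"
    using homeomorphic_imp_continuous_map[OF chart_homeo] by (simp add: continuous_map_in_subtopology)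
  then have "openin (subtopology tp U) {x \<in> topspace (subtopology tp U). \<phi> x \<in> B}"
    using assms by (rule openin_continuous_map_preimage)
  then show ?thesis using chart_open unfolding chart_topspace by (simp add: openin_open_subtopology)
qed

lemma chart_inv_continuous:
  "continuous_map (subtopology (Complex_space dm) (\<phi> ` U)) tp (inv_into U \<phi>)"
proof -
  obtain \<psi> where \<psi>: "homeomorphic_maps (subtopology tp U)
      (subtopology (Complex_space dm) (\<phi> ` U)) \<phi> \<psi>"
    using chart_homeo homeomorphic_map_maps by blast
  have "continuous_map (subtopology (Complex_space dm) (\<phi> ` U)) tp \<psi>"
    using \<psi> by (simp add: homeomorphic_maps_def continuous_map_in_subtopology)
  then show ?thesis
  proof (rule continuous_map_eq)
    fix z assume "z \<in> topspace (subtopology (Complex_space dm) (\<phi> ` U))"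
    then obtain x where "x \<in> U" "z = \<phi> x" by auto
    then show "\<psi> z = inv_into U \<phi> z"
      using \<psi> chart_topspace unfolding homeomorphic_maps_def by auto
  qed
qed

lemma chart_pd_in:
  assumes "openin tp W" "x \<in> W" "x \<in> U"
  obtains r where "r > 0" "pd dm (\<phi> x) r \<subseteq> \<phi> ` (U \<inter> W)"
proof -
  have "openin (Complex_space dm) (\<phi> ` (U \<inter> W))"
    using assms(1) chart_open by (intro chart_open_image) auto
  then show ?thesis using that assms(2,3) unfolding openin_Complex_space by blast
qed

text \<open>The set is the image of a compact closed polydisc under the continuous inverse
  chart.\<close>

lemma compactin_chart_pd:
  assumes "{z \<in> Cn dm. dn dm z a \<le> r} \<subseteq> \<phi> ` U"
  shows "compactin tp {x \<in> U. dn dm (\<phi> x) a \<le> r}"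
proof -
  let ?B = "{z \<in> Cn dm. dn dm z a \<le> r}"
  have "compactin (subtopology (Complex_space dm) (\<phi> ` U)) ?B"
    using assms compactin_closed_pd by (simp add: compactin_subtopology)
  then have "compactin tp (inv_into U \<phi> ` ?B)"
    using image_compactin chart_inv_continuous by blast
  moreover have "inv_into U \<phi> ` ?B = {x \<in> U. dn dm (\<phi> x) a \<le> r}" (is "_ = ?C")
  proof
    show "inv_into U \<phi> ` ?B \<subseteq> ?C"
      using assms by (auto simp: inv_into_into f_inv_into_f subset_iff)
    show "?C \<subseteq> inv_into U \<phi> ` ?B"
    proof
      fix x assume x: "x \<in> ?C"
      then have "\<phi> x \<in> ?B" using chart_in_Cn by auto
      then have "inv_into U \<phi> (\<phi> x) \<in> inv_into U \<phi> ` ?B" by blast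
      then show "x \<in> inv_into U \<phi> ` ?B" using x by simp
    qed
  qed
  ultimately show ?thesis by simp
qed

end

text \<open>The chain rule along a transition map carries differentiability from one chart to any
  other, so a single chart suffices.\<close>

lemma holo_at_chart:
  assumes chart: "(U, \<phi>) \<in> mfd_atlas M" "x \<in> U"
  shows "holo_at M f x \<longleftrightarrow> cd dm (f \<circ> inv_into U \<phi>) (\<phi> x)"
proof
  show "holo_at M f x \<Longrightarrow> cd dm (f \<circ> inv_into U \<phi>) (\<phi> x)"
    using assms unfolding holo_at_def by auto
  assume f: "cd dm (f \<circ> inv_into U \<phi>) (\<phi> x)"
  show "holo_at M f x" unfolding holo_at_def
  proof (intro ballI, clarify)
    fix V \<psi> assume V: "(V, \<psi>) \<in> mfd_atlas M" "x \<in> V"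
    obtain r where r: "r > 0" "pd dm (\<psi> x) r \<subseteq> \<psi> ` (V \<inter> U)"
      using chart_pd_in[OF V(1) chart_open[OF chart(1)] chart(2) V(2)] .
    have "\<forall>(U, \<phi>) \<in> mfd_atlas M. \<forall>(V, \<psi>) \<in> mfd_atlas M.
        holo_map dm dm (\<phi> ` (U \<inter> V)) (\<psi> \<circ> inv_into U \<phi>)"
      using manifold unfolding complex_manifold_def by (elim conjE)
    from bspec[OF bspec[OF this V(1), simplified] chart(1)]
    have "holo_map dm dm (\<psi> ` (V \<inter> U)) (\<phi> \<circ> inv_into V \<psi>)" by simp
    then have G: "cd dm (\<lambda>z. (\<phi> \<circ> inv_into V \<psi>) z j) (\<psi> x)" if "j < dm" for j
      using that chart(2) V(2) unfolding holo_map_def holo_fun_iff by blast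
    have c: "cd dm (\<lambda>z. (f \<circ> inv_into U \<phi>) ((\<phi> \<circ> inv_into V \<psi>) z)) (\<psi> x)"
    proof (rule cd_chain[OF r(1) _ G])
      show "(\<phi> \<circ> inv_into V \<psi>) w \<in> Cn dm" if "w \<in> pd dm (\<psi> x) r" for w
        using that r(2) chart_in_Cn[OF chart(1)] chart_inv[OF V(1)] by auto
      show "cd dm (f \<circ> inv_into U \<phi>) ((\<phi> \<circ> inv_into V \<psi>) (\<psi> x))"
        using f chart_inv[OF V] by simp
    qed
    show "cd dm (f \<circ> inv_into V \<psi>) (\<psi> x)"
    proof (rule iffD1[OF cd_cong[OF r(1) chart_in_Cn[OF V]] c])
      fix w assume "w \<in> pd dm (\<psi> x) r"
      then obtain y where "y \<in> V" "y \<in> U" "w = \<psi> y" using r(2) by blast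
      then show "(f \<circ> inv_into U \<phi>) ((\<phi> \<circ> inv_into V \<psi>) w) = (f \<circ> inv_into V \<psi>) w"
        using chart_inv[OF V(1)] chart_inv[OF chart(1)] by simp
    qed
  qed
qed

lemma holo_at_cong:
  assumes "openin tp W" "x \<in> W" "\<And>y. y \<in> W \<Longrightarrow> f y = g y"
  shows "holo_at M f x \<longleftrightarrow> holo_at M g x"
proof -
  obtain U \<phi> where U: "(U, \<phi>) \<in> mfd_atlas M" "x \<in> U"
    using chart_at openin_subset assms(1,2) by blast
  obtain r where r: "r > 0" "pd dm (\<phi> x) r \<subseteq> \<phi> ` (U \<inter> W)"
    using chart_pd_in[OF U(1) assms(1,2) U(2)] .
  show ?thesis
    unfolding holo_at_chart[OF U]
    using r(2) chart_inv[OF U(1)] assms(3)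
    by (intro cd_cong[OF r(1) chart_in_Cn[OF U]]) auto
qed

lemma holo_at_lincomb:
  "holo_at M f x \<Longrightarrow> holo_at M g x \<Longrightarrow> holo_at M (\<lambda>y. c * f y + d * g y) x"
  unfolding holo_at_def o_def by (clarify, rule cd_lincomb) auto

lemma holo_at_continuous:
  assumes "holo_at M f x" "x \<in> points M" "\<epsilon> > 0"
  obtains W where "openin tp W" "x \<in> W" "\<And>y. y \<in> W \<Longrightarrow> cmod (f y - f x) < \<epsilon>"
proof -
  obtain U \<phi> where U: "(U, \<phi>) \<in> mfd_atlas M" "x \<in> U" using chart_at assms(2) by blast
  obtain C \<delta> where C: "C > 0" "\<delta> > 0" "\<And>w. w \<in> Cn dm \<Longrightarrow> dn dm w (\<phi> x) < \<delta> \<Longrightarrow>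
      cmod ((f \<circ> inv_into U \<phi>) w - (f \<circ> inv_into U \<phi>) (\<phi> x)) \<le> C * dn dm w (\<phi> x)"
    using cd_lipschitz[OF iffD1[OF holo_at_chart[OF U] assms(1)]] by blast
  let ?W = "{y \<in> U. \<phi> y \<in> pd dm (\<phi> x) (min \<delta> (\<epsilon> / C))}"
  show ?thesis
  proof
    show "openin tp ?W" by (rule chart_open_vimage[OF U(1) openin_pd])
    show "x \<in> ?W" using U C assms(3) chart_in_Cn[OF U] by (auto intro!: centre_in_pd)
    fix y assume y: "y \<in> ?W"
    then have "cmod (f y - f x) \<le> C * dn dm (\<phi> y) (\<phi> x)"
      using C(3)[of "\<phi> y"] chart_inv[OF U(1)] U(2) by (auto simp: pd_def)
    also have "\<dots> < C * (\<epsilon> / C)" using y C(1) by (intro mult_strict_left_mono) (auto simp: pd_def)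
    finally show "cmod (f y - f x) < \<epsilon>" using C(1) by simp
  qed
qed

lemma holo_continuous_map:
  assumes "\<And>x. x \<in> points M \<Longrightarrow> holo_at M f x"
  shows "continuous_map tp euclidean f"
  unfolding continuous_map
proof (intro conjI allI impI)
  fix S :: "complex set" assume "openin euclidean S"
  then have S: "open S" by (simp only: open_openin)
  show "openin tp {x \<in> points M. f x \<in> S}"
  proof (subst openin_subopen, intro ballI)
    fix x assume x: "x \<in> {x \<in> points M. f x \<in> S}"
    then obtain e where e: "e > 0" "ball (f x) e \<subseteq> S" using S open_contains_ball by blast
    obtain W where W: "openin tp W" "x \<in> W" "\<And>y. y \<in> W \<Longrightarrow> cmod (f y - f x) < e"
      using holo_at_continuous[OF assms _ e(1), of x] x by blast
    then have "W \<subseteq> {x \<in> points M. f x \<in> S}"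
      using e(2) openin_subset[OF W(1)] by (force simp: dist_norm norm_minus_commute)
    then show "\<exists>T. openin tp T \<and> x \<in> T \<and> T \<subseteq> {x \<in> points M. f x \<in> S}" using W by blast
  qed
qed auto

lemma holomorphic_function_iff:
  "holomorphic_function M f \<longleftrightarrow> (\<forall>x\<in>points M. holo_at M f x)"
proof
  assume f: "holomorphic_function M f"
  show "\<forall>x\<in>points M. holo_at M f x"
  proof
    fix x assume "x \<in> points M"
    then obtain U \<phi> where U: "(U, \<phi>) \<in> mfd_atlas M" "x \<in> U" using chart_at by blast
    have "holo_fun dm (\<phi> ` U) (f \<circ> inv_into U \<phi>)"
      using f U(1) unfolding holomorphic_function_def by blast
    then show "holo_at M f x" unfolding holo_at_chart[OF U] holo_fun_iff using U by blast
  qed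
next
  assume f: "\<forall>x\<in>points M. holo_at M f x"
  show "holomorphic_function M f" unfolding holomorphic_function_def
  proof (intro ballI, clarify)
    fix U \<phi> assume U: "(U, \<phi>) \<in> mfd_atlas M"
    show "holo_fun dm (\<phi> ` U) (f \<circ> inv_into U \<phi>)"
      unfolding holo_fun_iff
      using f holo_at_chart[OF U] chart_image_open[OF U] chart_subset[OF U] by blast
  qed
qed

lemma holo_function_continuous: "holomorphic_function M f \<Longrightarrow> continuous_map tp euclidean f"
  using holo_continuous_map holomorphic_function_iff by blast

lemma holo_at_uniform_limit:
  assumes W: "openin tp W" "x \<in> W" and F: "\<And>k y. y \<in> W \<Longrightarrow> holo_at M (F k) y"
    and lim: "uniform_limit W F f sequentially"
  shows "holo_at M f x"
proof -
  obtain U \<phi> where U: "(U, \<phi>) \<in> mfd_atlas M" "x \<in> U"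
    using chart_at openin_subset[OF W(1)] W(2) by blast
  obtain r where r: "r > 0" "pd dm (\<phi> x) r \<subseteq> \<phi> ` (U \<inter> W)"
    using chart_pd_in[OF U(1) W U(2)] .
  show ?thesis
    unfolding holo_at_chart[OF U]
  proof (rule cd_uniform_limit[OF r(1) chart_in_Cn[OF U]])
    fix k z assume "z \<in> pd dm (\<phi> x) r"
    then obtain y where "y \<in> U" "y \<in> W" "z = \<phi> y" using r(2) by blast
    then show "cd dm (F k \<circ> inv_into U \<phi>) z" using F holo_at_chart[OF U(1)] by blast
  next
    have "inv_into U \<phi> z \<in> W" if "z \<in> pd dm (\<phi> x) r" for z
      using that r(2) chart_inv[OF U(1)] by force
    then show "uniform_limit (pd dm (\<phi> x) r) (\<lambda>k. F k \<circ> inv_into U \<phi>)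
        (f \<circ> inv_into U \<phi>) sequentially"
      using lim unfolding uniform_limit_iff o_def by (smt (verit) eventually_mono)
  qed
qed

section \<open>Compact neighbourhoods and exhaustion\<close>

lemma compact_neighbourhood:
  assumes "openin tp W" "x \<in> W"
  obtains V C where "openin tp V" "compactin tp C" "x \<in> V" "V \<subseteq> C" "C \<subseteq> W"
proof -
  obtain U \<phi> where U: "(U, \<phi>) \<in> mfd_atlas M" "x \<in> U"
    using chart_at openin_subset[OF assms(1)] assms(2) by blast
  obtain r where r: "r > 0" "pd dm (\<phi> x) r \<subseteq> \<phi> ` (U \<inter> W)"
    using chart_pd_in[OF U(1) assms U(2)] .
  have *: "{z \<in> Cn dm. dn dm z (\<phi> x) \<le> r / 2} \<subseteq> pd dm (\<phi> x) r"
    using r(1) by (auto simp: pd_def)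
  show ?thesis
  proof
    show "openin tp {y \<in> U. \<phi> y \<in> pd dm (\<phi> x) (r / 2)}"
      by (rule chart_open_vimage[OF U(1) openin_pd])
    show "compactin tp {y \<in> U. dn dm (\<phi> y) (\<phi> x) \<le> r / 2}"
      using * r(2) by (intro compactin_chart_pd[OF U(1)]) blast
    show "x \<in> {y \<in> U. \<phi> y \<in> pd dm (\<phi> x) (r / 2)}"
      using U r(1) chart_in_Cn[OF U] by (auto intro: centre_in_pd)
    show "{y \<in> U. \<phi> y \<in> pd dm (\<phi> x) (r / 2)} \<subseteq> {y \<in> U. dn dm (\<phi> y) (\<phi> x) \<le> r / 2}"
      by (auto simp: pd_def)
    show "{y \<in> U. dn dm (\<phi> y) (\<phi> x) \<le> r / 2} \<subseteq> W"
    proof clarify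
      fix y assume y: "y \<in> U" "dn dm (\<phi> y) (\<phi> x) \<le> r / 2"
      then have "\<phi> y \<in> \<phi> ` (U \<inter> W)" using * r(2) chart_in_Cn[OF U(1)] by blast
      then show "y \<in> W" using y(1) chart_inj[OF U(1)] by (auto dest: inj_onD)
    qed
  qed
qed

text \<open>The manifold is a Lindelof space, so countably many open sets lying in compact sets
  cover it; \<open>E k\<close> is the finite union of the compact sets numbered up to
  \<open>k\<close>. The last conclusion puts a whole neighbourhood into some \<open>E k\<close>, as
  locally uniform convergence requires.\<close>

lemma compact_exhaustion:
  obtains E :: "nat \<Rightarrow> 'a set" where "\<And>k. compactin tp (E k)"
    "\<And>k l. k \<le> l \<Longrightarrow> E k \<subseteq> E l"
    "\<And>x. x \<in> points M \<Longrightarrow> \<exists>k V. openin tp V \<and> x \<in> V \<and> V \<subseteq> E k"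
proof -
  define N where "N = {V. openin tp V \<and> (\<exists>C. compactin tp C \<and> V \<subseteq> C)}"
  have "\<Union>N = points M"
  proof
    show "\<Union>N \<subseteq> points M" using openin_subset unfolding N_def by blast
    show "points M \<subseteq> \<Union>N"
    proof
      fix x assume "x \<in> points M"
      then obtain V C where "openin tp V" "compactin tp C" "x \<in> V" "V \<subseteq> C"
        using compact_neighbourhood[OF openin_topspace] by metis
      then show "x \<in> \<Union>N" unfolding N_def by blast
    qed
  qed
  then have "\<exists>\<V>. countable \<V> \<and> \<V> \<subseteq> N \<and> \<Union>\<V> = points M"
    using second_countable_imp_Lindelof_space[OF second_countable, unfolded Lindelof_space_def, rule_format, of N]
    by (simp add: N_def)
  then obtain \<V> where "countable \<V> \<and> \<V> \<subseteq> N \<and> \<Union>\<V> = points M" ..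
  then have \<V>: "countable \<V>" "\<V> \<subseteq> N" "\<Union>\<V> = points M" by auto
  have "\<exists>C. \<forall>V\<in>\<V>. compactin tp (C V) \<and> V \<subseteq> C V" using \<V>(2) unfolding N_def by (intro bchoice) blast
  then obtain C where C: "\<And>V. V \<in> \<V> \<Longrightarrow> compactin tp (C V)" "\<And>V. V \<in> \<V> \<Longrightarrow> V \<subseteq> C V" by blast
  define E where "E k = \<Union>(C ` {V \<in> \<V>. to_nat_on \<V> V \<le> k})" for k
  show ?thesis
  proof (rule that)
    fix k
    have "finite {V \<in> \<V>. to_nat_on \<V> V \<le> k}"
    proof (rule inj_on_finite)
      show "inj_on (to_nat_on \<V>) {V \<in> \<V>. to_nat_on \<V> V \<le> k}"
        using inj_on_to_nat_on[OF \<V>(1)] by (rule inj_on_subset) auto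
      show "to_nat_on \<V> ` {V \<in> \<V>. to_nat_on \<V> V \<le> k} \<subseteq> {..k}" by auto
    qed auto
    then show "compactin tp (E k)"
      unfolding E_def using C(1) by (intro compactin_Union) auto
  next
    show "k \<le> l \<Longrightarrow> E k \<subseteq> E l" for k l unfolding E_def by force
  next
    fix x assume "x \<in> points M"
    then obtain V where V: "V \<in> \<V>" "x \<in> V" using \<V>(3) by blast
    moreover have "V \<subseteq> E (to_nat_on \<V> V)" unfolding E_def using C(2)[OF V(1)] V(1) by blast
    ultimately show "\<exists>k V. openin tp V \<and> x \<in> V \<and> V \<subseteq> E k" using \<V>(2) unfolding N_def by blast
  qed
qed

end

text \<open>Charts remain on the target side only; on the source side \<open>holo_at\<close> is
  already independent of them.\<close>

lemma holomorphic_map_iff: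
  assumes "complex_manifold M" "complex_manifold N"
  shows "holomorphic_map M N F \<longleftrightarrow> continuous_map (mfd_top M) (mfd_top N) F \<and>
    (\<forall>x\<in>points M. \<forall>(V, \<psi>)\<in>mfd_atlas N. F x \<in> V \<longrightarrow> (\<forall>j<mfd_dim N. holo_at M (\<lambda>y. \<psi> (F y) j) x))"
proof -
  interpret M: cmfd M using assms(1) by unfold_locales
  interpret N: cmfd N using assms(2) by unfold_locales
  show ?thesis
  proof (rule iffI)
    assume F: "holomorphic_map M N F"
    have "holo_at M (\<lambda>y. \<psi> (F y) j) x"
      if x: "x \<in> points M" and V: "(V, \<psi>) \<in> mfd_atlas N" "F x \<in> V" "j < mfd_dim N" for x V \<psi> j
    proof -
      obtain U \<phi> where U: "(U, \<phi>) \<in> mfd_atlas M" "x \<in> U" using M.chart_at x by blast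
      have "\<forall>(U, \<phi>) \<in> mfd_atlas M. \<forall>(V, \<psi>) \<in> mfd_atlas N.
          holo_map (mfd_dim M) (mfd_dim N) (\<phi> ` {x \<in> U. F x \<in> V}) (\<psi> \<circ> F \<circ> inv_into U \<phi>)"
        using F unfolding holomorphic_map_def by (rule conjunct2)
      from this[rule_format, OF U(1), simplified, rule_format, OF V(1)]
      have "holo_map (mfd_dim M) (mfd_dim N) (\<phi> ` {x \<in> U. F x \<in> V}) (\<psi> \<circ> F \<circ> inv_into U \<phi>)"
        by simp
      then have "cd (mfd_dim M) (\<lambda>z. (\<psi> \<circ> F \<circ> inv_into U \<phi>) z j) (\<phi> x)"
        unfolding holo_map_def holo_fun_iff using V(2,3) U(2) by blast
      then show ?thesis unfolding M.holo_at_chart[OF U] by (simp add: o_def)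
    qed
    then show "continuous_map (mfd_top M) (mfd_top N) F \<and>
      (\<forall>x\<in>points M. \<forall>(V, \<psi>)\<in>mfd_atlas N. F x \<in> V \<longrightarrow> (\<forall>j<mfd_dim N. holo_at M (\<lambda>y. \<psi> (F y) j) x))"
      using F unfolding holomorphic_map_def by auto
  next
    assume R: "continuous_map (mfd_top M) (mfd_top N) F \<and>
      (\<forall>x\<in>points M. \<forall>(V, \<psi>)\<in>mfd_atlas N. F x \<in> V \<longrightarrow> (\<forall>j<mfd_dim N. holo_at M (\<lambda>y. \<psi> (F y) j) x))"
    then have cont: "continuous_map (mfd_top M) (mfd_top N) F" ..
    have F: "holo_at M (\<lambda>y. \<psi> (F y) j) x"
      if "x \<in> points M" "(V, \<psi>) \<in> mfd_atlas N" "F x \<in> V" "j < mfd_dim N" for x V \<psi> j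
      using R that by blast
    show "holomorphic_map M N F" unfolding holomorphic_map_def
    proof (intro conjI cont ballI, clarify)
      fix U \<phi> V \<psi> assume U: "(U, \<phi>) \<in> mfd_atlas M" and V: "(V, \<psi>) \<in> mfd_atlas N"
      let ?W = "{x \<in> U. F x \<in> V}"
      have "?W = {x \<in> points M. F x \<in> V} \<inter> U" using M.chart_subset[OF U] by auto
      then have "openin (mfd_top M) ?W"
        using openin_continuous_map_preimage[OF cont N.chart_open[OF V]] M.chart_open[OF U] by auto
      then have W: "openin (Complex_space (mfd_dim M)) (\<phi> ` ?W)"
        by (intro M.chart_open_image[OF U]) auto
      show "holo_map (mfd_dim M) (mfd_dim N) (\<phi> ` ?W) (\<psi> \<circ> F \<circ> inv_into U \<phi>)"
        unfolding holo_map_def holo_fun_iff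
      proof (intro conjI W allI impI ballI)
        show "(\<psi> \<circ> F \<circ> inv_into U \<phi>) ` \<phi> ` ?W \<subseteq> topspace (Complex_space (mfd_dim N))"
          using M.chart_inv[OF U] N.chart_in_Cn[OF V] by auto
        fix j z assume j: "j < mfd_dim N" and "z \<in> \<phi> ` ?W"
        then obtain x where x: "x \<in> U" "F x \<in> V" "z = \<phi> x" by auto
        then have "holo_at M (\<lambda>y. \<psi> (F y) j) x"
          using F[OF _ V _ j] M.chart_subset[OF U] by blast
        then show "cd (mfd_dim M) (\<lambda>z. (\<psi> \<circ> F \<circ> inv_into U \<phi>) z j) z"
          unfolding M.holo_at_chart[OF U x(1)] x(3) by (simp add: o_def)
      qed
    qed
  qed
qed

lemma holomorphic_mapD:
  assumes "complex_manifold M" "complex_manifold N" "holomorphic_map M N F"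
  shows "continuous_map (mfd_top M) (mfd_top N) F"
    and "\<And>x V \<psi> j. x \<in> points M \<Longrightarrow> (V, \<psi>) \<in> mfd_atlas N \<Longrightarrow> F x \<in> V \<Longrightarrow> j < mfd_dim N
      \<Longrightarrow> holo_at M (\<lambda>y. \<psi> (F y) j) x"
proof -
  have *: "continuous_map (mfd_top M) (mfd_top N) F \<and>
    (\<forall>x\<in>points M. \<forall>(V, \<psi>)\<in>mfd_atlas N. F x \<in> V \<longrightarrow> (\<forall>j<mfd_dim N. holo_at M (\<lambda>y. \<psi> (F y) j) x))"
    by (rule iffD1[OF holomorphic_map_iff[OF assms(1,2)] assms(3)])
  show "continuous_map (mfd_top M) (mfd_top N) F" using * by (rule conjunct1)
  fix x V \<psi> j
  assume "x \<in> points M" "(V, \<psi>) \<in> mfd_atlas N" "F x \<in> V" "j < mfd_dim N"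
  then show "holo_at M (\<lambda>y. \<psi> (F y) j) x" using *[THEN conjunct2] by fast
qed

lemma holo_at_compose:
  assumes "complex_manifold M" "complex_manifold N"
    and F: "holomorphic_map M N F" and x: "x \<in> points M" and f: "holo_at N f (F x)"
  shows "holo_at M (\<lambda>y. f (F y)) x"
proof -
  interpret M: cmfd M using assms(1) by unfold_locales
  interpret N: cmfd N using assms(2) by unfold_locales
  note cont = holomorphic_mapD(1)[OF assms(1-3)] and H = holomorphic_mapD(2)[OF assms(1-3) x]
  obtain U \<phi> where U: "(U, \<phi>) \<in> mfd_atlas M" "x \<in> U" using M.chart_at x by blast
  have "F x \<in> points N" using x cont by (metis continuous_map_image_subset_topspace image_subset_iff)
  then obtain V \<psi> where V: "(V, \<psi>) \<in> mfd_atlas N" "F x \<in> V" using N.chart_at by blast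
  obtain r where r: "r > 0" "pd (mfd_dim M) (\<phi> x) r \<subseteq> \<phi> ` (U \<inter> {y \<in> points M. F y \<in> V})"
    using M.chart_pd_in[OF U(1) openin_continuous_map_preimage[OF cont N.chart_open[OF V(1)]]] U(2) V(2) x
    by blast
  let ?G = "\<lambda>z. \<psi> (F (inv_into U \<phi> z))"
  have "cd (mfd_dim M) (\<lambda>z. (f \<circ> inv_into V \<psi>) (?G z)) (\<phi> x)"
  proof (rule cd_chain[OF r(1), where G = ?G and m = "mfd_dim N"])
    fix w assume "w \<in> pd (mfd_dim M) (\<phi> x) r"
    then show "?G w \<in> Cn (mfd_dim N)"
      using r(2) N.chart_in_Cn[OF V(1)] M.chart_inv[OF U(1)] by auto
  next
    fix j assume "j < mfd_dim N"
    then show "cd (mfd_dim M) (\<lambda>w. ?G w j) (\<phi> x)"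
      using H[OF V] unfolding M.holo_at_chart[OF U] by (simp add: o_def)
  next
    show "cd (mfd_dim N) (f \<circ> inv_into V \<psi>) (?G (\<phi> x))"
      using f M.chart_inv[OF U] unfolding N.holo_at_chart[OF V] by simp
  qed
  moreover have "(f \<circ> inv_into V \<psi>) (?G w) = f (F (inv_into U \<phi> w))"
    if "w \<in> pd (mfd_dim M) (\<phi> x) r" for w
    using that r(2) N.chart_inv[OF V(1)] M.chart_inv[OF U(1)] by auto
  ultimately show ?thesis
    unfolding M.holo_at_chart[OF U] o_def
    using cd_cong[OF r(1) M.chart_in_Cn[OF U], of "\<lambda>z. (f \<circ> inv_into V \<psi>) (?G z)"] by (simp add: o_def)
qed

section \<open>Maps close to the identity\<close>

text \<open>The radii are chosen for Cauchy's estimate: a displacement of at most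
  \<open>R / 4\<close> on radius \<open>3 * R\<close> is Lipschitz with constant 1/4 on radius
  \<open>2 * R\<close>. The inverse is then constructed on radius \<open>R\<close>, with values in
  radius \<open>2 * R\<close>.\<close>

locale near_identity =
  fixes n :: nat and a :: "nat \<Rightarrow> complex" and R :: real and E :: "(nat \<Rightarrow> complex) \<Rightarrow> nat \<Rightarrow> complex"
  assumes R_pos: "R > 0"
    and E_in_Cn: "\<And>z. z \<in> pd n a (3 * R) \<Longrightarrow> E z \<in> Cn n"
    and E_close: "\<And>z. z \<in> pd n a (3 * R) \<Longrightarrow> dn n (E z) z \<le> R / 4"
    and E_cd: "\<And>z j. z \<in> pd n a (3 * R) \<Longrightarrow> j < n \<Longrightarrow> cd n (\<lambda>z. E z j) z"
begin

lemma pd_chain: "pd n a R \<subseteq> pd n a (2 * R)" "pd n a (2 * R) \<subseteq> pd n a (3 * R)"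
  using R_pos by (auto intro!: pd_mono)

lemma displacement_lipschitz:
  assumes "z \<in> pd n a (2 * R)" "w \<in> pd n a (2 * R)" "j < n"
  shows "cmod ((E w j - w j) - (E z j - z j)) \<le> dn n w z / 4"
proof -
  have "cmod ((E w j - w j) - (E z j - z j)) \<le> (R / 4) / (3 * R - 2 * R) * dn n w z"
  proof (rule cd_bounded_lipschitz[where f = "\<lambda>z. E z j - z j" and a = a])
    fix u assume u: "u \<in> pd n a (3 * R)"
    show "cd n (\<lambda>z. E z j - z j) u" using assms(3) by (intro cd_diff E_cd u cd_coordinate)
    show "cmod (E u j - u j) \<le> R / 4" using cmod_le_dn[OF assms(3), of "E u" u] E_close[OF u] by simp
  qed (use assms R_pos in auto)
  then show ?thesis using R_pos by simp
qed

text \<open>If the images agree, \<open>w - z\<close> is, up to sign, a difference of displacements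
  and thus at most a quarter of its own size.\<close>

lemma E_inj: "inj_on E (pd n a (2 * R))"
proof (rule inj_onI)
  fix z w assume zw: "z \<in> pd n a (2 * R)" "w \<in> pd n a (2 * R)" "E z = E w"
  have "cmod (w j - z j) \<le> dn n w z / 4" if "j < n" for j
    using displacement_lipschitz[OF zw(1,2) that] zw(3) by (simp add: norm_minus_commute)
  then have "dn n w z \<le> dn n w z / 4" by (subst dn_le_iff) auto
  then have "dn n w z = 0" using dn_nonneg[of n w z] by linarith
  then show "z = w" using dn_eq_0[of w n z] zw by (auto simp: pd_def)
qed

text \<open>A fixed point \<open>z = w - (E z - z)\<close> of the iteration solves \<open>E z = w\<close>.\<close>

primrec picard :: "nat \<Rightarrow> (nat \<Rightarrow> complex) \<Rightarrow> nat \<Rightarrow> complex" where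
  "picard 0 w = w"
| "picard (Suc k) w = (\<lambda>i. if i < n then w i - (E (picard k w) i - picard k w i) else 0)"

text \<open>After the start, every iterate is \<open>w\<close> minus one single displacement, so it
  stays within \<open>R / 4\<close> of \<open>w\<close>; the deviations do not accumulate.\<close>

lemma picard_close: "w \<in> pd n a R \<Longrightarrow> picard k w \<in> pd n a (2 * R) \<and> dn n (picard k w) w \<le> R / 4"
proof (induction k)
  case 0
  then show ?case using pd_chain R_pos by auto
next
  case (Suc k)
  then have p: "picard k w \<in> pd n a (3 * R)" using pd_chain by auto
  have "dn n (picard (Suc k) w) w \<le> R / 4"
  proof (subst dn_le_iff)
    show "\<forall>i<n. cmod (picard (Suc k) w i - w i) \<le> R / 4"
      using cmod_le_dn[of _ n "E (picard k w)" "picard k w"] E_close[OF p] by (force simp: norm_minus_commute)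
  qed (use R_pos in simp)
  moreover have "picard (Suc k) w \<in> Cn n" by (auto simp: Cn_def)
  moreover have "dn n w a < R" using Suc by (auto simp: pd_def)
  ultimately show ?case
    using dn_triangle[of n "picard (Suc k) w" a w] R_pos unfolding pd_def by simp
qed

text \<open>Two consecutive iterates differ by a difference of displacements, which contracts by the
  factor 1/4.\<close>

lemma picard_step: "w \<in> pd n a R \<Longrightarrow> dn n (picard (Suc k) w) (picard k w) \<le> (1/4) ^ k * (R / 4)"
proof (induction k)
  case 0
  then show ?case using picard_close[of w 1] by simp
next
  case (Suc k)
  have "dn n (picard (Suc (Suc k)) w) (picard (Suc k) w) \<le> dn n (picard (Suc k) w) (picard k w) / 4"
  proof (subst dn_le_iff)
    show "\<forall>i<n. cmod (picard (Suc (Suc k)) w i - picard (Suc k) w i)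
        \<le> dn n (picard (Suc k) w) (picard k w) / 4"
    proof (intro allI impI)
      fix i assume i: "i < n"
      let ?u = "picard k w" and ?v = "picard (Suc k) w"
      have "picard (Suc (Suc k)) w i - ?v i = - ((E ?v i - ?v i) - (E ?u i - ?u i))"
        using i by (simp del: picard.simps add: picard.simps(2)[of "Suc k"]) (simp add: i)
      then show "cmod (picard (Suc (Suc k)) w i - ?v i) \<le> dn n ?v ?u / 4"
        using displacement_lipschitz[of ?u ?v i] picard_close[OF Suc.prems] i by (metis norm_minus_cancel)
    qed
  qed simp
  then show ?case using Suc by simp
qed

lemma picard_cd: "w \<in> pd n a R \<Longrightarrow> j < n \<Longrightarrow> cd n (\<lambda>w. picard k w j) w"
proof (induction k arbitrary: j)
  case 0
  then show ?case by (simp add: cd_coordinate)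
next
  case (Suc k)
  obtain r where r: "r > 0" "pd n w r \<subseteq> pd n a R"
    using openin_pd[of n a R] Suc.prems(1) unfolding openin_Complex_space by blast
  have p: "picard k w \<in> pd n a (3 * R)" using picard_close[OF Suc.prems(1)] pd_chain by auto
  have "cd n (\<lambda>w. E (picard k w) j) w"
  proof (rule cd_chain[OF r(1), where G = "picard k" and m = n])
    show "picard k u \<in> Cn n" if "u \<in> pd n w r" for u
      using picard_close[of u k] r(2) that by (auto simp: pd_def)
  qed (use Suc E_cd p in auto)
  then have "cd n (\<lambda>w. w j - (E (picard k w) j - picard k w j)) w"
    using Suc by (intro cd_diff cd_coordinate) auto
  then show ?case using Suc.prems(2) by simp
qed

text \<open>The limit of the Picard iterates, written as a telescoping series so that the
  Weierstrass M-test with the geometric bound of \<open>picard_step\<close> yields uniform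
  convergence.\<close>

definition Einv :: "(nat \<Rightarrow> complex) \<Rightarrow> nat \<Rightarrow> complex"
  where "Einv w = (\<lambda>i. if i < n then w i + (\<Sum>l. picard (Suc l) w i - picard l w i) else 0)"

lemma picard_uniform_limit:
  assumes "i < n"
  shows "uniform_limit (pd n a R) (\<lambda>k w. picard k w i) (\<lambda>w. Einv w i) sequentially"
proof -
  have "uniform_limit (pd n a R) (\<lambda>k w. \<Sum>l<k. picard (Suc l) w i - picard l w i)
      (\<lambda>w. \<Sum>l. picard (Suc l) w i - picard l w i) sequentially"
  proof (rule Weierstrass_m_test)
    show "cmod (picard (Suc l) w i - picard l w i) \<le> (1/4) ^ l * (R / 4)" if "w \<in> pd n a R" for l w
      using cmod_le_dn[OF assms, of "picard (Suc l) w" "picard l w"] picard_step[OF that, of l] by linarith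
    show "summable (\<lambda>l. (1/4) ^ l * (R / 4))" by (intro summable_mult2 summable_geometric) auto
  qed
  moreover have "(\<Sum>l<k. picard (Suc l) w i - picard l w i) = picard k w i - w i" for k w
    using sum_lessThan_telescope[of "\<lambda>l. picard l w i" k] by simp
  ultimately have "uniform_limit (pd n a R) (\<lambda>k w. picard k w i - w i) (\<lambda>w. Einv w i - w i) sequentially"
    using assms by (simp add: Einv_def)
  moreover have "uniform_limit (pd n a R) (\<lambda>k w. w i) (\<lambda>w. w i) sequentially"
    by (rule uniform_limit_const)
  ultimately show ?thesis using uniform_limit_add by fastforce
qed

lemma picard_tendsto:
  assumes "w \<in> pd n a R" "i < n"
  shows "(\<lambda>k. picard k w i) \<longlonglongrightarrow> Einv w i"
  using tendsto_uniform_limitI[OF picard_uniform_limit[OF assms(2)] assms(1)] .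

lemma Einv_cd:
  assumes "w \<in> pd n a R" "i < n"
  shows "cd n (\<lambda>w. Einv w i) w"
proof -
  obtain r where r: "r > 0" "pd n w r \<subseteq> pd n a R"
    using openin_pd[of n a R] assms(1) unfolding openin_Complex_space by blast
  show ?thesis
  proof (rule cd_uniform_limit[OF r(1)])
    show "w \<in> Cn n" using assms(1) by (auto simp: pd_def)
    show "uniform_limit (pd n w r) (\<lambda>k w. picard k w i) (\<lambda>w. Einv w i) sequentially"
      using uniform_limit_on_subset[OF picard_uniform_limit[OF assms(2)] r(2)] .
  qed (use picard_cd assms(2) r(2) in blast)
qed

lemma Einv_close:
  assumes w: "w \<in> pd n a R"
  shows "Einv w \<in> pd n a (2 * R)"
proof -
  have "dn n (Einv w) w \<le> R / 4"
  proof (subst dn_le_iff)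
    show "\<forall>i<n. cmod (Einv w i - w i) \<le> R / 4"
    proof (intro allI impI)
      fix i assume i: "i < n"
      have "cmod (picard k w i - w i) \<le> R / 4" for k
        using cmod_le_dn[OF i, of "picard k w" w] picard_close[OF w, of k] by linarith
      then show "cmod (Einv w i - w i) \<le> R / 4"
        by (intro tendsto_upperbound[OF tendsto_norm[OF tendsto_diff[OF picard_tendsto[OF w i] tendsto_const]]]
            always_eventually allI) auto
    qed
  qed (use R_pos in simp)
  moreover have "Einv w \<in> Cn n" by (auto simp: Einv_def Cn_def)
  moreover have "dn n w a < R" using w by (auto simp: pd_def)
  ultimately show ?thesis
    using dn_triangle[of n "Einv w" a w] R_pos unfolding pd_def by simp
qed

lemma E_Einv:
  assumes w: "w \<in> pd n a R"
  shows "E (Einv w) = w"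
proof
  fix i
  show "E (Einv w) i = w i"
  proof (cases "i < n")
    case True
    let ?z = "Einv w"
    have z: "?z \<in> pd n a (2 * R)" by (rule Einv_close[OF w])
    \<comment> \<open>Coordinatewise convergence is turned into convergence of distances, which the
      Lipschitz bound on the displacement needs for the limit in the recursion.\<close>
    have "(\<lambda>k. dn n (picard k w) ?z) \<longlonglongrightarrow> 0"
    proof (rule tendstoI)
      fix e :: real assume "e > 0"
      have "\<forall>i\<in>{..<n}. \<forall>\<^sub>F k in sequentially. cmod (picard k w i - ?z i) < e"
        using picard_tendsto[OF w] tendstoD[OF _ \<open>e > 0\<close>] by (fastforce simp: dist_norm)
      then have "\<forall>\<^sub>F k in sequentially. \<forall>i\<in>{..<n}. cmod (picard k w i - ?z i) < e"
        by (intro eventually_ball_finite) auto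
      then show "\<forall>\<^sub>F k in sequentially. dist (dn n (picard k w) ?z) 0 < e"
        by eventually_elim (use \<open>e > 0\<close> in \<open>auto simp: dn_less_iff\<close>)
    qed
    then have 0: "(\<lambda>k. dn n (picard k w) ?z / 4) \<longlonglongrightarrow> 0" using tendsto_divide[OF _ tendsto_const, of _ 0 _ 4] by fastforce
    have "(\<lambda>k. (E (picard k w) i - picard k w i) - (E ?z i - ?z i)) \<longlonglongrightarrow> 0"
      using displacement_lipschitz[OF z _ True] picard_close[OF w]
      by (intro Lim_null_comparison[OF _ 0] always_eventually allI) blast
    then have "(\<lambda>k. E (picard k w) i - picard k w i) \<longlonglongrightarrow> E ?z i - ?z i" by (simp add: LIM_zero_iff)
    then have "(\<lambda>k. w i - (E (picard k w) i - picard k w i)) \<longlonglongrightarrow> w i - (E ?z i - ?z i)"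
      by (rule tendsto_diff[OF tendsto_const])
    then have "(\<lambda>k. picard (Suc k) w i) \<longlonglongrightarrow> w i - (E ?z i - ?z i)" using True by simp
    moreover have "(\<lambda>k. picard (Suc k) w i) \<longlonglongrightarrow> ?z i" using LIMSEQ_Suc[OF picard_tendsto[OF w True]] .
    ultimately have "?z i = w i - (E ?z i - ?z i)" by (rule LIMSEQ_unique[rotated])
    then show ?thesis by (simp add: algebra_simps)
  next
    case False
    have "E (Einv w) \<in> Cn n" using Einv_close[OF w] pd_chain by (intro E_in_Cn) blast
    then show ?thesis using False w by (simp add: Cn_def pd_def)
  qed
qed

end

section \<open>Holomorphic semigroups\<close>

locale holomorphic_semigroup = cmfd M for M :: "'a complex_mfd" +
  fixes \<theta> :: "real \<Rightarrow> 'a \<Rightarrow> 'a"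
  assumes action: "continuous_action {0..} (mfd_top M) \<theta>"
    and holomorphic: "\<And>t. t \<ge> 0 \<Longrightarrow> holomorphic_map M M (\<theta> t)"
begin

lemma continuous_joint:
  "continuous_map (prod_topology (top_of_set {0..}) tp) tp (\<lambda>(t, x). \<theta> t x)"
  and theta_0: "x \<in> points M \<Longrightarrow> \<theta> 0 x = x"
  and theta_add: "0 \<le> s \<Longrightarrow> 0 \<le> t \<Longrightarrow> x \<in> points M \<Longrightarrow> \<theta> (s + t) x = \<theta> s (\<theta> t x)"
  using action unfolding continuous_action_def by auto

lemma theta_in: "0 \<le> t \<Longrightarrow> x \<in> points M \<Longrightarrow> \<theta> t x \<in> points M"
  using continuous_map_funspace[OF continuous_joint] by (force simp: Pi_iff)

lemma continuous_theta: "0 \<le> t \<Longrightarrow> continuous_map tp tp (\<theta> t)"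
  using holomorphic by (auto simp: holomorphic_map_def)

lemma continuous_orbit: "x \<in> points M \<Longrightarrow> continuous_map (top_of_set {0..}) tp (\<lambda>t. \<theta> t x)"
proof -
  assume x: "x \<in> points M"
  have "continuous_map (top_of_set {0..}) (prod_topology (top_of_set {0..}) tp) (\<lambda>t. (t, x))"
    using x by (simp add: continuous_map_pairedI)
  from continuous_map_compose[OF this continuous_joint] show ?thesis by (simp add: o_def)
qed

text \<open>Compactness of the swept-out set keeps flow box times and bounds uniform along whole
  pieces of orbits.\<close>

lemma compact_orbits:
  assumes "compactin tp L" "0 \<le> c"
  shows "compactin tp ((\<lambda>(t, x). \<theta> t x) ` ({0..c} \<times> L))"
proof (rule image_compactin[OF _ continuous_joint])
  have "compactin (top_of_set {0..}) {0..c}" by (auto simp: compactin_subtopology)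
  then show "compactin (prod_topology (top_of_set {0..}) tp) ({0..c} \<times> L)"
    using assms by (simp add: compactin_Times)
qed

lemma holo_at_theta:
  "0 \<le> t \<Longrightarrow> x \<in> points M \<Longrightarrow> holo_at M f (\<theta> t x) \<Longrightarrow> holo_at M (\<lambda>y. f (\<theta> t y)) x"
  using holo_at_compose[OF manifold manifold holomorphic] by blast

lemma holo_function_theta:
  "0 \<le> t \<Longrightarrow> holomorphic_function M f \<Longrightarrow> holomorphic_function M (\<lambda>y. f (\<theta> t y))"
  unfolding holomorphic_function_iff using holo_at_theta theta_in by blast

text \<open>The displacement bound is the one of \<open>near_identity\<close>. The radius
  \<open>4 * R\<close> keeps closed polydiscs of radius up to \<open>3 * R\<close> inside the chart,
  where they are compact.\<close>

definition flow_box :: "'a set \<Rightarrow> ('a \<Rightarrow> nat \<Rightarrow> complex) \<Rightarrow> (nat \<Rightarrow> complex) \<Rightarrow> real \<Rightarrow> real \<Rightarrow> bool"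
  where "flow_box U \<phi> a R \<sigma> \<longleftrightarrow> (U, \<phi>) \<in> mfd_atlas M \<and> R > 0 \<and> \<sigma> > 0 \<and>
    pd dm a (4 * R) \<subseteq> \<phi> ` U \<and>
    (\<forall>s x. 0 \<le> s \<longrightarrow> s \<le> \<sigma> \<longrightarrow> x \<in> U \<longrightarrow> \<phi> x \<in> pd dm a (3 * R) \<longrightarrow>
      \<theta> s x \<in> U \<and> dn dm (\<phi> (\<theta> s x)) (\<phi> x) \<le> R / 4)"

lemma flow_box_mono: "flow_box U \<phi> a R \<sigma> \<Longrightarrow> 0 < \<sigma>' \<Longrightarrow> \<sigma>' \<le> \<sigma> \<Longrightarrow> flow_box U \<phi> a R \<sigma>'"
  unfolding flow_box_def by auto

text \<open>At time 0 nothing moves, so the open set \<open>O'\<close> of small displacements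
  contains \<open>{0} \<times> C\<close> for the compact polydisc \<open>C\<close>; the tube lemma
  gives one time that works on all of \<open>C\<close>.\<close>

lemma flow_box_exists:
  assumes "p \<in> points M"
  obtains U \<phi> R \<sigma> where "p \<in> U" "flow_box U \<phi> (\<phi> p) R \<sigma>"
proof -
  let ?n = "dm"
  obtain U \<phi> where U: "(U, \<phi>) \<in> mfd_atlas M" "p \<in> U" using chart_at assms by blast
  obtain r where r: "r > 0" "pd ?n (\<phi> p) r \<subseteq> \<phi> ` U"
    using chart_pd_in[OF U(1) chart_open[OF U(1)] U(2) U(2)] by auto
  define R where "R = r / 4"
  have R: "R > 0" "pd ?n (\<phi> p) (4 * R) \<subseteq> \<phi> ` U" using r by (auto simp: R_def)
  define C where "C = {x \<in> U. dn ?n (\<phi> x) (\<phi> p) \<le> 3 * R}"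
  have C: "compactin tp C" unfolding C_def
  proof (rule compactin_chart_pd[OF U(1)])
    have "{z \<in> Cn ?n. dn ?n z (\<phi> p) \<le> 3 * R} \<subseteq> pd ?n (\<phi> p) (4 * R)" using R(1) by (auto simp: pd_def)
    then show "{z \<in> Cn ?n. dn ?n z (\<phi> p) \<le> 3 * R} \<subseteq> \<phi> ` U" using R(2) by blast
  qed
  define O' where "O' = {(s, x). 0 \<le> s \<and> x \<in> U \<and> \<theta> s x \<in> U \<and> dn ?n (\<phi> (\<theta> s x)) (\<phi> x) < R / 4}"
  let ?P = "prod_topology (top_of_set {0::real..}) tp"
  have "openin ?P O'"
  proof (subst openin_subopen, intro ballI)
    fix q assume "q \<in> O'"
    then obtain s x where q: "q = (s, x)" "0 \<le> s" "x \<in> U" "\<theta> s x \<in> U" "dn ?n (\<phi> (\<theta> s x)) (\<phi> x) < R / 4"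
      by (auto simp: O'_def)
    \<comment> \<open>Both the starting point and the end point are perturbed, each by less than
      half of the remaining gap.\<close>
    define e where "e = (R / 4 - dn ?n (\<phi> (\<theta> s x)) (\<phi> x)) / 2"
    have e: "e > 0" using q(5) by (simp add: e_def)
    define B where "B u = {y \<in> U. \<phi> y \<in> pd ?n (\<phi> u) e}" for u
    have B: "openin tp (B u)" for u
      unfolding B_def by (rule chart_open_vimage[OF U(1) openin_pd])
    have uB: "u \<in> B u" if "u \<in> U" for u
      using that e chart_in_Cn[OF U(1) that] by (auto simp: B_def intro: centre_in_pd)
    let ?V = "{q \<in> topspace ?P. (\<lambda>(t, x). \<theta> t x) q \<in> B (\<theta> s x)} \<inter> ({0..} \<times> B x)"
    have "openin ?P ?V"
      by (intro openin_Int openin_continuous_map_preimage[OF continuous_joint] B)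
        (simp add: openin_prod_Times_iff B)
    moreover have "q \<in> ?V" using q uB chart_subset[OF U(1)] by auto
    moreover have "?V \<subseteq> O'"
    proof
      fix v assume v: "v \<in> ?V"
      obtain t y where ty: "v = (t, y)" by (cases v)
      have y: "\<theta> t y \<in> B (\<theta> s x)" "y \<in> B x" "0 \<le> t" using v unfolding ty by auto
      have "dn ?n (\<phi> (\<theta> t y)) (\<phi> y)
          \<le> dn ?n (\<phi> (\<theta> t y)) (\<phi> (\<theta> s x)) + dn ?n (\<phi> (\<theta> s x)) (\<phi> x) + dn ?n (\<phi> x) (\<phi> y)"
        using dn_triangle[of ?n "\<phi> (\<theta> t y)" "\<phi> y" "\<phi> (\<theta> s x)"]
          dn_triangle[of ?n "\<phi> (\<theta> s x)" "\<phi> y" "\<phi> x"] by linarith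
      moreover have "dn ?n (\<phi> x) (\<phi> y) < e" using y(2) dn_commute[of ?n "\<phi> x" "\<phi> y"] by (auto simp: B_def pd_def)
      moreover have "dn ?n (\<phi> (\<theta> t y)) (\<phi> (\<theta> s x)) < e" using y(1) by (auto simp: B_def pd_def)
      ultimately have "dn ?n (\<phi> (\<theta> t y)) (\<phi> y) < R / 4" by (simp add: e_def)
      then show "v \<in> O'" unfolding ty using y by (auto simp: O'_def B_def)
    qed
    ultimately show "\<exists>T. openin ?P T \<and> q \<in> T \<and> T \<subseteq> O'" by blast
  qed
  moreover have "{0} \<times> C \<subseteq> O'"
    using chart_subset[OF U(1)] theta_0 R(1) by (auto simp: O'_def C_def)
  moreover have "compactin (top_of_set {0::real..}) {0}" by simp
  ultimately obtain A V where A: "openin (top_of_set {0::real..}) A" "openin tp V" "{0} \<subseteq> A" "C \<subseteq> V" "A \<times> V \<subseteq> O'"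
    using Wallace_theorem_prod_topology[OF _ C] by metis
  obtain \<epsilon> where \<epsilon>: "\<epsilon> > 0" "\<And>s. 0 \<le> s \<Longrightarrow> s < \<epsilon> \<Longrightarrow> s \<in> A"
    using A(1,3) unfolding openin_euclidean_subtopology_iff by (force simp: dist_real_def)
  have "flow_box U \<phi> (\<phi> p) R (\<epsilon> / 2)"
    unfolding flow_box_def
  proof (intro conjI allI impI)
    fix s x assume *: "0 \<le> s" "s \<le> \<epsilon> / 2" "x \<in> U" "\<phi> x \<in> pd ?n (\<phi> p) (3 * R)"
    then have "(s, x) \<in> O'" using A(4,5) \<epsilon> by (auto simp: C_def pd_def subset_iff)
    then show "\<theta> s x \<in> U" "dn ?n (\<phi> (\<theta> s x)) (\<phi> x) \<le> R / 4" by (auto simp: O'_def)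
  qed (use U R \<epsilon> in auto)
  then show ?thesis using that U(2) by blast
qed

section \<open>Local inversion inside a flow box\<close>

definition chart_flow :: "'a set \<Rightarrow> ('a \<Rightarrow> nat \<Rightarrow> complex) \<Rightarrow> real \<Rightarrow> (nat \<Rightarrow> complex) \<Rightarrow> nat \<Rightarrow> complex"
  where "chart_flow U \<phi> s z = \<phi> (\<theta> s (inv_into U \<phi> z))"

definition chart_pd :: "'a set \<Rightarrow> ('a \<Rightarrow> nat \<Rightarrow> complex) \<Rightarrow> (nat \<Rightarrow> complex) \<Rightarrow> real \<Rightarrow> 'a set"
  where "chart_pd U \<phi> a r = {x \<in> U. \<phi> x \<in> pd dm a r}"

context
  fixes U \<phi> a R \<sigma>
  assumes box: "flow_box U \<phi> a R \<sigma>"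
begin

lemma
  shows box_chart: "(U, \<phi>) \<in> mfd_atlas M" and box_R: "R > 0" and box_time: "\<sigma> > 0"
    and box_pd: "pd dm a (4 * R) \<subseteq> \<phi> ` U"
    and box_flow: "\<And>s x. 0 \<le> s \<Longrightarrow> s \<le> \<sigma> \<Longrightarrow> x \<in> U \<Longrightarrow> \<phi> x \<in> pd dm a (3 * R) \<Longrightarrow> \<theta> s x \<in> U"
    and box_flow_close: "\<And>s x. 0 \<le> s \<Longrightarrow> s \<le> \<sigma> \<Longrightarrow> x \<in> U \<Longrightarrow> \<phi> x \<in> pd dm a (3 * R)
      \<Longrightarrow> dn dm (\<phi> (\<theta> s x)) (\<phi> x) \<le> R / 4"
proof -
  have *: "(U, \<phi>) \<in> mfd_atlas M \<and> R > 0 \<and> \<sigma> > 0 \<and> pd dm a (4 * R) \<subseteq> \<phi> ` U \<and>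
    (\<forall>s x. 0 \<le> s \<longrightarrow> s \<le> \<sigma> \<longrightarrow> x \<in> U \<longrightarrow> \<phi> x \<in> pd dm a (3 * R) \<longrightarrow>
      \<theta> s x \<in> U \<and> dn dm (\<phi> (\<theta> s x)) (\<phi> x) \<le> R / 4)"
    using box unfolding flow_box_def .
  then show "(U, \<phi>) \<in> mfd_atlas M" "R > 0" "\<sigma> > 0" "pd dm a (4 * R) \<subseteq> \<phi> ` U"
    by simp_all
  fix s x assume "0 \<le> s" "s \<le> \<sigma>" "x \<in> U" "\<phi> x \<in> pd dm a (3 * R)"
  with * show "\<theta> s x \<in> U" "dn dm (\<phi> (\<theta> s x)) (\<phi> x) \<le> R / 4" by simp_all
qed

lemma box_point:
  assumes "z \<in> pd dm a r" "r \<le> 4 * R"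
  obtains x where "x \<in> U" "z = \<phi> x" "inv_into U \<phi> z = x"
proof -
  have "z \<in> \<phi> ` U" using assms box_pd pd_mono[of r "4 * R"] by blast
  then show ?thesis using that chart_inv[OF box_chart] by blast
qed

lemma chart_pd_open: "openin tp (chart_pd U \<phi> a r)"
  unfolding chart_pd_def by (rule chart_open_vimage[OF box_chart openin_pd])

lemma chart_flow_apply: "x \<in> U \<Longrightarrow> chart_flow U \<phi> s (\<phi> x) = \<phi> (\<theta> s x)"
  using chart_inv[OF box_chart] by (simp add: chart_flow_def)

lemma near_identity_flow:
  assumes s: "0 \<le> s" "s \<le> \<sigma>"
  shows "near_identity dm a R (chart_flow U \<phi> s)"
proof
  show "R > 0" by (rule box_R)
  fix z assume z: "z \<in> pd dm a (3 * R)"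
  then obtain x where x: "x \<in> U" "z = \<phi> x" "inv_into U \<phi> z = x"
    using box_point[of z "3 * R"] box_R by auto
  have F: "\<theta> s x \<in> U" using box_flow s x z by blast
  show "chart_flow U \<phi> s z \<in> Cn dm"
    using F x chart_in_Cn[OF box_chart] by (simp add: chart_flow_def)
  show "dn dm (chart_flow U \<phi> s z) z \<le> R / 4"
    using box_flow_close[of s x] s x z by (simp add: chart_flow_def)
  fix j assume "j < dm"
  then have "holo_at M (\<lambda>y. \<phi> (\<theta> s y) j) x"
    using holomorphic_mapD(2)[OF manifold manifold holomorphic[OF s(1)] _ box_chart F] x(1)
      chart_subset[OF box_chart] by blast
  then show "cd dm (\<lambda>z. chart_flow U \<phi> s z j) z"
    unfolding holo_at_chart[OF box_chart x(1)] x(2) chart_flow_def o_def .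
qed

text \<open>In coordinates, the maps at small times are close to the identity and are inverted by the Picard
  iteration, whose limit is holomorphic by Weierstrass' theorem.\<close>

lemma
  assumes s: "0 \<le> s" "s \<le> \<sigma>"
  shows box_inj: "inj_on (\<theta> s) (chart_pd U \<phi> a (R / 2))"
    and box_open: "\<And>W. openin tp W \<Longrightarrow> W \<subseteq> chart_pd U \<phi> a (R / 2) \<Longrightarrow> openin tp (\<theta> s ` W)"
    and box_reflect: "\<And>x f. x \<in> chart_pd U \<phi> a (R / 2) \<Longrightarrow> holo_at M (\<lambda>y. f (\<theta> s y)) x \<Longrightarrow> holo_at M f (\<theta> s x)"
proof -
  let ?n = "dm"
  interpret N: near_identity ?n a R "chart_flow U \<phi> s" by (rule near_identity_flow[OF s])
  have half: "pd ?n a (R / 2) \<subseteq> pd ?n a (2 * R)" "pd ?n a (R / 2) \<subseteq> pd ?n a (3 * R)"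
    using box_R by (auto intro!: pd_mono)
  \<comment> \<open>Reason for the half radius: points of radius \<open>R / 2\<close> move to radius
    below \<open>R / 2 + R / 4 < R\<close>, where \<open>Einv\<close> is the inverse.\<close>
  have F: "\<theta> s x \<in> U" "\<phi> (\<theta> s x) \<in> pd ?n a R" "N.Einv (\<phi> (\<theta> s x)) = \<phi> x"
    if x: "x \<in> chart_pd U \<phi> a (R / 2)" for x
  proof -
    have xU: "x \<in> U" and z: "\<phi> x \<in> pd ?n a (R / 2)" using x by (auto simp: chart_pd_def)
    show 1: "\<theta> s x \<in> U" using box_flow[OF s xU] z half by blast
    have "dn ?n (\<phi> (\<theta> s x)) a \<le> R / 4 + dn ?n (\<phi> x) a"
      using dn_triangle[of ?n "\<phi> (\<theta> s x)" a "\<phi> x"] box_flow_close[OF s xU] z half by fastforce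
    then show 2: "\<phi> (\<theta> s x) \<in> pd ?n a R"
      using z chart_in_Cn[OF box_chart 1] box_R by (simp add: pd_def)
    have "chart_flow U \<phi> s (N.Einv (\<phi> (\<theta> s x))) = chart_flow U \<phi> s (\<phi> x)"
      using N.E_Einv[OF 2] chart_flow_apply[OF xU] by simp
    then show "N.Einv (\<phi> (\<theta> s x)) = \<phi> x"
      using N.E_inj N.Einv_close[OF 2] z half by (auto dest: inj_onD)
  qed
  have inv_step: "\<theta> s (inv_into U \<phi> (N.Einv w)) = inv_into U \<phi> w" if w: "w \<in> pd ?n a R" for w
  proof -
    have z: "N.Einv w \<in> pd ?n a (3 * R)" using N.Einv_close[OF w] N.pd_chain by blast
    then obtain y where y: "y \<in> U" "N.Einv w = \<phi> y" "inv_into U \<phi> (N.Einv w) = y"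
      using box_point[of "N.Einv w" "3 * R"] box_R by auto
    have "\<theta> s y \<in> U" using box_flow[OF s y(1)] z y(2) by simp
    moreover have "\<phi> (\<theta> s y) = w" using N.E_Einv[OF w] chart_flow_apply[OF y(1)] y(2) by simp
    ultimately show ?thesis using y(3) chart_inv[OF box_chart] by force
  qed
  show "inj_on (\<theta> s) (chart_pd U \<phi> a (R / 2))"
  proof (rule inj_onI)
    fix x y assume xy: "x \<in> chart_pd U \<phi> a (R / 2)" "y \<in> chart_pd U \<phi> a (R / 2)" "\<theta> s x = \<theta> s y"
    then have "\<phi> x = \<phi> y" using F(3)[of x] F(3)[of y] by simp
    then show "x = y" using xy chart_inj[OF box_chart] by (auto simp: chart_pd_def dest: inj_onD)
  qed
  show "holo_at M f (\<theta> s x)"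
    if x: "x \<in> chart_pd U \<phi> a (R / 2)" and f: "holo_at M (\<lambda>y. f (\<theta> s y)) x" for x f
  proof -
    let ?w = "\<phi> (\<theta> s x)"
    have xU: "x \<in> U" using x by (auto simp: chart_pd_def)
    obtain r where r: "r > 0" "pd ?n ?w r \<subseteq> pd ?n a R"
      using openin_pd[of ?n a R] F(2)[OF x] unfolding openin_Complex_space by blast
    \<comment> \<open>Near \<open>\<theta> s x\<close> the function \<open>f\<close> is
      \<open>f \<circ> \<theta> s\<close> preceded by the holomorphic local inverse.\<close>
    have "cd ?n (\<lambda>w. ((\<lambda>y. f (\<theta> s y)) \<circ> inv_into U \<phi>) (N.Einv w)) ?w"
    proof (rule cd_chain[OF r(1), where G = N.Einv and m = ?n])
      show "N.Einv w \<in> Cn ?n" if "w \<in> pd ?n ?w r" for w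
        using N.Einv_close[of w] that r(2) by (auto simp: pd_def)
      show "cd ?n (\<lambda>w. N.Einv w j) ?w" if "j < ?n" for j
        using N.Einv_cd[OF F(2)[OF x] that] .
      show "cd ?n ((\<lambda>y. f (\<theta> s y)) \<circ> inv_into U \<phi>) (N.Einv ?w)"
        using f unfolding holo_at_chart[OF box_chart xU] F(3)[OF x] .
    qed
    then have "cd ?n (f \<circ> inv_into U \<phi>) ?w"
    proof (rule iffD1[OF cd_cong, rotated 3])
      show "\<And>w. w \<in> pd ?n ?w r \<Longrightarrow> ((\<lambda>y. f (\<theta> s y)) \<circ> inv_into U \<phi>) (N.Einv w) = (f \<circ> inv_into U \<phi>) w"
        using inv_step r(2) by auto
    qed (use r chart_in_Cn[OF box_chart F(1)[OF x]] in auto)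
    then show ?thesis unfolding holo_at_chart[OF box_chart F(1)[OF x]] .
  qed
  show "openin tp (\<theta> s ` W)"
    if W: "openin tp W" "W \<subseteq> chart_pd U \<phi> a (R / 2)" for W
  proof -
    have WU: "W \<subseteq> U" using W(2) by (auto simp: chart_pd_def)
    \<comment> \<open>Read in the chart, the image of \<open>W\<close> is the preimage of
      \<open>W\<close> under the continuous local inverse.\<close>
    let ?B = "{w \<in> pd ?n a R. N.Einv w \<in> \<phi> ` W}"
    have phiW: "openin (Complex_space ?n) (\<phi> ` W)" by (rule chart_open_image[OF box_chart W(1) WU])
    have "openin (Complex_space ?n) ?B" unfolding openin_Complex_space
    proof (intro conjI ballI)
      show "?B \<subseteq> Cn ?n" by (auto simp: pd_def)
      fix w assume w: "w \<in> ?B"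
      obtain r1 where r1: "r1 > 0" "pd ?n w r1 \<subseteq> pd ?n a R"
        using openin_pd[of ?n a R] w unfolding openin_Complex_space by blast
      obtain r2 where r2: "r2 > 0" "pd ?n (N.Einv w) r2 \<subseteq> \<phi> ` W"
        using phiW w unfolding openin_Complex_space by blast
      obtain r3 where r3: "r3 > 0" "\<And>v. v \<in> Cn ?n \<Longrightarrow> dn ?n v w < r3 \<Longrightarrow> dn ?n (N.Einv v) (N.Einv w) < r2"
        using cd_vector_continuous[of ?n ?n N.Einv w r2] N.Einv_cd w r2(1) by blast
      have "pd ?n w (min r1 r3) \<subseteq> ?B"
      proof
        fix v assume v: "v \<in> pd ?n w (min r1 r3)"
        then have vR: "v \<in> pd ?n a R" using r1(2) by (auto simp: pd_def)
        have "N.Einv v \<in> pd ?n (N.Einv w) r2" using v r3(2)[of v] N.Einv_close[OF vR] by (auto simp: pd_def)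
        then show "v \<in> ?B" using vR r2(2) by blast
      qed
      then show "\<exists>r>0. pd ?n w r \<subseteq> ?B" using r1(1) r3(1) by (intro exI[of _ "min r1 r3"]) auto
    qed
    then have "openin tp {x \<in> U. \<phi> x \<in> ?B}" by (rule chart_open_vimage[OF box_chart])
    also have "{x \<in> U. \<phi> x \<in> ?B} = \<theta> s ` W"
    proof (intro equalityI subsetI)
      fix y assume y: "y \<in> {x \<in> U. \<phi> x \<in> ?B}"
      then obtain x where x: "x \<in> W" "N.Einv (\<phi> y) = \<phi> x" by auto
      then have "\<theta> s x = y" using inv_step[of "\<phi> y"] y WU chart_inv[OF box_chart] by auto
      then show "y \<in> \<theta> s ` W" using x(1) by blast
    next
      fix y assume "y \<in> \<theta> s ` W"
      then obtain x where x: "x \<in> W" "y = \<theta> s x" by blast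
      then have "x \<in> chart_pd U \<phi> a (R / 2)" using W(2) by blast
      from F[OF this] show "y \<in> {x \<in> U. \<phi> x \<in> ?B}" using x by auto
    qed
    finally show ?thesis .
  qed
qed

end

text \<open>Two points that merge at the infimal time would already agree slightly earlier.\<close>

lemma theta_inj:
  assumes "0 \<le> t" "x \<in> points M" "y \<in> points M" "\<theta> t x = \<theta> t y"
  shows "x = y"
proof -
  define S where "S = {s. 0 \<le> s \<and> \<theta> s x = \<theta> s y}"
  have "closedin (top_of_set {0::real..}) {s \<in> topspace (top_of_set {0..}). \<theta> s x = \<theta> s y}"
    by (rule closedin_continuous_maps_eq[OF Hausdorff continuous_orbit[OF assms(2)] continuous_orbit[OF assms(3)]])
  moreover have "{s \<in> topspace (top_of_set {0..}). \<theta> s x = \<theta> s y} = S" by (auto simp: S_def)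
  ultimately have "closed S" using closedin_closed_trans[of "{0::real..}" S] by auto
  moreover have "t \<in> S" "bdd_below S" using assms by (auto simp: S_def intro!: bdd_belowI[of _ 0])
  ultimately have c: "Inf S \<in> S" using closed_contains_Inf by blast
  define c where "c = Inf S"
  have c: "0 \<le> c" "\<theta> c x = \<theta> c y" using c by (auto simp: c_def S_def)
  have "\<not> 0 < c"
  proof
    assume "0 < c"
    have p: "\<theta> c x \<in> points M" using theta_in c assms by blast
    obtain U \<phi> R \<sigma> where U: "\<theta> c x \<in> U" "flow_box U \<phi> (\<phi> (\<theta> c x)) R \<sigma>" using flow_box_exists[OF p] .
    let ?W = "chart_pd U \<phi> (\<phi> (\<theta> c x)) (R / 2)"
    have W: "openin tp ?W" by (rule chart_pd_open[OF U(2)])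
    have "\<theta> c x \<in> ?W"
      using U(1) box_R[OF U(2)] chart_in_Cn[OF box_chart[OF U(2)] U(1)]
      by (auto simp: chart_pd_def intro: centre_in_pd)
    let ?A = "\<lambda>x. {s \<in> topspace (top_of_set {0..}). \<theta> s x \<in> ?W}"
    have op: "openin (top_of_set {0::real..}) (?A x \<inter> ?A y)"
      using continuous_orbit assms(2,3) W by (intro openin_Int openin_continuous_map_preimage) auto
    have "c \<in> ?A x \<inter> ?A y" using c \<open>\<theta> c x \<in> ?W\<close> by auto
    then have "\<exists>e>0. \<forall>s\<in>{0..}. dist s c < e \<longrightarrow> s \<in> ?A x \<inter> ?A y"
      using op[unfolded openin_euclidean_subtopology_iff, THEN conjunct2] by (rule bspec[rotated])
    then obtain e where e: "e > 0" "\<And>s. 0 \<le> s \<Longrightarrow> dist s c < e \<Longrightarrow> s \<in> ?A x \<inter> ?A y"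
      unfolding Ball_def atLeast_iff by (elim exE conjE) blast
    \<comment> \<open>Being at most \<open>c\<close> keeps the earlier time nonnegative, being at
      most \<open>\<sigma>\<close> makes \<open>\<theta> d\<close> injective in the box, and being
      below \<open>e\<close> puts both orbits into the box at time \<open>c - d\<close>.\<close>
    define d where "d = min (min (e / 2) c) \<sigma>"
    have d: "0 < d" "d \<le> c" "d \<le> \<sigma>" "d < e" using e(1) \<open>0 < c\<close> box_time[OF U(2)] by (auto simp: d_def)
    have "c - d \<in> ?A x \<inter> ?A y" using d by (intro e(2)) (auto simp: dist_real_def)
    moreover have "\<theta> d (\<theta> (c - d) x) = \<theta> d (\<theta> (c - d) y)"
      using theta_add[of d "c - d"] d c(2) assms(2,3) by simp
    ultimately have "\<theta> (c - d) x = \<theta> (c - d) y"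
      using box_inj[OF U(2), of d] d by (auto dest: inj_onD)
    then have "c - d \<in> S" using d by (auto simp: S_def)
    then have "c \<le> c - d" unfolding c_def using \<open>bdd_below S\<close> by (intro cInf_lower)
    then show False using d(1) by simp
  qed
  then show ?thesis using c theta_0 assms(2,3) by simp
qed

text \<open>Records only two consequences of a holomorphic local inverse: small open sets have open
  images, and holomorphy of \<open>f \<circ> \<theta> s\<close> descends to \<open>f\<close>. Both
  pass to composites, so that inverses need not be composed themselves.\<close>

definition locally_biholomorphic :: "real \<Rightarrow> 'a \<Rightarrow> bool"
  where "locally_biholomorphic s p \<longleftrightarrow> (\<exists>W. openin tp W \<and> p \<in> W \<and>
    (\<forall>V. openin tp V \<longrightarrow> V \<subseteq> W \<longrightarrow> openin tp (\<theta> s ` V)) \<and>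
    (\<forall>f. holo_at M (\<lambda>y. f (\<theta> s y)) p \<longrightarrow> holo_at M f (\<theta> s p)))"

lemma locally_biholomorphic_add:
  assumes "0 \<le> s" "0 \<le> t" "p \<in> points M"
    and "locally_biholomorphic t p" "locally_biholomorphic s (\<theta> t p)"
  shows "locally_biholomorphic (s + t) p"
proof -
  obtain W where W: "openin tp W" "p \<in> W"
    "\<And>V. openin tp V \<Longrightarrow> V \<subseteq> W \<Longrightarrow> openin tp (\<theta> t ` V)"
    "\<And>f. holo_at M (\<lambda>y. f (\<theta> t y)) p \<Longrightarrow> holo_at M f (\<theta> t p)"
    using assms(4) unfolding locally_biholomorphic_def by auto
  obtain W' where W': "openin tp W'" "\<theta> t p \<in> W'"
    "\<And>V. openin tp V \<Longrightarrow> V \<subseteq> W' \<Longrightarrow> openin tp (\<theta> s ` V)"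
    "\<And>f. holo_at M (\<lambda>y. f (\<theta> s y)) (\<theta> t p) \<Longrightarrow> holo_at M f (\<theta> s (\<theta> t p))"
    using assms(5) unfolding locally_biholomorphic_def by auto
  let ?Z = "W \<inter> {x \<in> points M. \<theta> t x \<in> W'}"
  show ?thesis unfolding locally_biholomorphic_def
  proof (intro exI[of _ ?Z] conjI allI impI)
    show "openin tp ?Z"
      using W(1) openin_continuous_map_preimage[OF continuous_theta[OF assms(2)] W'(1)] by blast
    show "p \<in> ?Z" using assms(3) W(2) W'(2) by blast
    show "openin tp (\<theta> (s + t) ` V)" if V: "openin tp V" "V \<subseteq> ?Z" for V
    proof -
      have "openin tp (\<theta> s ` \<theta> t ` V)" using V by (intro W'(3) W(3)) auto
      moreover have "\<theta> s ` \<theta> t ` V = \<theta> (s + t) ` V"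
        unfolding image_image using V(2) theta_add[OF assms(1,2)] by (intro image_cong) auto
      ultimately show ?thesis by simp
    qed
    fix f assume "holo_at M (\<lambda>y. f (\<theta> (s + t) y)) p"
    then have "holo_at M (\<lambda>y. f (\<theta> s (\<theta> t y))) p"
    proof (rule iffD1[OF holo_at_cong[OF openin_topspace assms(3)], rotated])
      show "\<And>y. y \<in> points M \<Longrightarrow> f (\<theta> (s + t) y) = f (\<theta> s (\<theta> t y))"
        using theta_add[OF assms(1,2)] by simp
    qed
    then have "holo_at M f (\<theta> s (\<theta> t p))" by (intro W'(4) W(4))
    then show "holo_at M f (\<theta> (s + t) p)" by (simp only: theta_add[OF assms(1-3)])
  qed
qed

text \<open>Finitely many of the half-size polydiscs cover \<open>L\<close>, and the least of their
  times serves all of them.\<close>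

lemma compact_flow_boxes:
  assumes L: "compactin tp L"
  obtains F \<sigma> where "finite F" "\<sigma> > 0" "\<And>U \<phi> a R. (U, \<phi>, a, R) \<in> F \<Longrightarrow> flow_box U \<phi> a R \<sigma>"
    "\<And>x. x \<in> L \<Longrightarrow> \<exists>(U, \<phi>, a, R) \<in> F. x \<in> chart_pd U \<phi> a (R / 2)"
proof -
  have ex: "\<exists>b. p \<in> L \<longrightarrow> (case b of (U, \<phi>, R, \<sigma>) \<Rightarrow> p \<in> U \<and> flow_box U \<phi> (\<phi> p) R \<sigma>)" for p
  proof (cases "p \<in> L")
    case True
    then have "p \<in> points M" using compactin_subset_topspace[OF L] by blast
    then obtain U \<phi> R \<sigma> where "p \<in> U" "flow_box U \<phi> (\<phi> p) R \<sigma>" using flow_box_exists by blast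
    then show ?thesis by (intro exI[of _ "(U, \<phi>, R, \<sigma>)"]) simp
  qed simp
  have "\<forall>p. \<exists>b. p \<in> L \<longrightarrow> (case b of (U, \<phi>, R, \<sigma>) \<Rightarrow> p \<in> U \<and> flow_box U \<phi> (\<phi> p) R \<sigma>)"
    by (intro allI ex)
  from choice[OF this] obtain b where
    b: "\<And>p. p \<in> L \<Longrightarrow> (case b p of (U, \<phi>, R, \<sigma>) \<Rightarrow> p \<in> U \<and> flow_box U \<phi> (\<phi> p) R \<sigma>)"
    by auto
  define N where "N p = (case b p of (U, \<phi>, R, \<sigma>) \<Rightarrow> chart_pd U \<phi> (\<phi> p) (R / 2))" for p
  have N: "openin tp (N p)" "p \<in> N p" if p: "p \<in> L" for p
  proof -
    obtain U \<phi> R \<sigma> where bp: "b p = (U, \<phi>, R, \<sigma>)" by (cases "b p") auto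
    have U: "p \<in> U" "flow_box U \<phi> (\<phi> p) R \<sigma>" using b[OF p] by (auto simp: bp)
    show "openin tp (N p)" unfolding N_def bp using chart_pd_open[OF U(2)] by simp
    show "p \<in> N p" unfolding N_def bp
      using U(1) box_R[OF U(2)] chart_in_Cn[OF box_chart[OF U(2)] U(1)]
      by (auto simp: chart_pd_def intro: centre_in_pd)
  qed
  have "\<exists>\<F>. finite \<F> \<and> \<F> \<subseteq> N ` L \<and> L \<subseteq> \<Union>\<F>"
  proof -
    have "\<forall>V\<in>N ` L. openin tp V" "L \<subseteq> \<Union>(N ` L)" using N by auto
    then show ?thesis using L[unfolded compactin_def, THEN conjunct2] by simp
  qed
  then obtain P where P: "finite P" "P \<subseteq> L" "L \<subseteq> \<Union>(N ` P)" by (metis finite_subset_image)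
  define T where "T p = (case b p of (U, \<phi>, R, \<sigma>) \<Rightarrow> \<sigma>)" for p
  define \<sigma> where "\<sigma> = Min (insert 1 (T ` P))"
  have T: "T p > 0" if "p \<in> P" for p
  proof -
    obtain U \<phi> R \<tau> where bp: "b p = (U, \<phi>, R, \<tau>)" by (cases "b p")
    have "p \<in> L" using that P(2) by (rule rev_subsetD)
    then have "flow_box U \<phi> (\<phi> p) R \<tau>" using b[of p] by (simp add: bp)
    from box_time[OF this] show ?thesis by (simp add: T_def bp)
  qed
  have \<sigma>: "\<sigma> > 0" "\<And>p. p \<in> P \<Longrightarrow> \<sigma> \<le> T p" using T P(1) by (auto simp: \<sigma>_def)
  define F where "F = (\<lambda>p. case b p of (U, \<phi>, R, \<sigma>) \<Rightarrow> (U, \<phi>, \<phi> p, R)) ` P"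
  show ?thesis
  proof (rule that)
    show "finite F" using P(1) by (simp add: F_def)
    show "\<sigma> > 0" by (rule \<sigma>(1))
  next
    fix U \<phi> a R assume "(U, \<phi>, a, R) \<in> F"
    then obtain p where p: "p \<in> P" "(U, \<phi>, a, R) = (case b p of (U, \<phi>, R, \<sigma>) \<Rightarrow> (U, \<phi>, \<phi> p, R))"
      unfolding F_def by (rule imageE)
    obtain U' \<phi>' R' \<tau> where bp: "b p = (U', \<phi>', R', \<tau>)" by (cases "b p")
    have eq: "U = U'" "\<phi> = \<phi>'" "a = \<phi>' p" "R = R'" using p(2) by (simp_all add: bp)
    have "p \<in> L" using p(1) P(2) by (rule rev_subsetD)
    then have fb: "flow_box U \<phi> a R \<tau>" using b[of p] by (simp add: bp eq)
    have "\<sigma> \<le> \<tau>" using \<sigma>(2)[OF p(1)] by (simp add: T_def bp)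
    then show "flow_box U \<phi> a R \<sigma>" by (rule flow_box_mono[OF fb \<sigma>(1)])
  next
    fix x assume "x \<in> L"
    then obtain p where p: "p \<in> P" "x \<in> N p" using P(3) by blast
    obtain U \<phi> R \<tau> where bp: "b p = (U, \<phi>, R, \<tau>)" by (cases "b p") auto
    have "(U, \<phi>, \<phi> p, R) \<in> F" unfolding F_def using p(1) by (rule rev_image_eqI) (simp add: bp)
    moreover have "x \<in> chart_pd U \<phi> (\<phi> p) (R / 2)" using p(2) by (simp add: N_def bp)
    ultimately show "\<exists>(U, \<phi>, a, R) \<in> F. x \<in> chart_pd U \<phi> a (R / 2)"
      by (intro bexI[of _ "(U, \<phi>, \<phi> p, R)"]) simp_all
  qed
qed

text \<open>The orbit of \<open>p\<close> up to time \<open>t\<close> is compact, so a common flow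
  box time exists along it; \<open>[0, t]\<close> is cut into steps no longer than that time, and
  the steps are composed.\<close>

lemma theta_locally_biholomorphic:
  assumes t: "0 \<le> t" and p: "p \<in> points M"
  shows "locally_biholomorphic t p"
proof -
  let ?L = "(\<lambda>(t, x). \<theta> t x) ` ({0..t} \<times> {p})"
  have "compactin tp ?L" using p by (intro compact_orbits t) simp
  then obtain F \<sigma> where F: "\<sigma> > 0" "\<And>U \<phi> a R. (U, \<phi>, a, R) \<in> F \<Longrightarrow> flow_box U \<phi> a R \<sigma>"
    "\<And>x. x \<in> ?L \<Longrightarrow> \<exists>(U, \<phi>, a, R) \<in> F. x \<in> chart_pd U \<phi> a (R / 2)"
    using compact_flow_boxes by metis
  have small: "locally_biholomorphic s x" if s: "0 \<le> s" "s \<le> \<sigma>" and x: "x \<in> ?L" for s x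
  proof -
    obtain U \<phi> a R where U: "(U, \<phi>, a, R) \<in> F" "x \<in> chart_pd U \<phi> a (R / 2)" using F(3)[OF x] by blast
    note box = F(2)[OF U(1)]
    show ?thesis unfolding locally_biholomorphic_def
      using U(2) chart_pd_open[OF box] box_open[OF box s] box_reflect[OF box s U(2)] by blast
  qed
  obtain N where N: "N > 0" "t / real N \<le> \<sigma>"
  proof -
    obtain N :: nat where "t / \<sigma> < real N" using reals_Archimedean2 by blast
    moreover from this have "N > 0" using t F(1) divide_nonneg_pos[OF t F(1)] by (cases N) auto
    ultimately show ?thesis using that[of N] F(1) by (simp add: field_simps)
  qed
  define h where "h = t / real N"
  have h: "0 \<le> h" "h \<le> \<sigma>" "real N * h = t" using N t by (auto simp: h_def)
  have "k \<le> N \<Longrightarrow> locally_biholomorphic (real k * h) p" for k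
  proof (induction k)
    case 0
    show ?case using small[of 0 "\<theta> 0 p"] F(1) t p theta_0[OF p] by force
  next
    case (Suc k)
    have "real k * h \<le> real N * h" using Suc.prems h(1) by (intro mult_right_mono) auto
    then have "locally_biholomorphic h (\<theta> (real k * h) p)"
      using h t by (intro small) auto
    then have "locally_biholomorphic (h + real k * h) p"
      using Suc h p by (intro locally_biholomorphic_add) auto
    then show ?case by (simp add: algebra_simps)
  qed
  from this[of N] show ?thesis using h by simp
qed

lemma theta_open:
  assumes t: "0 \<le> t" and V: "openin tp V"
  shows "openin tp (\<theta> t ` V)"
proof (subst openin_subopen, intro ballI)
  fix y assume "y \<in> \<theta> t ` V"
  then obtain x where x: "x \<in> V" "y = \<theta> t x" by blast
  then have "x \<in> points M" using openin_subset[OF V] by blast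
  then obtain W where W: "openin tp W" "x \<in> W"
    "\<And>V. openin tp V \<Longrightarrow> V \<subseteq> W \<Longrightarrow> openin tp (\<theta> t ` V)"
    using theta_locally_biholomorphic[OF t] unfolding locally_biholomorphic_def by blast
  have "openin tp (\<theta> t ` (V \<inter> W))" using V W by (intro W(3)) auto
  then show "\<exists>T. openin tp T \<and> y \<in> T \<and> T \<subseteq> \<theta> t ` V"
    using x W(2) by (intro exI[of _ "\<theta> t ` (V \<inter> W)"]) auto
qed

text \<open>One direction is composition, the other the local inverse. This equivalence is the
  reason why holomorphy on the glued manifold does not depend on the copy in which it is
  tested.\<close>

lemma holo_at_theta_iff:
  assumes "0 \<le> t" "x \<in> points M"
  shows "holo_at M (\<lambda>y. f (\<theta> t y)) x \<longleftrightarrow> holo_at M f (\<theta> t x)"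
  using holo_at_theta[OF assms] theta_locally_biholomorphic[OF assms]
  unfolding locally_biholomorphic_def by blast

end

section \<open>The Runge property\<close>

context cmfd
begin

lemma holomorphic_function_lincomb:
  "holomorphic_function M f \<Longrightarrow> holomorphic_function M g \<Longrightarrow> holomorphic_function M (\<lambda>x. c * f x + d * g x)"
  unfolding holomorphic_function_iff using holo_at_lincomb by blast

lemma holomorphic_function_bounded:
  assumes "compactin tp K" "holomorphic_function M g"
  obtains B where "0 \<le> B" "\<And>x. x \<in> K \<Longrightarrow> cmod (g x) \<le> B"
proof -
  have "compactin euclidean (g ` K)"
    using image_compactin[OF assms(1) holo_function_continuous[OF assms(2)]] .
  then have "bounded (g ` K)" by (simp add: compact_imp_bounded)
  then obtain B where B: "\<forall>y\<in>g ` K. norm y \<le> B" unfolding bounded_iff by blast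
  show ?thesis by (rule that[of "max 0 B"]) (use B in \<open>auto intro: max.coboundedI2\<close>)
qed

end

section \<open>Binomial estimates\<close>

lemma binomial_difference_sum:
  fixes d :: "nat \<Rightarrow> complex"
  shows "(\<Sum>j\<le>N. (-1) ^ j * of_nat (N choose j) * (d j - d (Suc j)))
       = (\<Sum>j\<le>Suc N. (-1) ^ j * of_nat (Suc N choose j) * d j)"
proof -
  have "(\<Sum>j\<le>Suc N. (-1) ^ j * of_nat (Suc N choose j) * d j)
      = d 0 + (\<Sum>j\<le>N. (-1) ^ Suc j * of_nat (Suc N choose Suc j) * d (Suc j))"
    by (subst sum.atMost_Suc_shift) simp
  \<comment> \<open>Pascal's rule splits the coefficient; the two resulting sums are those with
    \<open>d j\<close> and with \<open>d (Suc j)\<close>.\<close>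
  also have "\<dots> = d 0 + (\<Sum>j\<le>N. (-1) ^ Suc j * of_nat (N choose Suc j) * d (Suc j)
      - (-1) ^ j * of_nat (N choose j) * d (Suc j))"
    by (intro arg_cong2[where f = "(+)"] refl sum.cong) (simp_all add: algebra_simps)
  also have "\<dots> = (d 0 + (\<Sum>j\<le>N. (-1) ^ Suc j * of_nat (N choose Suc j) * d (Suc j)))
      - (\<Sum>j\<le>N. (-1) ^ j * of_nat (N choose j) * d (Suc j))"
    by (simp add: sum_subtractf)
  also have "d 0 + (\<Sum>j\<le>N. (-1) ^ Suc j * of_nat (N choose Suc j) * d (Suc j))
      = (\<Sum>j\<le>Suc N. (-1) ^ j * of_nat (N choose j) * d j)"
    by (subst sum.atMost_Suc_shift) simp
  also have "\<dots> = (\<Sum>j\<le>N. (-1) ^ j * of_nat (N choose j) * d j)" by simp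
  finally show ?thesis by (simp add: sum_subtractf right_diff_distrib)
qed

text \<open>Combines \<open>j^j \<le> e^j j!\<close>, from a single term of the exponential series,
  with \<open>(N choose j) j! \<le> N^j\<close>; the number \<open>e\<close> is rounded up to
  3.\<close>

lemma binomial_power_bound: "real (N choose j) * real j ^ j \<le> (3 * real N) ^ j"
proof -
  have "real j ^ j / fact j \<le> exp (real j)"
  proof -
    have "(\<Sum>i\<in>{j}. real j ^ i /\<^sub>R fact i) \<le> exp (real j)"
      unfolding exp_def by (intro sum_le_suminf summable_exp_generic) auto
    then show ?thesis by (simp add: divide_inverse ac_simps)
  qed
  also have "\<dots> \<le> 3 ^ j"
  proof -
    have "exp (real j) = exp 1 ^ j" by (metis exp_of_nat_mult mult.right_neutral)
    then show ?thesis using exp_le by (simp add: power_mono)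
  qed
  finally have 1: "real j ^ j \<le> 3 ^ j * fact j" by (simp add: divide_le_eq)
  have "real ((N choose j) * fact j) \<le> real (N ^ j)"
    using binomial_fact_pow[of N j] of_nat_le_iff by blast
  then have 2: "real (N choose j) * fact j \<le> real N ^ j" by simp
  have "real (N choose j) * real j ^ j \<le> real (N choose j) * (3 ^ j * fact j)"
    using 1 by (intro mult_left_mono) auto
  also have "\<dots> = 3 ^ j * (real (N choose j) * fact j)" by simp
  also have "\<dots> \<le> 3 ^ j * real N ^ j" using 2 by (intro mult_left_mono) auto
  finally show ?thesis by (simp add: power_mult_distrib)
qed

text \<open>The left side bounds the term \<open>j\<close> of the expansion: a difference of order
  \<open>2 * j\<close> with \<open>10 * N\<close> subdivisions. The 10 gives
  \<open>3 * (4 / 10)^2 = 48 / 100 \<le> 1 / 2\<close>, hence a geometric factor; one factor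
  \<open>j / N\<close> is kept to make the sum of order \<open>1 / N\<close>.\<close>

lemma binomial_term_bound:
  assumes "1 \<le> j" "j \<le> N"
  shows "real (N choose j) * (2 * real (2 * j) / real (10 * N)) ^ (2 * j) \<le> (1 / real N) * (real j / 2 ^ j)"
proof -
  have N: "real N > 0" using assms by simp
  let ?q = "real j / real N"
  have q: "0 \<le> ?q" "?q \<le> 1" using assms by auto
  have "(2 * real (2 * j) / real (10 * N)) ^ (2 * j) = ((2 * real (2 * j) / real (10 * N))\<^sup>2) ^ j"
    by (simp add: power_mult)
  also have "(2 * real (2 * j) / real (10 * N))\<^sup>2 = real j * (?q * (16 / 100) / real N)"
    by (simp add: power2_eq_square)
  finally have "real (N choose j) * (2 * real (2 * j) / real (10 * N)) ^ (2 * j)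
      = (real (N choose j) * real j ^ j) * (?q * (16 / 100) / real N) ^ j"
    by (simp only: power_mult_distrib mult.assoc)
  also have "\<dots> \<le> (3 * real N) ^ j * (?q * (16 / 100) / real N) ^ j"
    using q(1) N by (intro mult_right_mono binomial_power_bound zero_le_power) auto
  also have "\<dots> = (48 / 100 * ?q) ^ j"
    unfolding power_mult_distrib[symmetric] using N by simp
  also have "\<dots> \<le> (1 / 2 * ?q) ^ j"
    using q(1) by (intro power_mono mult_right_mono mult_nonneg_nonneg) auto
  also have "\<dots> = (1 / 2) ^ j * ?q ^ j" by (rule power_mult_distrib)
  also have "\<dots> \<le> (1 / 2) ^ j * ?q"
  proof -
    have "?q ^ j \<le> ?q ^ 1" using assms(1) q by (intro power_decreasing) auto
    then show ?thesis by (intro mult_left_mono) auto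
  qed
  also have "\<dots> = (1 / real N) * (real j / 2 ^ j)" by (simp add: power_divide)
  finally show ?thesis .
qed

lemma sum_geometric_linear: "(\<Sum>j=1..N. real j / 2 ^ j) \<le> 2"
proof -
  have "(\<Sum>j=1..N. real j / 2 ^ j) = 2 - (real N + 2) / 2 ^ N"
    by (induction N) (auto simp: field_simps)
  then show ?thesis by simp
qed

context holomorphic_semigroup
begin

section \<open>Iterated differences along the flow\<close>

definition delta :: "real \<Rightarrow> ('a \<Rightarrow> complex) \<Rightarrow> 'a \<Rightarrow> complex"
  where "delta h g = (\<lambda>x. g (\<theta> h x) - g x)"

definition backward :: "real \<Rightarrow> ('a \<Rightarrow> complex) \<Rightarrow> 'a \<Rightarrow> complex"
  where "backward h g = (\<lambda>x. 2 * g x - g (\<theta> h x))"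

lemma delta_holomorphic: "0 \<le> h \<Longrightarrow> holomorphic_function M g \<Longrightarrow> holomorphic_function M ((delta h ^^ k) g)"
proof (induction k)
  case (Suc k)
  then show ?case
    using holomorphic_function_lincomb[OF holo_function_theta, of h "(delta h ^^ k) g" "(delta h ^^ k) g" 1 "-1"]
    by (simp add: delta_def[of h "(delta h ^^ k) g"])
qed simp

lemma backward_holomorphic: "0 \<le> h \<Longrightarrow> holomorphic_function M g \<Longrightarrow> holomorphic_function M ((backward h ^^ k) g)"
proof (induction k)
  case (Suc k)
  then show ?case
    using holomorphic_function_lincomb[OF _ holo_function_theta, of "(backward h ^^ k) g" h "(backward h ^^ k) g" 2 "-1"]
    by (simp add: backward_def[of h "(backward h ^^ k) g"])
qed simp

text \<open>Both operators are polynomials in the composition with \<open>\<theta> h\<close> and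
  therefore commute.\<close>

lemma delta_backward: "(delta h ^^ k) (backward h g) = backward h ((delta h ^^ k) g)"
  by (induction k) (auto simp: delta_def backward_def fun_eq_iff)

text \<open>With \<open>T g = g \<circ> \<theta> h\<close> and \<open>D = T - 1\<close> this is the expansion of \<open>T\<^sup>N (2 - T)\<^sup>N = (1 - D\<^sup>2)\<^sup>N\<close>.\<close>

lemma backward_expansion:
  "(backward h ^^ N) g ((\<theta> h ^^ N) x) = (\<Sum>j\<le>N. (-1) ^ j * of_nat (N choose j) * (delta h ^^ (2 * j)) g x)"
proof (induction N arbitrary: g x)
  case (Suc N)
  have step: "(delta h ^^ k) (backward h g) (\<theta> h x) = (delta h ^^ k) g x - (delta h ^^ (Suc (Suc k))) g x" for k
    unfolding delta_backward by (simp add: backward_def delta_def)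
  \<comment> \<open>One factor \<open>T (2 - T)\<close> is split off: \<open>2 - T\<close> goes to
    the function and \<open>T\<close> to the point, so the hypothesis is applied to
    \<open>backward h g\<close> at \<open>\<theta> h x\<close>.\<close>
  have "(backward h ^^ Suc N) g ((\<theta> h ^^ Suc N) x) = (backward h ^^ N) (backward h g) ((\<theta> h ^^ N) (\<theta> h x))"
    by (simp add: funpow_swap1)
  also have "\<dots> = (\<Sum>j\<le>N. (-1) ^ j * of_nat (N choose j) *
      ((delta h ^^ (2 * j)) g x - (delta h ^^ (2 * Suc j)) g x))"
    unfolding Suc.IH step by simp
  also have "\<dots> = (\<Sum>j\<le>Suc N. (-1) ^ j * of_nat (Suc N choose j) * (delta h ^^ (2 * j)) g x)"
    by (rule binomial_difference_sum)
  finally show ?case .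
qed simp

lemma theta_funpow: "0 \<le> h \<Longrightarrow> x \<in> points M \<Longrightarrow> (\<theta> h ^^ N) x = \<theta> (real N * h) x"
proof (induction N)
  case (Suc N)
  then have "(\<theta> h ^^ Suc N) x = \<theta> (h + real N * h) x" by (simp add: theta_add)
  then show ?case by (simp add: algebra_simps)
qed (simp add: theta_0)

text \<open>The average of the maps at the times \<open>k\<sigma>/N\<close>, \<open>k < N\<close>, differs from the identity by a
  \<open>1/4\<close>-Lipschitz map, while precomposing it with the map at time \<open>\<sigma>/N\<close> changes it by at most
  \<open>R/(4N)\<close>, by telescoping.\<close>

lemma flow_displacement:
  assumes box: "flow_box U \<phi> a R \<sigma>" and N: "N > 0" and z: "z \<in> pd dm a R"
  shows "dn dm (chart_flow U \<phi> (\<sigma> / real N) z) z \<le> R / (3 * real N)"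
proof -
  let ?n = "dm"
  define h where "h = \<sigma> / real N"
  have h: "0 \<le> h" "real N * h = \<sigma>" using N box_time[OF box] by (auto simp: h_def)
  have kh: "0 \<le> real k * h" "real k * h \<le> \<sigma>" if "k \<le> N" for k
  proof -
    show "0 \<le> real k * h" using h by simp
    have "real k * h \<le> real N * h" using that h(1) by (intro mult_right_mono) auto
    then show "real k * h \<le> \<sigma>" using h(2) by simp
  qed
  have R: "R > 0" by (rule box_R[OF box])
  have z2: "z \<in> pd ?n a (2 * R)" and z3: "z \<in> pd ?n a (3 * R)" using z R by (auto simp: pd_def)
  obtain x where x: "x \<in> U" "z = \<phi> x" "inv_into U \<phi> z = x" using box_point[OF box, of z R] z R by auto
  have xM: "x \<in> points M" using x chart_subset[OF box_chart[OF box]] by blast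
  define w where "w = \<phi> (\<theta> h x)"
  have hs: "h \<le> \<sigma>" using kh(2)[of 1] N by simp
  have hU: "\<theta> h x \<in> U" using box_flow[OF box h(1) hs x(1)] z3 x(2) by simp
  have "dn ?n w z \<le> R / 4" using box_flow_close[OF box h(1) hs x(1)] z3 x(2) by (simp add: w_def)
  then have w2: "w \<in> pd ?n a (2 * R)"
    using dn_triangle[of ?n w a z] z R chart_in_Cn[OF box_chart[OF box] hU] by (simp add: pd_def w_def)
  define c where "c k = \<phi> (\<theta> (real k * h) x)" for k
  \<comment> \<open>The map at time \<open>k * h\<close> sends \<open>z\<close> to
    \<open>c k\<close> and \<open>w\<close> to \<open>c (Suc k)\<close>. Its displacement being
    1/4-Lipschitz, every increment of the orbit differs from the first one, \<open>w - z\<close>, by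
    at most a quarter of its size.\<close>
  have step: "cmod ((c (Suc k) j - w j) - (c k j - z j)) \<le> dn ?n w z / 4" if k: "k < N" and j: "j < ?n" for k j
  proof -
    interpret near_identity ?n a R "chart_flow U \<phi> (real k * h)"
      using near_identity_flow[OF box kh] k by simp
    have "chart_flow U \<phi> (real k * h) w = c (Suc k)"
      unfolding w_def chart_flow_apply[OF box hU] c_def
      using theta_add[of "real k * h" h x] kh[of k] k h(1) xM by (simp add: algebra_simps)
    moreover have "chart_flow U \<phi> (real k * h) z = c k"
      unfolding x(2) chart_flow_apply[OF box x(1)] c_def ..
    ultimately show ?thesis using displacement_lipschitz[OF z2 w2 j] by simp
  qed
  have "real N * cmod (w j - z j) \<le> R / 4 + real N * (dn ?n w z / 4)" if j: "j < ?n" for j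
  proof -
    have c0: "c 0 = z" using theta_0[OF xM] x(2) by (simp add: c_def)
    have "dn ?n (c N) z \<le> R / 4"
      using box_flow_close[OF box kh x(1), of N] z3 x(2) by (simp add: c_def)
    then have cN: "cmod (c N j - c 0 j) \<le> R / 4" using cmod_le_dn[OF j, of "c N" z] c0 by simp
    have "(\<Sum>k<N. (c (Suc k) j - w j) - (c k j - z j)) = (\<Sum>k<N. (c (Suc k) j - c k j) - (w j - z j))"
      by (intro sum.cong) auto
    also have "\<dots> = (c N j - c 0 j) - of_nat N * (w j - z j)"
      using sum_lessThan_telescope[of "\<lambda>k. c k j" N] by (simp add: sum_subtractf)
    finally have eq: "of_nat N * (w j - z j) = (c N j - c 0 j) - (\<Sum>k<N. (c (Suc k) j - w j) - (c k j - z j))"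
      by simp
    have "cmod (\<Sum>k<N. (c (Suc k) j - w j) - (c k j - z j)) \<le> (\<Sum>k<N. dn ?n w z / 4)"
      using step j by (intro sum_norm_le) auto
    then have S: "cmod (\<Sum>k<N. (c (Suc k) j - w j) - (c k j - z j)) \<le> real N * (dn ?n w z / 4)" by simp
    have "cmod (of_nat N * (w j - z j)) \<le> R / 4 + real N * (dn ?n w z / 4)"
      unfolding eq by (rule order_trans[OF norm_triangle_ineq4 add_mono[OF cN S]])
    then show ?thesis by (simp add: norm_mult)
  qed
  \<comment> \<open>The distance \<open>d = dn ?n w z\<close> also occurs on the right:
    \<open>N d \<le> R / 4 + N d / 4\<close> is solved for \<open>d\<close>, whence the factor
    3.\<close>
  then have "dn ?n w z \<le> (R / 4 + real N * (dn ?n w z / 4)) / real N"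
    using N R by (subst dn_le_iff) (auto simp: pos_le_divide_eq mult.commute)
  then have "dn ?n w z * real N \<le> R / 4 + real N * (dn ?n w z / 4)" using N by (simp add: pos_le_divide_eq)
  then have "dn ?n w z * (3 * real N) \<le> R" by (simp add: algebra_simps)
  then have "dn ?n w z \<le> R / (3 * real N)" using N by (simp add: pos_le_divide_eq)
  then show ?thesis unfolding h_def[symmetric] x(2) chart_flow_apply[OF box x(1)] w_def x(2) .
qed

text \<open>Each application of \<open>delta\<close> costs one Cauchy estimate on a slightly smaller polydisc.\<close>

lemma delta_bound_in_box:
  assumes box: "flow_box U \<phi> a R \<sigma>" and m: "m > 0" "2 * m \<le> N"
    and g: "holomorphic_function M g" and B: "0 \<le> B" "\<And>x. x \<in> chart_pd U \<phi> a R \<Longrightarrow> cmod (g x) \<le> B"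
  shows "k \<le> m \<Longrightarrow> x \<in> chart_pd U \<phi> a (R - real k * (R / (2 * real m)))
    \<Longrightarrow> cmod ((delta (\<sigma> / real N) ^^ k) g x) \<le> B * (2 * real m / real N) ^ k"
proof (induction k arbitrary: x)
  case 0
  then show ?case using B(2) by simp
next
  case (Suc k)
  let ?n = "dm"
  have N: "N > 0" using m by simp
  define h where "h = \<sigma> / real N"
  define f where "f = (delta h ^^ k) g"
  define Bk where "Bk = B * (2 * real m / real N) ^ k"
  \<comment> \<open>The \<open>m\<close> rings of width \<open>q\<close> lead from radius
    \<open>R\<close> down to \<open>R / 2\<close>. Half of each ring absorbs the displacement by the
    flow, the other half is the gap in Cauchy's estimate.\<close>
  define q where "q = R / (2 * real m)"
  define r where "r = R - real k * q"
  have R: "R > 0" by (rule box_R[OF box])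
  have h: "0 \<le> h" "h \<le> \<sigma>" using N box_time[OF box] by (auto simp: h_def divide_le_eq)
  have q: "q > 0" using R m(1) by (simp add: q_def)
  have "0 \<le> real k * q" using q by simp
  then have r: "r \<le> R" "r \<le> 4 * R" using R unfolding r_def by linarith+
  have "R - real (Suc k) * q = r - q" by (simp add: r_def distrib_right)
  then have xr: "x \<in> chart_pd U \<phi> a (r - q)" using Suc.prems(2) by (simp only: q_def)
  have xU: "x \<in> U" and x: "\<phi> x \<in> pd ?n a (r - q)" using xr by (auto simp: chart_pd_def)
  have xR: "\<phi> x \<in> pd ?n a R" using x q r(1) by (auto simp: pd_def)
  then have x3: "\<phi> x \<in> pd ?n a (3 * R)" using R by (auto simp: pd_def)
  have hU: "\<theta> h x \<in> U" by (rule box_flow[OF box h xU x3])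
  have dw: "dn ?n (\<phi> (\<theta> h x)) (\<phi> x) \<le> R / (3 * real N)"
    using flow_displacement[OF box N xR] chart_flow_apply[OF box xU] by (simp add: h_def)
  \<comment> \<open>Here \<open>2 * m \<le> N\<close> enters: it keeps the displacement within half
    a ring.\<close>
  have "R / (3 * real N) \<le> R / (4 * real m)" using R m N by (intro divide_left_mono) auto
  then have dw2: "dn ?n (\<phi> (\<theta> h x)) (\<phi> x) \<le> q / 2" using dw by (simp add: q_def)
  have "cmod ((f \<circ> inv_into U \<phi>) (\<phi> (\<theta> h x)) - (f \<circ> inv_into U \<phi>) (\<phi> x))
      \<le> Bk / (r - (r - q / 2)) * dn ?n (\<phi> (\<theta> h x)) (\<phi> x)"
  proof (rule cd_bounded_lipschitz[where a = a and R = r])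
    fix u assume u: "u \<in> pd ?n a r"
    obtain y where y: "y \<in> U" "u = \<phi> y" "inv_into U \<phi> u = y" by (rule box_point[OF box u r(2)])
    have "holo_at M f y"
      using delta_holomorphic[OF h(1) g] y(1) chart_subset[OF box_chart[OF box]]
      unfolding f_def holomorphic_function_iff by blast
    then show "cd ?n (f \<circ> inv_into U \<phi>) u" unfolding holo_at_chart[OF box_chart[OF box] y(1)] y(2) .
    have "y \<in> chart_pd U \<phi> a r" using u y by (simp add: chart_pd_def)
    then show "cmod ((f \<circ> inv_into U \<phi>) u) \<le> Bk"
      using Suc.IH[of y] Suc.prems(1) y(3) by (simp add: f_def Bk_def h_def r_def q_def)
  next
    show "\<phi> x \<in> pd ?n a (r - q / 2)" using x q by (auto simp: pd_def)
    show "\<phi> (\<theta> h x) \<in> pd ?n a (r - q / 2)"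
      using x dw2 dn_triangle[of ?n "\<phi> (\<theta> h x)" a "\<phi> x"] chart_in_Cn[OF box_chart[OF box] hU]
      by (auto simp: pd_def)
  qed (use q in auto)
  also have "\<dots> \<le> Bk / (r - (r - q / 2)) * (R / (3 * real N))"
    using dw q B(1) by (intro mult_left_mono) (auto simp: Bk_def)
  also have "\<dots> = Bk * (4 * real m / (3 * real N))" using R m(1) N by (simp add: q_def field_simps)
  also have "\<dots> \<le> Bk * (2 * real m / real N)"
    using B(1) N by (intro mult_left_mono) (auto simp: Bk_def divide_simps)
  also have "(f \<circ> inv_into U \<phi>) (\<phi> (\<theta> h x)) - (f \<circ> inv_into U \<phi>) (\<phi> x) = (delta h ^^ Suc k) g x"
    using chart_inv[OF box_chart[OF box]] xU hU by (simp add: f_def delta_def)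
  finally show ?case by (simp only: Bk_def h_def power_Suc ac_simps)
qed

text \<open>\<open>B\<close> bounds \<open>g\<close> on a compact union of polydiscs about
  \<open>L\<close>. It depends neither on \<open>N\<close> nor on \<open>m\<close>, which is
  essential since the expansion uses all orders while \<open>N\<close> grows.\<close>

lemma delta_bound:
  assumes L: "compactin tp L"
  obtains \<sigma>0 where "\<sigma>0 > 0" "\<And>\<sigma> g. 0 < \<sigma> \<Longrightarrow> \<sigma> \<le> \<sigma>0 \<Longrightarrow> holomorphic_function M g \<Longrightarrow>
    \<exists>B\<ge>0. \<forall>N m. m > 0 \<longrightarrow> 2 * m \<le> N \<longrightarrow> (\<forall>x\<in>L. cmod ((delta (\<sigma> / real N) ^^ m) g x) \<le> B * (2 * real m / real N) ^ m)"
proof -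
  obtain F \<sigma>0 where F: "finite F" "\<sigma>0 > 0" "\<And>U \<phi> a R. (U, \<phi>, a, R) \<in> F \<Longrightarrow> flow_box U \<phi> a R \<sigma>0"
    "\<And>x. x \<in> L \<Longrightarrow> \<exists>(U, \<phi>, a, R) \<in> F. x \<in> chart_pd U \<phi> a (R / 2)"
    using compact_flow_boxes[OF L] by metis
  define P where "P = (\<Union>(U, \<phi>, a, R) \<in> F. {x \<in> U. dn dm (\<phi> x) a \<le> R})"
  have P: "compactin tp P"
    unfolding P_def
  proof (rule compactin_Union)
    show "finite ((\<lambda>(U, \<phi>, a, R). {x \<in> U. dn dm (\<phi> x) a \<le> R}) ` F)" using F(1) by simp
    fix C assume "C \<in> (\<lambda>(U, \<phi>, a, R). {x \<in> U. dn dm (\<phi> x) a \<le> R}) ` F"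
    then obtain U \<phi> a R where U: "(U, \<phi>, a, R) \<in> F" "C = {x \<in> U. dn dm (\<phi> x) a \<le> R}" by auto
    note box = F(3)[OF U(1)]
    have "{z \<in> Cn dm. dn dm z a \<le> R} \<subseteq> pd dm a (4 * R)"
      using box_R[OF box] by (auto simp: pd_def)
    then show "compactin tp C"
      unfolding U(2) using box_pd[OF box] by (intro compactin_chart_pd[OF box_chart[OF box]]) blast
  qed
  show ?thesis
  proof (rule that[OF F(2)])
    fix \<sigma> g assume \<sigma>: "0 < \<sigma>" "\<sigma> \<le> \<sigma>0" and g: "holomorphic_function M g"
    obtain B where B: "0 \<le> B" "\<And>x. x \<in> P \<Longrightarrow> cmod (g x) \<le> B"
      using holomorphic_function_bounded[OF P g] by blast
    have "cmod ((delta (\<sigma> / real N) ^^ m) g x) \<le> B * (2 * real m / real N) ^ m"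
      if m: "m > 0" "2 * m \<le> N" and x: "x \<in> L" for N m x
    proof -
      obtain U \<phi> a R where U: "(U, \<phi>, a, R) \<in> F" "x \<in> chart_pd U \<phi> a (R / 2)" using F(4)[OF x] by blast
      have box: "flow_box U \<phi> a R \<sigma>" by (rule flow_box_mono[OF F(3)[OF U(1)] \<sigma>])
      show ?thesis
      proof (rule delta_bound_in_box[OF box m g B(1)])
        show "cmod (g y) \<le> B" if "y \<in> chart_pd U \<phi> a R" for y
        proof (rule B(2))
          show "y \<in> P" unfolding P_def
            by (rule UN_I[OF U(1)]) (use that in \<open>simp add: chart_pd_def pd_def\<close>)
        qed
        show "x \<in> chart_pd U \<phi> a (R - real m * (R / (2 * real m)))" using U(2) m(1) by simp
      qed simp
    qed
    then show "\<exists>B\<ge>0. \<forall>N m. m > 0 \<longrightarrow> 2 * m \<le> N \<longrightarrow>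
        (\<forall>x\<in>L. cmod ((delta (\<sigma> / real N) ^^ m) g x) \<le> B * (2 * real m / real N) ^ m)"
      using B(1) by blast
  qed
qed

text \<open>The time \<open>r0\<close> depends on \<open>L\<close> alone, not on \<open>g\<close> or
  \<open>\<epsilon>\<close>; this uniformity allows the iteration in \<open>runge\<close>, where
  each approximant is approximated again.\<close>

lemma runge_small_time:
  assumes L: "compactin tp L"
  obtains r0 where "r0 > 0" "\<And>r g \<epsilon>. 0 < r \<Longrightarrow> r \<le> r0 \<Longrightarrow> holomorphic_function M g \<Longrightarrow> \<epsilon> > 0 \<Longrightarrow>
    \<exists>f. holomorphic_function M f \<and> (\<forall>x\<in>L. cmod (f (\<theta> r x) - g x) < \<epsilon>)"
proof -
  obtain \<sigma>0 where \<sigma>0: "\<sigma>0 > 0" "\<And>\<sigma> g. 0 < \<sigma> \<Longrightarrow> \<sigma> \<le> \<sigma>0 \<Longrightarrow> holomorphic_function M g \<Longrightarrow>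
    \<exists>B\<ge>0. \<forall>N m. m > 0 \<longrightarrow> 2 * m \<le> N \<longrightarrow> (\<forall>x\<in>L. cmod ((delta (\<sigma> / real N) ^^ m) g x) \<le> B * (2 * real m / real N) ^ m)"
    using delta_bound[OF L] by blast
  show ?thesis
  proof (rule that[of "\<sigma>0 / 10"])
    show "\<sigma>0 / 10 > 0" using \<sigma>0(1) by simp
    fix r g and \<epsilon> :: real assume r: "0 < r" "r \<le> \<sigma>0 / 10" and g: "holomorphic_function M g" and \<epsilon>: "\<epsilon> > 0"
    \<comment> \<open>Flow boxes of time \<open>10 * r\<close> are used with \<open>10 * N\<close>
      subdivisions, so that one step is \<open>h = r / N\<close>; hence the restriction
      \<open>r \<le> \<sigma>0 / 10\<close>.\<close>
    have "\<exists>B\<ge>0. \<forall>N m. m > 0 \<longrightarrow> 2 * m \<le> N \<longrightarrow>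
        (\<forall>x\<in>L. cmod ((delta (10 * r / real N) ^^ m) g x) \<le> B * (2 * real m / real N) ^ m)"
      using r g by (intro \<sigma>0(2)) auto
    then obtain B where B: "0 \<le> B" "\<And>N m x. m > 0 \<Longrightarrow> 2 * m \<le> N \<Longrightarrow> x \<in> L \<Longrightarrow>
        cmod ((delta (10 * r / real N) ^^ m) g x) \<le> B * (2 * real m / real N) ^ m" by blast
    obtain N0 :: nat where N0: "2 * B / \<epsilon> < real N0" using reals_Archimedean2 by blast
    define N where "N = Suc N0"
    have N: "N > 0" "2 * B / real N < \<epsilon>"
    proof -
      show "N > 0" by (simp add: N_def)
      have "2 * B < real N0 * \<epsilon>" using N0 \<epsilon> by (simp add: divide_less_eq)
      also have "\<dots> \<le> real N * \<epsilon>" using \<epsilon> by (intro mult_right_mono) (auto simp: N_def)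
      finally show "2 * B / real N < \<epsilon>" by (simp add: N_def divide_less_eq mult.commute)
    qed
    define h where "h = r / real N"
    have h: "0 \<le> h" "real N * h = r" "10 * r / real (10 * N) = h" using r N by (auto simp: h_def)
    let ?f = "(backward h ^^ N) g"
    have "cmod (?f (\<theta> r x) - g x) < \<epsilon>" if x: "x \<in> L" for x
    proof -
      have xM: "x \<in> points M" using x compactin_subset_topspace[OF L] by blast
      let ?t = "\<lambda>j. (-1) ^ j * of_nat (N choose j) * (delta h ^^ (2 * j)) g x"
      have "?f (\<theta> r x) = (\<Sum>j\<le>N. ?t j)"
        using backward_expansion[of N h g x] theta_funpow[OF h(1) xM, of N] h(2) by simp
      also have "\<dots> = ?t 0 + (\<Sum>j=1..N. ?t j)"
        by (simp add: atMost_atLeast0 sum.atLeast_Suc_atMost)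
      finally have eq: "?f (\<theta> r x) - g x = (\<Sum>j=1..N. ?t j)" by simp
      have "cmod (?t j) \<le> B / real N * (real j / 2 ^ j)" if j: "j \<in> {1..N}" for j
      proof -
        have "cmod ((delta h ^^ (2 * j)) g x) \<le> B * (2 * real (2 * j) / real (10 * N)) ^ (2 * j)"
          using B(2)[of "2 * j" "10 * N" x] j x unfolding h(3) by simp
        then have "cmod (?t j) \<le> real (N choose j) * (B * (2 * real (2 * j) / real (10 * N)) ^ (2 * j))"
          by (simp only: norm_mult norm_power norm_minus_cancel norm_one power_one mult_1 norm_of_nat mult_left_mono of_nat_0_le_iff)
        also have "\<dots> = B * (real (N choose j) * (2 * real (2 * j) / real (10 * N)) ^ (2 * j))"
          by (simp only: mult.left_commute)
        also have "\<dots> \<le> B * ((1 / real N) * (real j / 2 ^ j))"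
          using j B(1) by (intro mult_left_mono binomial_term_bound) auto
        finally show ?thesis by simp
      qed
      then have "cmod (\<Sum>j=1..N. ?t j) \<le> (\<Sum>j=1..N. B / real N * (real j / 2 ^ j))" by (rule sum_norm_le)
      also have "\<dots> = B / real N * (\<Sum>j=1..N. real j / 2 ^ j)" by (rule sum_distrib_left[symmetric])
      also have "\<dots> \<le> B / real N * 2" using B(1) sum_geometric_linear by (intro mult_left_mono) auto
      also have "\<dots> < \<epsilon>" using N(2) by (simp add: mult.commute)
      finally show ?thesis unfolding eq .
    qed
    moreover have "holomorphic_function M ?f" by (rule backward_holomorphic[OF h(1) g])
    ultimately show "\<exists>f. holomorphic_function M f \<and> (\<forall>x\<in>L. cmod (f (\<theta> r x) - g x) < \<epsilon>)" by blast
  qed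
qed

text \<open>The swept-out set \<open>L'\<close> contains all intermediate positions of
  \<open>L\<close>, so one step length serves every stage. Each stage spends half of the tolerance,
  hence the induction over arbitrary \<open>\<epsilon>\<close>.\<close>

lemma runge:
  assumes L: "compactin tp L" and t: "0 \<le> t" and g: "holomorphic_function M g" and "\<epsilon> > 0"
  obtains f where "holomorphic_function M f" "\<And>x. x \<in> L \<Longrightarrow> cmod (f (\<theta> t x) - g x) < \<epsilon>"
proof (cases "t = 0")
  case True
  have "cmod (g (\<theta> t x) - g x) < \<epsilon>" if "x \<in> L" for x
    using that theta_0 compactin_subset_topspace[OF L] \<open>\<epsilon> > 0\<close> by (auto simp: True)
  then show ?thesis by (rule that[OF g])
next
  case False
  define L' where "L' = (\<lambda>(t, x). \<theta> t x) ` ({0..t} \<times> L)"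
  have "compactin tp L'" unfolding L'_def by (rule compact_orbits[OF L t])
  then obtain r0 where r0: "r0 > 0" "\<And>r g \<epsilon>. 0 < r \<Longrightarrow> r \<le> r0 \<Longrightarrow> holomorphic_function M g \<Longrightarrow> \<epsilon> > 0 \<Longrightarrow>
    \<exists>f. holomorphic_function M f \<and> (\<forall>x\<in>L'. cmod (f (\<theta> r x) - g x) < \<epsilon>)"
    using runge_small_time by blast
  obtain N :: nat where N: "t / r0 < real N" using reals_Archimedean2 by blast
  have N0: "N > 0" using N divide_nonneg_pos[OF t r0(1)] by (cases N) auto
  define r where "r = t / real N"
  have r: "0 < r" "r \<le> r0" "real N * r = t"
    using False t N N0 r0(1) by (auto simp: r_def divide_le_eq divide_less_eq mult.commute)
  have "k \<le> N \<Longrightarrow> \<epsilon> > 0 \<Longrightarrow>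
    \<exists>f. holomorphic_function M f \<and> (\<forall>x\<in>L. cmod (f (\<theta> (real k * r) x) - g x) < \<epsilon>)" for k \<epsilon>
  proof (induction k arbitrary: \<epsilon>)
    case 0
    then show ?case using g theta_0 compactin_subset_topspace[OF L] by (intro exI[of _ g]) auto
  next
    case (Suc k)
    have k: "k \<le> N" "\<epsilon> / 2 > 0" using Suc.prems by auto
    obtain f1 where f1: "holomorphic_function M f1" "\<And>x. x \<in> L \<Longrightarrow> cmod (f1 (\<theta> (real k * r) x) - g x) < \<epsilon> / 2"
      using Suc.IH[OF k] by blast
    obtain f2 where f2: "holomorphic_function M f2" "\<And>y. y \<in> L' \<Longrightarrow> cmod (f2 (\<theta> r y) - f1 y) < \<epsilon> / 2"
      using r0(2)[OF r(1,2) f1(1) k(2)] by blast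
    have "cmod (f2 (\<theta> (real (Suc k) * r) x) - g x) < \<epsilon>" if x: "x \<in> L" for x
    proof -
      have xM: "x \<in> points M" using x compactin_subset_topspace[OF L] by blast
      have "real k * r \<le> real N * r" using k(1) r(1) by (intro mult_right_mono) auto
      then have kt: "0 \<le> real k * r" "real k * r \<le> t" using r by auto
      then have "\<theta> (real k * r) x \<in> L'" using x by (force simp: L'_def)
      from f2(2)[OF this] have "cmod (f2 (\<theta> (r + real k * r) x) - f1 (\<theta> (real k * r) x)) < \<epsilon> / 2"
        using theta_add[of r "real k * r" x] kt(1) r(1) xM by simp
      moreover have "r + real k * r = real (Suc k) * r" by (simp add: algebra_simps)
      ultimately show ?thesis
        using f1(2)[OF x] norm_triangle_ineq[of "f2 (\<theta> (real (Suc k) * r) x) - f1 (\<theta> (real k * r) x)"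
            "f1 (\<theta> (real k * r) x) - g x"] by simp
    qed
    then show ?case using f2(1) by blast
  qed
  from this[of N \<epsilon>] show ?thesis using that \<open>\<epsilon> > 0\<close> r(3) by auto
qed

end

section \<open>The globalisation\<close>

lemma cd_cong_open:
  assumes "openin (Complex_space n) A" "z \<in> A" "\<And>w. w \<in> A \<Longrightarrow> f w = g w"
  shows "cd n f z \<longleftrightarrow> cd n g z"
proof -
  obtain r where "r > 0" "pd n z r \<subseteq> A" using assms(1,2) unfolding openin_Complex_space by blast
  moreover have "z \<in> Cn n" using assms(1,2) unfolding openin_Complex_space by blast
  ultimately show ?thesis using assms(3) by (intro cd_cong) auto
qed

context cmfd
begin

lemma holo_at_chart_coordinate:
  assumes "(U, \<phi>) \<in> mfd_atlas M" "x \<in> U" "j < dm"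
  shows "holo_at M (\<lambda>y. \<phi> y j) x"
  unfolding holo_at_chart[OF assms(1,2)]
proof (rule iffD2[OF cd_cong_open[OF chart_image_open[OF assms(1)]]])
  show "cd dm (\<lambda>w. w j) (\<phi> x)" by (rule cd_coordinate[OF assms(3)])
qed (use assms chart_inv[OF assms(1)] in auto)

end

context holomorphic_semigroup
begin

text \<open>The class of \<open>(t, x)\<close> plays the role of the position at time \<open>-t\<close> of the point \<open>x\<close>;
  the map \<open>cls t\<close> embeds the original manifold as the part of the globalisation from which time \<open>t\<close>
  leads back to the image of \<open>cls 0\<close>.\<close>

definition cls :: "real \<Rightarrow> 'a \<Rightarrow> (real \<times> 'a) set"
  where "cls t x = {(s, y). y \<in> points M \<and> (\<exists>u. s \<le> u \<and> t \<le> u \<and> \<theta> (u - t) x = \<theta> (u - s) y)}"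

text \<open>Translates the index of every representative: a class of index \<open>t\<close> becomes
  one of index \<open>t - s\<close> (\<open>shift_cls\<close>).\<close>

definition shift :: "real \<Rightarrow> (real \<times> 'a) set \<Rightarrow> (real \<times> 'a) set"
  where "shift s p = {(q, y). (q + s, y) \<in> p}"

definition big_space :: "(real \<times> 'a) set set"
  where "big_space = (\<Union>t. cls t ` points M)"

text \<open>The final topology with respect to all maps \<open>cls t\<close>.\<close>

definition big_top :: "(real \<times> 'a) set topology"
  where "big_top = topology (\<lambda>U. U \<subseteq> big_space \<and> (\<forall>t. openin tp {x \<in> points M. cls t x \<in> U}))"

text \<open>\<open>\<theta> (u - r)\<close> is injective, so merging at the later time
  \<open>u\<close> already means merging at \<open>r\<close>. Equality of classes can thus be tested
  at any common time.\<close>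

lemma merge_mono:
  assumes "x \<in> points M" "y \<in> points M" "t \<le> r" "s \<le> r" "r \<le> u"
  shows "\<theta> (u - t) x = \<theta> (u - s) y \<longleftrightarrow> \<theta> (r - t) x = \<theta> (r - s) y"
proof -
  have "\<theta> (u - t) x = \<theta> (u - r) (\<theta> (r - t) x)" "\<theta> (u - s) y = \<theta> (u - r) (\<theta> (r - s) y)"
    using theta_add[of "u - r" "r - t" x] theta_add[of "u - r" "r - s" y] assms by auto
  moreover have "\<theta> (r - t) x \<in> points M" "\<theta> (r - s) y \<in> points M" using assms theta_in by auto
  ultimately show ?thesis using theta_inj[of "u - r"] assms(5) by auto
qed

lemma merge_iff:
  assumes "x \<in> points M" "y \<in> points M" "t \<le> r" "s \<le> r" "t \<le> u" "s \<le> u"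
  shows "\<theta> (u - t) x = \<theta> (u - s) y \<longleftrightarrow> \<theta> (r - t) x = \<theta> (r - s) y"
  using merge_mono[OF assms(1-4), of u] merge_mono[OF assms(1,2,5,6), of r] by (cases "r \<le> u") auto

lemma in_cls_iff:
  assumes "x \<in> points M" "t \<le> r" "s \<le> r"
  shows "(s, y) \<in> cls t x \<longleftrightarrow> y \<in> points M \<and> \<theta> (r - t) x = \<theta> (r - s) y"
  using merge_iff[OF assms(1) _ assms(2,3)] assms unfolding cls_def by blast

lemma cls_eq_iff:
  assumes "x \<in> points M" "y \<in> points M" "t \<le> r" "s \<le> r"
  shows "cls t x = cls s y \<longleftrightarrow> \<theta> (r - t) x = \<theta> (r - s) y"
proof
  assume "cls t x = cls s y"
  moreover have "(s, y) \<in> cls s y" using in_cls_iff[OF assms(2), of s s s y] assms(2) by simp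
  ultimately show "\<theta> (r - t) x = \<theta> (r - s) y" using in_cls_iff[OF assms(1,3,4)] by blast
next
  assume eq: "\<theta> (r - t) x = \<theta> (r - s) y"
  have "(q, z) \<in> cls t x \<longleftrightarrow> (q, z) \<in> cls s y" for q z
  proof -
    let ?u = "max r q"
    have "\<theta> (?u - t) x = \<theta> (?u - s) y" using eq merge_mono[OF assms, of ?u] by simp
    then show ?thesis
      using in_cls_iff[OF assms(1), of t ?u q z] in_cls_iff[OF assms(2), of s ?u q z] assms by auto
  qed
  then show "cls t x = cls s y" by auto
qed

lemma cls_inj: "inj_on (cls t) (points M)"
  using cls_eq_iff[of _ _ t t t] theta_0 by (auto intro: inj_onI)

lemma cls_theta:
  assumes "x \<in> points M" "s \<le> t"
  shows "cls t (\<theta> (t - s) x) = cls s x"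
  using cls_eq_iff[of "\<theta> (t - s) x" x t t s] theta_in[of "t - s" x] theta_0 assms by simp

lemma inv_cls [simp]: "x \<in> points M \<Longrightarrow> inv_into (points M) (cls t) (cls t x) = x"
  using cls_inj by simp

lemma cls_image_mono: "s \<le> t \<Longrightarrow> cls s ` points M \<subseteq> cls t ` points M"
proof clarify
  fix x assume "s \<le> t" "x \<in> points M"
  then show "cls s x \<in> cls t ` points M"
    using cls_theta[of x s t] theta_in[of "t - s" x] by (intro image_eqI[of _ _ "\<theta> (t - s) x"]) auto
qed

lemma shift_cls: "shift s (cls t x) = cls (t - s) x"
proof -
  have "(q + s, y) \<in> cls t x \<longleftrightarrow> (q, y) \<in> cls (t - s) x" for q y
  proof
    assume "(q + s, y) \<in> cls t x"
    then obtain u where "y \<in> points M" "q + s \<le> u" "t \<le> u" "\<theta> (u - t) x = \<theta> (u - (q + s)) y"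
      unfolding cls_def by blast
    then show "(q, y) \<in> cls (t - s) x"
      unfolding cls_def by (auto intro!: exI[of _ "u - s"] simp: algebra_simps)
  next
    assume "(q, y) \<in> cls (t - s) x"
    then obtain u where "y \<in> points M" "q \<le> u" "t - s \<le> u" "\<theta> (u - (t - s)) x = \<theta> (u - q) y"
      unfolding cls_def by blast
    then show "(q + s, y) \<in> cls t x"
      unfolding cls_def by (auto intro!: exI[of _ "u + s"] simp: algebra_simps)
  qed
  then show ?thesis unfolding shift_def by auto
qed

lemma cls_in_big: "x \<in> points M \<Longrightarrow> cls t x \<in> big_space"
  unfolding big_space_def by blast

lemma big_spaceE:
  assumes "p \<in> big_space"
  obtains t x where "x \<in> points M" "p = cls t x"
  using assms unfolding big_space_def by blast

lemma big_space_late: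
  assumes "p \<in> big_space"
  obtains t x where "x \<in> points M" "p = cls t x" "r \<le> t"
proof -
  obtain s x where x: "x \<in> points M" "p = cls s x" using big_spaceE[OF assms] .
  then have "p \<in> cls (max r s) ` points M" using cls_image_mono[of s "max r s"] by auto
  then show ?thesis using that by auto
qed

section \<open>Topology of the glued space\<close>

lemma openin_big: "openin big_top U \<longleftrightarrow>
    U \<subseteq> big_space \<and> (\<forall>t. openin tp {x \<in> points M. cls t x \<in> U})"
proof -
  have "istopology (\<lambda>U. U \<subseteq> big_space \<and> (\<forall>t. openin tp {x \<in> points M. cls t x \<in> U}))"
    unfolding istopology_def
  proof (intro conjI allI impI)
    fix S T assume *: "S \<subseteq> big_space \<and> (\<forall>t. openin tp {x \<in> points M. cls t x \<in> S})"
      "T \<subseteq> big_space \<and> (\<forall>t. openin tp {x \<in> points M. cls t x \<in> T})"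
    show "S \<inter> T \<subseteq> big_space" using * by auto
    fix t
    have "{x \<in> points M. cls t x \<in> S \<inter> T} = {x \<in> points M. cls t x \<in> S} \<inter> {x \<in> points M. cls t x \<in> T}" by auto
    then show "openin tp {x \<in> points M. cls t x \<in> S \<inter> T}" using * by auto
  next
    fix \<K> assume *: "\<forall>K\<in>\<K>. K \<subseteq> big_space \<and> (\<forall>t. openin tp {x \<in> points M. cls t x \<in> K})"
    show "\<Union>\<K> \<subseteq> big_space" using * by auto
    fix t
    have "{x \<in> points M. cls t x \<in> \<Union>\<K>} = (\<Union>K\<in>\<K>. {x \<in> points M. cls t x \<in> K})" by auto
    then show "openin tp {x \<in> points M. cls t x \<in> \<Union>\<K>}" using * by auto
  qed
  then show ?thesis unfolding big_top_def by (simp add: topology_inverse')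
qed

text \<open>Seen in copy \<open>s\<close>, the set is the preimage of \<open>V\<close> under
  \<open>\<theta> (t - s)\<close> if \<open>s \<le> t\<close>, and the image of \<open>V\<close>
  under \<open>\<theta> (s - t)\<close> otherwise; the first is open by continuity, the second by
  \<open>theta_open\<close>.\<close>

lemma cls_open:
  assumes V: "openin tp V"
  shows "openin big_top (cls t ` V)"
  unfolding openin_big
proof (intro conjI allI)
  have VM: "V \<subseteq> points M" by (rule openin_subset[OF V])
  then show "cls t ` V \<subseteq> big_space" using cls_in_big by auto
  fix s
  show "openin tp {x \<in> points M. cls s x \<in> cls t ` V}"
  proof (cases "s \<le> t")
    case True
    have "{x \<in> points M. cls s x \<in> cls t ` V} = {x \<in> points M. \<theta> (t - s) x \<in> V}"
    proof (intro Collect_cong conj_cong refl)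
      fix x assume x: "x \<in> points M"
      have "cls s x = cls t (\<theta> (t - s) x)" using cls_theta[OF x True] by simp
      then show "cls s x \<in> cls t ` V \<longleftrightarrow> \<theta> (t - s) x \<in> V"
        using inj_on_image_mem_iff[OF cls_inj theta_in[OF _ x] VM] True by simp
    qed
    then show ?thesis
      using openin_continuous_map_preimage[OF continuous_theta V, of "t - s"] True by simp
  next
    case False
    have "{x \<in> points M. cls s x \<in> cls t ` V} = \<theta> (s - t) ` V"
    proof
      show "\<theta> (s - t) ` V \<subseteq> {x \<in> points M. cls s x \<in> cls t ` V}"
        using False VM theta_in cls_theta by auto
      show "{x \<in> points M. cls s x \<in> cls t ` V} \<subseteq> \<theta> (s - t) ` V"
      proof clarify
        fix x y assume xy: "x \<in> points M" "y \<in> V" "cls s x = cls t y"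
        then have "cls s x = cls s (\<theta> (s - t) y)" using cls_theta[of y t s] VM False by auto
        then have "x = \<theta> (s - t) y"
          using inj_onD[OF cls_inj] xy theta_in[of "s - t" y] VM False by auto
        then show "x \<in> \<theta> (s - t) ` V" using xy by blast
      qed
    qed
    then show ?thesis using theta_open[OF _ V, of "s - t"] False by simp
  qed
qed

lemma topspace_big [simp]: "topspace big_top = big_space"
proof
  show "topspace big_top \<subseteq> big_space" using openin_big by (metis openin_topspace)
  have "openin big_top (cls t ` points M)" for t by (rule cls_open) simp
  then show "big_space \<subseteq> topspace big_top" unfolding big_space_def by (auto dest: openin_subset)
qed

lemma cls_continuous: "continuous_map tp big_top (cls t)"
  unfolding continuous_map by (auto simp: openin_big cls_in_big)

lemma cls_inverse_continuous:
  "continuous_map (subtopology big_top (cls t ` points M)) tp (inv_into (points M) (cls t))"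
  unfolding continuous_map_def
proof (intro conjI allI impI)
  show "inv_into (points M) (cls t) \<in> topspace (subtopology big_top (cls t ` points M)) \<rightarrow> points M"
    by auto
  fix V assume V: "openin tp V"
  have "{p \<in> topspace (subtopology big_top (cls t ` points M)). inv_into (points M) (cls t) p \<in> V} = cls t ` V"
    using openin_subset[OF V] cls_in_big by auto
  moreover have "cls t ` V \<subseteq> cls t ` points M" using openin_subset[OF V] by auto
  ultimately show "openin (subtopology big_top (cls t ` points M))
      {p \<in> topspace (subtopology big_top (cls t ` points M)). inv_into (points M) (cls t) p \<in> V}"
    using cls_open[OF V, of t] cls_open[OF openin_topspace, of t] by (simp add: openin_open_subtopology)
qed

text \<open>Both points lie in the copy of the later index, and neighbourhoods separated there stay
  open and disjoint in the union.\<close>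

lemma Hausdorff_big: "Hausdorff_space big_top"
  unfolding Hausdorff_space_def
proof (intro allI impI)
  fix p q assume *: "p \<in> topspace big_top \<and> q \<in> topspace big_top \<and> p \<noteq> q"
  then have pq: "p \<in> big_space" "q \<in> big_space" by auto
  obtain t x where x: "x \<in> points M" "p = cls t x" by (rule big_spaceE[OF pq(1)])
  obtain s y where y: "y \<in> points M" "q = cls s y" "t \<le> s" by (rule big_space_late[OF pq(2)])
  define x' where "x' = \<theta> (s - t) x"
  have x': "x' \<in> points M" "p = cls s x'" using x y(3) theta_in cls_theta by (auto simp: x'_def)
  then have "x' \<noteq> y" using * y by auto
  then obtain U V where UV: "openin tp U" "openin tp V" "x' \<in> U" "y \<in> V" "disjnt U V"
    using Hausdorff x'(1) y(1) unfolding Hausdorff_space_def by blast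
  have "disjnt (cls s ` U) (cls s ` V)"
    using UV(5) openin_subset[OF UV(1)] openin_subset[OF UV(2)] cls_inj[of s]
    by (auto simp: disjnt_iff dest: inj_onD)
  then show "\<exists>U V. openin big_top U \<and> openin big_top V \<and> p \<in> U \<and> q \<in> V \<and> disjnt U V"
    using cls_open[OF UV(1), of s] cls_open[OF UV(2), of s] UV(3,4) x'(2) y(2) by blast
qed

text \<open>The copies increase with the index, so those of natural index already cover the
  space.\<close>

lemma second_countable_big: "second_countable big_top"
proof -
  obtain \<B> where \<B>: "countable \<B> \<and> (\<forall>V\<in>\<B>. openin tp V) \<and>
      (\<forall>U x. openin tp U \<and> x \<in> U \<longrightarrow> (\<exists>V\<in>\<B>. x \<in> V \<and> V \<subseteq> U))"
    using second_countable unfolding second_countable_def by (rule exE)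
  then have B: "countable \<B>" "\<And>V. V \<in> \<B> \<Longrightarrow> openin tp V" by blast+
  have base: "\<exists>V\<in>\<B>. x \<in> V \<and> V \<subseteq> U" if "openin tp U" "x \<in> U" for U x
    using \<B> that by simp
  define \<C> where "\<C> = (\<lambda>(n::nat, V). cls (real n) ` V) ` (UNIV \<times> \<B>)"
  show ?thesis unfolding second_countable_def
  proof (intro exI[of _ \<C>] conjI ballI allI impI)
    show "countable \<C>" unfolding \<C>_def using B(1) by auto
    show "openin big_top W" if "W \<in> \<C>" for W using that B(2) cls_open unfolding \<C>_def by auto
    fix U p assume U: "openin big_top U \<and> p \<in> U"
    then have "p \<in> big_space" using openin_subset[of big_top U] by auto
    then obtain t x where x: "x \<in> points M" "p = cls t x" by (rule big_spaceE)
    obtain n :: nat where n: "t \<le> real n" using real_arch_simple by blast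
    then obtain y where y: "y \<in> points M" "p = cls (real n) y"
      using cls_image_mono[OF n] x by blast
    have "openin tp {x \<in> points M. cls (real n) x \<in> U}" using U unfolding openin_big by blast
    moreover have "y \<in> {x \<in> points M. cls (real n) x \<in> U}" using y U by simp
    ultimately obtain V where "V \<in> \<B>" "y \<in> V" "V \<subseteq> {x \<in> points M. cls (real n) x \<in> U}"
      using base by blast
    then show "\<exists>V\<in>\<C>. p \<in> V \<and> V \<subseteq> U"
      unfolding \<C>_def using y(2) by (intro bexI[of _ "cls (real n) ` V"]) auto
  qed
qed

section \<open>The group action\<close>

lemma shift_0: "shift 0 p = p"
  by (auto simp: shift_def)

lemma shift_add: "shift (s + t) p = shift s (shift t p)"
  by (auto simp: shift_def add.assoc)

lemma shift_in_big: "p \<in> big_space \<Longrightarrow> shift s p \<in> big_space"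
  by (metis big_spaceE shift_cls cls_in_big)

lemma shift_action: "continuous_action UNIV big_top shift"
  unfolding continuous_action_def
proof (intro conjI ballI)
  let ?P = "prod_topology (top_of_set (UNIV :: real set)) big_top"
  show "continuous_map ?P big_top (\<lambda>(s, p). shift s p)"
    unfolding continuous_map_def
  proof (intro conjI allI impI)
    show "(\<lambda>(s, p). shift s p) \<in> topspace ?P \<rightarrow> topspace big_top" using shift_in_big by auto
    fix U assume U: "openin big_top U"
    show "openin ?P {q \<in> topspace ?P. (case q of (s, p) \<Rightarrow> shift s p) \<in> U}"
    proof (subst openin_subopen, intro ballI)
      fix q assume "q \<in> {q \<in> topspace ?P. (case q of (s, p) \<Rightarrow> shift s p) \<in> U}"
      then obtain s0 p where q: "q = (s0, p)" "p \<in> big_space" "shift s0 p \<in> U" by auto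
      obtain t x where x: "x \<in> points M" "p = cls t x" using big_spaceE[OF q(2)] .
      \<comment> \<open>Time is counted from one unit before \<open>s0\<close>: for
        \<open>s \<ge> s1\<close> the shift is \<open>\<theta> (s - s1)\<close> followed by the
        fixed map \<open>cls (t - s1)\<close>. Joint continuity of the semigroup at time 1, which is
        interior to its time domain, then covers both sides of \<open>s0\<close>.\<close>
      define s1 where "s1 = s0 - 1"
      have sh: "shift s (cls t y) = cls (t - s1) (\<theta> (s - s1) y)" if "s1 \<le> s" "y \<in> points M" for s y
        using cls_theta[OF that(2), of "t - s" "t - s1"] that by (simp add: shift_cls algebra_simps)
      define W where "W = {x \<in> points M. cls (t - s1) x \<in> U}"
      have W: "openin tp W" using U unfolding openin_big W_def by blast
      let ?T = "prod_topology (top_of_set {0::real..}) tp"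
      have op: "openin ?T {q \<in> topspace ?T. (\<lambda>(t, x). \<theta> t x) q \<in> W}"
        by (rule openin_continuous_map_preimage[OF continuous_joint W])
      have "(1, x) \<in> {q \<in> topspace ?T. (\<lambda>(t, x). \<theta> t x) q \<in> W}"
        using x q(3) sh[of s0 x] theta_in[of 1 x] by (auto simp: W_def s1_def)
      from iffD1[OF openin_prod_topology_alt op, rule_format, OF this] obtain A V
        where A: "openin (top_of_set {0::real..}) A" "openin tp V" "1 \<in> A" "x \<in> V"
        "A \<times> V \<subseteq> {q \<in> topspace ?T. (\<lambda>(t, x). \<theta> t x) q \<in> W}"
        by (elim exE conjE)
      have "\<exists>e>0. \<forall>s\<in>{0..}. dist s 1 < e \<longrightarrow> s \<in> A"
        using A(3) A(1)[unfolded openin_euclidean_subtopology_iff, THEN conjunct2] by (rule bspec[rotated])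
      then obtain e where e: "e > 0" "\<And>s. 0 \<le> s \<Longrightarrow> dist s 1 < e \<Longrightarrow> s \<in> A"
        unfolding Ball_def atLeast_iff by (elim exE conjE) blast
      \<comment> \<open>A radius of at most 1 keeps \<open>s\<close> above
        \<open>s1\<close>.\<close>
      let ?N = "ball s0 (min e 1) \<times> cls t ` V"
      have "openin ?P ?N"
        by (simp add: openin_prod_Times_iff cls_open[OF A(2)])
      moreover have "q \<in> ?N" using q x A(4) e(1) by auto
      moreover have "?N \<subseteq> {q \<in> topspace ?P. (case q of (s, p) \<Rightarrow> shift s p) \<in> U}"
      proof
        fix v assume "v \<in> ?N"
        then obtain s y where v: "v = (s, cls t y)" "s \<in> ball s0 (min e 1)" "y \<in> V" by auto
        have yM: "y \<in> points M" using v(3) openin_subset[OF A(2)] by blast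
        have s: "s1 \<le> s" "dist (s - s1) 1 < e" using v(2) by (auto simp: s1_def dist_real_def)
        then have "(s - s1, y) \<in> A \<times> V" using e(2)[of "s - s1"] v(3) by auto
        then have "\<theta> (s - s1) y \<in> W" using A(5) by auto
        then have "shift s (cls t y) \<in> U" using sh[OF s(1) yM] by (simp add: W_def)
        then show "v \<in> {q \<in> topspace ?P. (case q of (s, p) \<Rightarrow> shift s p) \<in> U}"
          using v(1) cls_in_big[OF yM] by simp
      qed
      ultimately show "\<exists>N. openin ?P N \<and> q \<in> N \<and> N \<subseteq> {q \<in> topspace ?P. (case q of (s, p) \<Rightarrow> shift s p) \<in> U}"
        by blast
    qed
  qed
qed (simp_all add: shift_0 shift_add)

section \<open>Manifold structure and holomorphic functions\<close>

definition big_chart :: "real \<Rightarrow> ('a \<Rightarrow> nat \<Rightarrow> complex) \<Rightarrow> (real \<times> 'a) set \<Rightarrow> nat \<Rightarrow> complex"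
  where "big_chart t \<phi> = \<phi> \<circ> inv_into (points M) (cls t)"

definition big_mfd :: "(real \<times> 'a) set complex_mfd"
  where "big_mfd = \<lparr>mfd_top = big_top, mfd_dim = dm,
    mfd_atlas = {(cls t ` U, big_chart t \<phi>) | t U \<phi>. (U, \<phi>) \<in> mfd_atlas M}\<rparr>"

lemma big_mfd_simps [simp]:
  "mfd_top big_mfd = big_top" "mfd_dim big_mfd = dm"
  "mfd_atlas big_mfd = {(cls t ` U, big_chart t \<phi>) | t U \<phi>. (U, \<phi>) \<in> mfd_atlas M}"
  by (simp_all add: big_mfd_def)

lemma big_chart_cls: "x \<in> points M \<Longrightarrow> big_chart t \<phi> (cls t x) = \<phi> x"
  by (simp add: big_chart_def)

text \<open>Both sides are transported to the later copy \<open>r\<close>, where the two points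
  coincide; \<open>holo_at_theta_iff\<close> makes the transport an equivalence.\<close>

lemma holo_at_cls_iff:
  assumes "x \<in> points M" "y \<in> points M" "cls t x = cls s y"
  shows "holo_at M (\<lambda>z. q (cls t z)) x \<longleftrightarrow> holo_at M (\<lambda>z. q (cls s z)) y"
proof -
  define r where "r = max t s"
  have r: "t \<le> r" "s \<le> r" by (auto simp: r_def)
  have *: "holo_at M (\<lambda>z. q (cls t z)) x \<longleftrightarrow> holo_at M (\<lambda>z. q (cls r z)) (\<theta> (r - t) x)"
    if "x \<in> points M" "t \<le> r" for t x
  proof -
    have "holo_at M (\<lambda>z. q (cls t z)) x \<longleftrightarrow> holo_at M (\<lambda>z. q (cls r (\<theta> (r - t) z))) x"
      by (rule holo_at_cong[OF openin_topspace that(1)]) (simp add: cls_theta that(2))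
    also have "\<dots> \<longleftrightarrow> holo_at M (\<lambda>z. q (cls r z)) (\<theta> (r - t) x)"
      using holo_at_theta_iff[of "r - t" x "\<lambda>z. q (cls r z)"] that by simp
    finally show ?thesis .
  qed
  have "\<theta> (r - t) x = \<theta> (r - s) y" using cls_eq_iff[OF assms(1,2) r] assms(3) by simp
  then show ?thesis using *[OF assms(1) r(1)] *[OF assms(2) r(2)] by simp
qed

context
  fixes t :: real and U \<phi> assumes chart: "(U, \<phi>) \<in> mfd_atlas M"
begin

lemma big_chart_apply: "x \<in> U \<Longrightarrow> big_chart t \<phi> (cls t x) = \<phi> x"
  using big_chart_cls chart_subset[OF chart] by blast

lemma big_chart_image: "V \<subseteq> U \<Longrightarrow> big_chart t \<phi> ` cls t ` V = \<phi> ` V"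
  unfolding image_image using big_chart_apply by (intro image_cong) auto

lemma big_chart_inj: "inj_on (big_chart t \<phi>) (cls t ` U)"
proof (rule inj_onI)
  fix p q assume pq: "p \<in> cls t ` U" "q \<in> cls t ` U" "big_chart t \<phi> p = big_chart t \<phi> q"
  then obtain x y where "x \<in> U" "y \<in> U" "p = cls t x" "q = cls t y" by blast
  then show "p = q" using pq(3) big_chart_apply chart_inj[OF chart] by (auto dest: inj_onD)
qed

lemma inv_big_chart:
  assumes "x \<in> U"
  shows "inv_into (cls t ` U) (big_chart t \<phi>) (\<phi> x) = cls t x"
  using inv_into_f_f[OF big_chart_inj, of "cls t x"] assms big_chart_apply by simp

lemma big_chart_homeo:
  "homeomorphic_map (subtopology big_top (cls t ` U))
     (subtopology (Complex_space dm) (\<phi> ` U)) (big_chart t \<phi>)"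
proof (rule bijective_open_imp_homeomorphic_map)
  let ?S = "subtopology big_top (cls t ` U)" and ?C = "subtopology (Complex_space dm) (\<phi> ` U)"
  have UM: "U \<subseteq> points M" by (rule chart_subset[OF chart])
  have tS: "topspace ?S = cls t ` U" using UM cls_in_big by auto
  have tC: "topspace ?C = \<phi> ` U" using chart_image_subset[OF chart] by auto
  have Uo: "openin big_top (cls t ` U)" by (rule cls_open[OF chart_open[OF chart]])
  show "big_chart t \<phi> ` topspace ?S = topspace ?C" unfolding tS tC by (rule big_chart_image) simp
  show "inj_on (big_chart t \<phi>) (topspace ?S)" unfolding tS by (rule big_chart_inj)
  show "continuous_map ?S ?C (big_chart t \<phi>)"
    unfolding continuous_map_def
  proof (intro conjI allI impI)
    show "big_chart t \<phi> \<in> topspace ?S \<rightarrow> topspace ?C" unfolding tS tC using big_chart_apply by auto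
    fix B assume "openin ?C B"
    then have B: "openin (Complex_space dm) B"
      using chart_image_open[OF chart] by (simp add: openin_open_subtopology)
    have "{p \<in> topspace ?S. big_chart t \<phi> p \<in> B} = cls t ` {x \<in> U. \<phi> x \<in> B}"
      unfolding tS using big_chart_apply by force
    moreover have "openin big_top (cls t ` {x \<in> U. \<phi> x \<in> B})"
      by (rule cls_open[OF chart_open_vimage[OF chart B]])
    moreover have "cls t ` {x \<in> U. \<phi> x \<in> B} \<subseteq> cls t ` U" by auto
    ultimately show "openin ?S {p \<in> topspace ?S. big_chart t \<phi> p \<in> B}"
      using Uo by (simp add: openin_open_subtopology)
  qed
  show "open_map ?S ?C (big_chart t \<phi>)"
    unfolding open_map_def
  proof (intro allI impI)
    fix W assume "openin ?S W"
    then have W: "openin big_top W" "W \<subseteq> cls t ` U" using Uo by (auto simp: openin_open_subtopology)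
    let ?V = "{x \<in> points M. cls t x \<in> W}"
    have V: "openin tp ?V" using W(1) unfolding openin_big by blast
    have VU: "?V \<subseteq> U"
    proof clarify
      fix x assume x: "x \<in> points M" "cls t x \<in> W"
      then obtain y where "y \<in> U" "cls t x = cls t y" using W(2) by blast
      then show "x \<in> U" using inj_onD[OF cls_inj] x(1) UM by blast
    qed
    have "W = cls t ` ?V" using W(2) UM by auto
    then have "big_chart t \<phi> ` W = \<phi> ` ?V" using big_chart_image[OF VU] by simp
    moreover have "openin (Complex_space dm) (\<phi> ` ?V)" by (rule chart_open_image[OF chart V VU])
    moreover have "\<phi> ` ?V \<subseteq> \<phi> ` U" using VU by (rule image_mono)
    ultimately show "openin ?C (big_chart t \<phi> ` W)"
      using chart_image_open[OF chart] by (simp add: openin_open_subtopology)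
  qed
qed

lemma cd_big_chart_iff:
  assumes "x \<in> U"
  shows "cd dm (f \<circ> inv_into (cls t ` U) (big_chart t \<phi>)) (\<phi> x) \<longleftrightarrow> holo_at M (\<lambda>y. f (cls t y)) x"
  unfolding holo_at_chart[OF chart assms]
proof (rule cd_cong_open[OF chart_image_open[OF chart]])
  fix w assume "w \<in> \<phi> ` U"
  then show "(f \<circ> inv_into (cls t ` U) (big_chart t \<phi>)) w = ((\<lambda>y. f (cls t y)) \<circ> inv_into U \<phi>) w"
    using inv_big_chart chart_inv[OF chart] by auto
qed (use assms in blast)

end

text \<open>For \<open>t = s\<close> this is a coordinate of a chart of the original manifold;
  \<open>holo_at_cls_iff\<close> carries it to the other copies. It yields both the transition maps
  and the holomorphy of the embedding.\<close>

lemma holo_at_big_chart: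
  assumes V: "(V, \<psi>) \<in> mfd_atlas M" and x: "x \<in> points M" "cls t x \<in> cls s ` V" and j: "j < dm"
  shows "holo_at M (\<lambda>y. big_chart s \<psi> (cls t y) j) x"
proof -
  obtain v where v: "v \<in> V" "cls t x = cls s v" using x(2) by blast
  then have vM: "v \<in> points M" using chart_subset[OF V] by blast
  have "holo_at M (\<lambda>y. big_chart s \<psi> (cls s y) j) v \<longleftrightarrow> holo_at M (\<lambda>y. \<psi> y j) v"
    by (rule holo_at_cong[OF openin_topspace vM]) (simp add: big_chart_cls)
  then have "holo_at M (\<lambda>y. big_chart s \<psi> (cls s y) j) v"
    using holo_at_chart_coordinate[OF V v(1) j] by simp
  then show ?thesis using holo_at_cls_iff[OF x(1) vM v(2), of "\<lambda>p. big_chart s \<psi> p j"] by simp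
qed

lemma big_manifold: "complex_manifold big_mfd"
  unfolding complex_manifold_def
proof (intro conjI)
  show "Hausdorff_space (mfd_top big_mfd)" using Hausdorff_big by simp
  show "second_countable (mfd_top big_mfd)" using second_countable_big by simp
  show "\<forall>(A, \<alpha>) \<in> mfd_atlas big_mfd. openin (mfd_top big_mfd) A \<and>
      openin (Complex_space (mfd_dim big_mfd)) (\<alpha> ` A) \<and>
      homeomorphic_map (subtopology (mfd_top big_mfd) A)
        (subtopology (Complex_space (mfd_dim big_mfd)) (\<alpha> ` A)) \<alpha>"
  proof (intro ballI, clarify)
    fix A \<alpha> assume "(A, \<alpha>) \<in> mfd_atlas big_mfd"
    then obtain t U \<phi> where U: "(U, \<phi>) \<in> mfd_atlas M" "A = cls t ` U" "\<alpha> = big_chart t \<phi>" by auto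
    show "openin (mfd_top big_mfd) A \<and> openin (Complex_space (mfd_dim big_mfd)) (\<alpha> ` A) \<and>
      homeomorphic_map (subtopology (mfd_top big_mfd) A)
        (subtopology (Complex_space (mfd_dim big_mfd)) (\<alpha> ` A)) \<alpha>"
      unfolding U(2,3) big_chart_image[OF U(1) subset_refl] big_mfd_simps
      using cls_open[OF chart_open[OF U(1)]] chart_image_open[OF U(1)] big_chart_homeo[OF U(1)] by blast
  qed
  show "points big_mfd = (\<Union>(A, \<alpha>) \<in> mfd_atlas big_mfd. A)"
  proof
    show "points big_mfd \<subseteq> (\<Union>(A, \<alpha>) \<in> mfd_atlas big_mfd. A)"
    proof
      fix p assume "p \<in> points big_mfd"
      then have "p \<in> big_space" by simp
      then obtain t x where x: "x \<in> points M" "p = cls t x" by (rule big_spaceE)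
      obtain U \<phi> where U: "(U, \<phi>) \<in> mfd_atlas M" "x \<in> U" using chart_at[OF x(1)] .
      have "(cls t ` U, big_chart t \<phi>) \<in> mfd_atlas big_mfd" using U(1) by auto
      then show "p \<in> (\<Union>(A, \<alpha>) \<in> mfd_atlas big_mfd. A)" 
        by (rule UN_I) (use U(2) x(2) in simp)
    qed
    show "(\<Union>(A, \<alpha>) \<in> mfd_atlas big_mfd. A) \<subseteq> points big_mfd"
      using chart_subset cls_in_big by fastforce
  qed
  show "\<forall>(A, \<alpha>) \<in> mfd_atlas big_mfd. \<forall>(B, \<beta>) \<in> mfd_atlas big_mfd.
      holo_map (mfd_dim big_mfd) (mfd_dim big_mfd) (\<alpha> ` (A \<inter> B)) (\<beta> \<circ> inv_into A \<alpha>)"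
  proof (intro ballI, clarify)
    fix A \<alpha> B \<beta> assume "(A, \<alpha>) \<in> mfd_atlas big_mfd" "(B, \<beta>) \<in> mfd_atlas big_mfd"
    then obtain t U \<phi> s V \<psi> where U: "(U, \<phi>) \<in> mfd_atlas M" "A = cls t ` U" "\<alpha> = big_chart t \<phi>"
      and V: "(V, \<psi>) \<in> mfd_atlas M" "B = cls s ` V" "\<beta> = big_chart s \<psi>" by auto
    let ?W = "{x \<in> U. cls t x \<in> B}"
    have im: "\<alpha> ` (A \<inter> B) = \<phi> ` ?W"
    proof -
      have "A \<inter> B = cls t ` ?W" using U(2) by auto
      then show ?thesis unfolding U(3) by (simp add: big_chart_image[OF U(1)])
    qed
    have "?W = {x \<in> points M. cls t x \<in> B} \<inter> U" using chart_subset[OF U(1)] by auto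
    moreover have "openin big_top B" unfolding V(2) by (rule cls_open[OF chart_open[OF V(1)]])
    ultimately have "openin tp ?W" using chart_open[OF U(1)] by (auto simp: openin_big)
    then have W: "openin (Complex_space dm) (\<phi> ` ?W)" by (rule chart_open_image[OF U(1)]) auto
    show "holo_map (mfd_dim big_mfd) (mfd_dim big_mfd) (\<alpha> ` (A \<inter> B)) (\<beta> \<circ> inv_into A \<alpha>)"
      unfolding im holo_map_def holo_fun_iff big_mfd_simps(2)
    proof (intro conjI allI impI ballI W)
      show "(\<beta> \<circ> inv_into A \<alpha>) ` \<phi> ` ?W \<subseteq> topspace (Complex_space dm)"
      proof clarify
        fix x assume x: "x \<in> U" "cls t x \<in> B"
        then obtain v where v: "v \<in> V" "cls t x = cls s v" using V(2) by blast
        have "(\<beta> \<circ> inv_into A \<alpha>) (\<phi> x) = \<psi> v"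
          using inv_big_chart[OF U(1) x(1)] v big_chart_apply[OF V(1) v(1)] by (simp add: U V)
        then show "(\<beta> \<circ> inv_into A \<alpha>) (\<phi> x) \<in> topspace (Complex_space dm)"
          using chart_in_Cn[OF V(1) v(1)] by simp
      qed
      fix j z assume j: "j < dm" and "z \<in> \<phi> ` ?W"
      then obtain x where x: "x \<in> U" "cls t x \<in> B" "z = \<phi> x" by auto
      have "holo_at M (\<lambda>y. \<beta> (cls t y) j) x"
        unfolding V(3) using x chart_subset[OF U(1)] by (intro holo_at_big_chart[OF V(1) _ _ j]) (auto simp: V(2))
      then have "cd dm ((\<lambda>p. \<beta> p j) \<circ> inv_into A \<alpha>) (\<phi> x)"
        unfolding U(2,3) cd_big_chart_iff[OF U(1) x(1)] .
      then show "cd dm (\<lambda>z. (\<beta> \<circ> inv_into A \<alpha>) z j) z" by (simp add: o_def x(3))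
    qed
  qed
qed

lemma holomorphic_function_big_iff:
  "holomorphic_function big_mfd f \<longleftrightarrow> (\<forall>t. holomorphic_function M (\<lambda>x. f (cls t x)))"
proof
  assume f: "holomorphic_function big_mfd f"
  show "\<forall>t. holomorphic_function M (\<lambda>x. f (cls t x))"
    unfolding holomorphic_function_iff
  proof (intro allI ballI)
    fix t x assume "x \<in> points M"
    then obtain U \<phi> where U: "(U, \<phi>) \<in> mfd_atlas M" "x \<in> U" using chart_at by blast
    have "(cls t ` U, big_chart t \<phi>) \<in> mfd_atlas big_mfd" using U(1) by auto
    with f have "holo_fun (mfd_dim big_mfd) (big_chart t \<phi> ` cls t ` U) (f \<circ> inv_into (cls t ` U) (big_chart t \<phi>))"
      unfolding holomorphic_function_def by (metis (no_types, lifting) case_prodD)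
    then show "holo_at M (\<lambda>x. f (cls t x)) x"
      unfolding holo_fun_iff big_chart_image[OF U(1) subset_refl] big_mfd_simps(2)
      using cd_big_chart_iff[OF U, of f t] U(2) by blast
  qed
next
  assume f: "\<forall>t. holomorphic_function M (\<lambda>x. f (cls t x))"
  show "holomorphic_function big_mfd f"
    unfolding holomorphic_function_def
  proof (intro ballI, clarify)
    fix A \<alpha> assume "(A, \<alpha>) \<in> mfd_atlas big_mfd"
    then obtain t U \<phi> where U: "(U, \<phi>) \<in> mfd_atlas M" "A = cls t ` U" "\<alpha> = big_chart t \<phi>" by auto
    show "holo_fun (mfd_dim big_mfd) (\<alpha> ` A) (f \<circ> inv_into A \<alpha>)"
      unfolding U(2,3) holo_fun_iff big_chart_image[OF U(1) subset_refl] big_mfd_simps(2)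
    proof (intro conjI ballI chart_image_open[OF U(1)])
      fix z assume "z \<in> \<phi> ` U"
      then obtain x where x: "x \<in> U" "z = \<phi> x" by blast
      then have "holo_at M (\<lambda>x. f (cls t x)) x"
        using f chart_subset[OF U(1)] unfolding holomorphic_function_iff by blast
      then show "cd dm (f \<circ> inv_into (cls t ` U) (big_chart t \<phi>)) z"
        unfolding x(2) cd_big_chart_iff[OF U(1) x(1)] .
    qed
  qed
qed

lemma holomorphic_function_shift:
  "holomorphic_function big_mfd f \<Longrightarrow> holomorphic_function big_mfd (\<lambda>p. f (shift s p))"
  unfolding holomorphic_function_big_iff shift_cls by blast

lemma holomorphic_embedding: "holomorphic_map M big_mfd (cls 0)"
proof (rule iffD2[OF holomorphic_map_iff[OF manifold big_manifold]], intro conjI ballI)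
  show "continuous_map tp (mfd_top big_mfd) (cls 0)" using cls_continuous by simp
  fix x Vp assume x: "x \<in> points M" and Vp: "Vp \<in> mfd_atlas big_mfd"
  then obtain t V \<psi> where V: "(V, \<psi>) \<in> mfd_atlas M" "Vp = (cls t ` V, big_chart t \<psi>)" by auto
  show "case Vp of (B, \<beta>) \<Rightarrow> cls 0 x \<in> B \<longrightarrow> (\<forall>j<mfd_dim big_mfd. holo_at M (\<lambda>y. \<beta> (cls 0 y) j) x)"
    unfolding V(2) using holo_at_big_chart[OF V(1) x] by simp
qed

text \<open>\<open>G n\<close> is a function on the copy of index \<open>n\<close>; pulled back to
  that copy by \<open>\<theta> 1\<close>, the next function differs from it on \<open>Kn n\<close>
  by less than \<open>\<epsilon> / 2^(n+1)\<close>. The sequence converges locally uniformly on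
  every copy, and its total correction on \<open>K\<close> is at most
  \<open>\<epsilon>\<close>.\<close>

lemma big_approximation_0:
  assumes K: "compactin tp K" and g: "holomorphic_function M g" and \<epsilon>: "\<epsilon> > 0"
  obtains F where "holomorphic_function big_mfd F" "\<And>x. x \<in> K \<Longrightarrow> cmod (F (cls 0 x) - g x) \<le> \<epsilon>"
proof -
  obtain E :: "nat \<Rightarrow> 'a set" where E: "\<And>k. compactin tp (E k)" "\<And>k l. k \<le> l \<Longrightarrow> E k \<subseteq> E l"
    "\<And>x. x \<in> points M \<Longrightarrow> \<exists>k V. openin tp V \<and> x \<in> V \<and> V \<subseteq> E k"
    by (rule compact_exhaustion) blast
  \<comment> \<open>The first set contains the positions in copy \<open>n\<close> of a piece of copy
    \<open>t\<close> lying in \<open>E n\<close>, as soon as \<open>n\<close> is at least the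
    absolute value of \<open>t\<close>, since then \<open>0 \<le> n - t \<le> 2 * n\<close>; it
    gives convergence. The second is \<open>K\<close> as seen in copy \<open>n\<close>; it controls
    the error from the first step on.\<close>
  define Kn where "Kn n = (\<lambda>(t, x). \<theta> t x) ` ({0..2 * real n} \<times> E n) \<union> \<theta> (real n) ` K" for n
  have Kn: "compactin tp (Kn n)" for n
    unfolding Kn_def using K E(1)
    by (intro compactin_Un compact_orbits image_compactin[OF _ continuous_theta]) auto
  \<comment> \<open>The clause for \<open>n = 0\<close> fixes the starting function \<open>g\<close>
    within the choice principle.\<close>
  have "\<exists>G. \<forall>n::nat. (holomorphic_function M (G n) \<and> (n = 0 \<longrightarrow> G n = g)) \<and>
      (\<forall>x\<in>Kn n. cmod (G (Suc n) (\<theta> 1 x) - G n x) < \<epsilon> * (1/2) ^ Suc n)"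
  proof (rule dependent_nat_choice)
    show "\<exists>f. holomorphic_function M f \<and> ((0::nat) = 0 \<longrightarrow> f = g)" using g by blast
    fix f and n :: nat assume f: "holomorphic_function M f \<and> (n = 0 \<longrightarrow> f = g)"
    have pos: "\<epsilon> * (1/2) ^ Suc n > 0" using \<epsilon> by simp
    obtain f' where "holomorphic_function M f'" "\<And>x. x \<in> Kn n \<Longrightarrow> cmod (f' (\<theta> 1 x) - f x) < \<epsilon> * (1/2) ^ Suc n"
      using runge[OF Kn zero_le_one conjunct1[OF f] pos, of n] by blast
    then show "\<exists>f'. (holomorphic_function M f' \<and> (Suc n = 0 \<longrightarrow> f' = g)) \<and>
        (\<forall>x\<in>Kn n. cmod (f' (\<theta> 1 x) - f x) < \<epsilon> * (1/2) ^ Suc n)" by auto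
  qed
  then obtain G where G: "\<And>n. holomorphic_function M (G n)" "G 0 = g"
    "\<And>n x. x \<in> Kn n \<Longrightarrow> cmod (G (Suc n) (\<theta> 1 x) - G n x) < \<epsilon> * (1/2) ^ Suc n" by blast
  \<comment> \<open>Outside copy \<open>n\<close> the value is arbitrary; each point lies in copy
    \<open>n\<close> for all large \<open>n\<close>, and the limit sees only those.\<close>
  define A where "A n p = G n (inv_into (points M) (cls (real n)) p)" for n p
  have A: "A n (cls t x) = G n (\<theta> (real n - t) x)" if "t \<le> real n" "x \<in> points M" for n t x
  proof -
    have "cls t x = cls (real n) (\<theta> (real n - t) x)" using cls_theta[OF that(2,1)] by simp
    then show ?thesis using inv_cls[OF theta_in[of "real n - t" x]] that by (simp add: A_def)
  qed
  have A_step: "cmod (A (Suc n) (cls t x) - A n (cls t x)) < \<epsilon> * (1/2) ^ Suc n"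
    if "t \<le> real n" "x \<in> points M" "\<theta> (real n - t) x \<in> Kn n" for n t x
  proof -
    have "A (Suc n) (cls t x) = G (Suc n) (\<theta> 1 (\<theta> (real n - t) x))"
      using A[of t "Suc n" x] theta_add[of 1 "real n - t" x] that by (simp add: algebra_simps)
    then show ?thesis using G(3)[OF that(3)] A[OF that(1,2)] by simp
  qed
  define F where "F p = lim (\<lambda>n. A n p)" for p
  have main: "holo_at M (\<lambda>y. F (cls t y)) x \<and> (\<lambda>n. A n (cls t x)) \<longlonglongrightarrow> F (cls t x)"
    if x: "x \<in> points M" for t x
  proof -
    obtain k V where V: "openin tp V" "x \<in> V" "V \<subseteq> E k" using E(3)[OF x] by blast
    obtain m :: nat where m: "\<bar>t\<bar> \<le> real m" using real_arch_simple by blast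
    define N where "N = max k m"
    have N: "t \<le> real (N + l)" "- t \<le> real (N + l)" for l using m by (auto simp: N_def)
    have VM: "V \<subseteq> points M" by (rule openin_subset[OF V(1)])
    define b where "b l y = A (N + l) (cls t y)" for l y
    have inK: "\<theta> (real (N + l) - t) y \<in> Kn (N + l)" if "y \<in> V" for l y
    proof -
      have "k \<le> N + l" by (simp add: N_def)
      then have "y \<in> E (N + l)" using that V(3) E(2) by blast
      then have "(real (N + l) - t, y) \<in> {0..2 * real (N + l)} \<times> E (N + l)" using N[of l] by auto
      then have "\<theta> (real (N + l) - t) y \<in> (\<lambda>(t, x). \<theta> t x) ` ({0..2 * real (N + l)} \<times> E (N + l))"
        by (rule rev_image_eqI) simp
      then show ?thesis unfolding Kn_def by (rule UnI1)
    qed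
    have "uniform_limit V (\<lambda>n y. \<Sum>l<n. b (Suc l) y - b l y) (\<lambda>y. \<Sum>l. b (Suc l) y - b l y) sequentially"
    proof (rule Weierstrass_m_test)
      show "cmod (b (Suc l) y - b l y) \<le> \<epsilon> * (1/2) ^ l" if y: "y \<in> V" for l y
      proof -
        have "cmod (b (Suc l) y - b l y) < \<epsilon> * (1/2) ^ Suc (N + l)"
          using A_step[OF N(1) _ inK[OF y]] y VM by (auto simp: b_def)
        also have "\<dots> \<le> \<epsilon> * (1/2) ^ l" using \<epsilon> by (intro mult_left_mono power_decreasing) auto
        finally show ?thesis by simp
      qed
      show "summable (\<lambda>l. \<epsilon> * (1/2) ^ l)" by (intro summable_mult summable_geometric) auto
    qed
    moreover have "(\<Sum>l<n. b (Suc l) y - b l y) = b n y - b 0 y" for n y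
      using sum_lessThan_telescope[of "\<lambda>l. b l y" n] by simp
    ultimately have u1: "uniform_limit V (\<lambda>n y. b n y - b 0 y) (\<lambda>y. \<Sum>l. b (Suc l) y - b l y) sequentially"
      by simp
    have u2: "uniform_limit V (\<lambda>n y. b 0 y) (\<lambda>y. b 0 y) sequentially" by (rule uniform_limit_const)
    from uniform_limit_add[OF u1 u2] have ul: "uniform_limit V b (\<lambda>y. (\<Sum>l. b (Suc l) y - b l y) + b 0 y) sequentially" by simp
    have lim: "(\<lambda>n. A n (cls t y)) \<longlonglongrightarrow> (\<Sum>l. b (Suc l) y - b l y) + b 0 y" if "y \<in> V" for y
    proof (rule LIMSEQ_offset[of _ N])
      show "(\<lambda>n. A (n + N) (cls t y)) \<longlonglongrightarrow> (\<Sum>l. b (Suc l) y - b l y) + b 0 y"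
        using tendsto_uniform_limitI[OF ul that] by (simp add: b_def add.commute)
    qed
    have F: "F (cls t y) = (\<Sum>l. b (Suc l) y - b l y) + b 0 y" if "y \<in> V" for y
      unfolding F_def by (rule limI[OF lim[OF that]])
    have "holo_at M (\<lambda>y. (\<Sum>l. b (Suc l) y - b l y) + b 0 y) x"
    proof (rule holo_at_uniform_limit[OF V(1,2) _ ul])
      fix l y assume y: "y \<in> V"
      have yM: "y \<in> points M" using y VM by blast
      have "holo_at M (\<lambda>y. G (N + l) (\<theta> (real (N + l) - t) y)) y"
        using holo_function_theta[OF _ G(1)] yM N(1)[of l] unfolding holomorphic_function_iff by simp
      moreover have "b l z = G (N + l) (\<theta> (real (N + l) - t) z)" if "z \<in> points M" for z
        unfolding b_def by (rule A[OF N(1) that])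
      ultimately show "holo_at M (b l) y" using holo_at_cong[OF openin_topspace yM, of "b l"] by simp
    qed
    then have "holo_at M (\<lambda>y. F (cls t y)) x" using holo_at_cong[OF V(1,2), of "\<lambda>y. F (cls t y)"] F by simp
    then show ?thesis using lim[OF V(2)] F[OF V(2)] by simp
  qed
  have "cmod (F (cls 0 x) - g x) \<le> \<epsilon>" if x: "x \<in> K" for x
  proof -
    have xM: "x \<in> points M" using x compactin_subset_topspace[OF K] by blast
    have A0: "A 0 (cls 0 x) = g x" using A[of 0 0 x] xM theta_0 G(2) by simp
    \<comment> \<open>The right side is the sum of \<open>\<epsilon> / 2^(k+1)\<close> over
      \<open>k < n\<close>.\<close>
    have "cmod (A n (cls 0 x) - g x) \<le> \<epsilon> * (1 - (1/2) ^ n)" for n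
    proof (induction n)
      case 0
      then show ?case using A0 by simp
    next
      case (Suc n)
      have "\<theta> (real n - 0) x \<in> Kn n" using x by (auto simp: Kn_def)
      then have "cmod (A (Suc n) (cls 0 x) - A n (cls 0 x)) < \<epsilon> * (1/2) ^ Suc n"
        using A_step[of 0 n x] xM by simp
      then have "cmod (A (Suc n) (cls 0 x) - g x) \<le> \<epsilon> * (1/2) ^ Suc n + \<epsilon> * (1 - (1/2) ^ n)"
        using Suc norm_triangle_ineq[of "A (Suc n) (cls 0 x) - A n (cls 0 x)" "A n (cls 0 x) - g x"] by simp
      also have "\<dots> = \<epsilon> * (1 - (1/2) ^ Suc n)" by (simp add: algebra_simps)
      finally show ?case .
    qed
    moreover have "\<epsilon> * (1 - (1/2) ^ n) \<le> \<epsilon>" for n using \<epsilon> by (simp add: algebra_simps)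
    ultimately have "cmod (A n (cls 0 x) - g x) \<le> \<epsilon>" for n using order_trans by blast
    moreover have "(\<lambda>n. cmod (A n (cls 0 x) - g x)) \<longlonglongrightarrow> cmod (F (cls 0 x) - g x)"
      using main[OF xM, of 0] by (intro tendsto_intros) auto
    ultimately show ?thesis by (intro LIMSEQ_le_const2) auto
  qed
  moreover have "holomorphic_function big_mfd F"
    unfolding holomorphic_function_big_iff holomorphic_function_iff using main by blast
  ultimately show ?thesis using that by blast
qed

text \<open>The translation by \<open>r\<close> carries copy \<open>r\<close> to copy 0 and
  preserves holomorphic functions.\<close>

lemma big_approximation:
  assumes K: "compactin tp K" and g: "holomorphic_function M g" and \<epsilon>: "\<epsilon> > 0"
  obtains F where "holomorphic_function big_mfd F" "\<And>x. x \<in> K \<Longrightarrow> cmod (F (cls r x) - g x) \<le> \<epsilon>"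
proof -
  obtain F where F: "holomorphic_function big_mfd F" "\<And>x. x \<in> K \<Longrightarrow> cmod (F (cls 0 x) - g x) \<le> \<epsilon>"
    by (rule big_approximation_0[OF assms]) blast
  show ?thesis
    by (rule that[OF holomorphic_function_shift[OF F(1), of r]]) (simp add: shift_cls F(2))
qed

text \<open>In a common copy some \<open>g\<close> separates the two points, and an approximation
  with an error of a third of the difference of its values still does.\<close>

lemma big_separable:
  assumes "holomorphically_separable M"
  shows "holomorphically_separable big_mfd"
  unfolding holomorphically_separable_def
proof (intro ballI impI)
  fix p q assume pq: "p \<in> points big_mfd" "q \<in> points big_mfd" "p \<noteq> q"
  obtain t x where x: "x \<in> points M" "p = cls t x" using pq(1) by (auto elim: big_spaceE)
  have "q \<in> big_space" using pq(2) by simp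
  then obtain s y where y: "y \<in> points M" "q = cls s y" "t \<le> s" by (rule big_space_late)
  define x' where "x' = \<theta> (s - t) x"
  have x': "x' \<in> points M" "p = cls s x'" using x y(3) theta_in cls_theta by (auto simp: x'_def)
  then have "x' \<noteq> y" using pq y by auto
  then obtain g where g: "holomorphic_function M g" "g x' \<noteq> g y"
    using assms x'(1) y(1) unfolding holomorphically_separable_def by blast
  define e where "e = cmod (g x' - g y) / 3"
  have e: "e > 0" using g(2) by (simp add: e_def)
  have "compactin tp {x', y}" using x'(1) y(1) by (intro finite_imp_compactin) auto
  then obtain F where F: "holomorphic_function big_mfd F" "\<And>z. z \<in> {x', y} \<Longrightarrow> cmod (F (cls s z) - g z) \<le> e"
    using big_approximation[OF _ g(1) e, of "{x', y}" s] by blast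
  have "F p \<noteq> F q"
  proof
    assume eq: "F p = F q"
    have "cmod (g x' - g y) \<le> cmod (F (cls s x') - g x') + cmod (F (cls s y) - g y)"
      using norm_triangle_ineq4[of "F (cls s y) - g y" "F (cls s x') - g x'"] eq x'(2) y(2) by simp
    also have "\<dots> \<le> e + e" using F(2)[of x'] F(2)[of y] by simp
    also have "\<dots> < cmod (g x' - g y)" using e by (simp add: e_def)
    finally show False by simp
  qed
  then show "\<exists>f. holomorphic_function big_mfd f \<and> f p \<noteq> f q" using F(1) by blast
qed

section \<open>Holomorphic hulls in the union\<close>

lemma holo_bdd_above:
  assumes "compactin tp L" "holomorphic_function M g"
  shows "bdd_above ((\<lambda>y. cmod (g y)) ` L)"
proof -
  obtain B where "\<And>x. x \<in> L \<Longrightarrow> cmod (g x) \<le> B" using holomorphic_function_bounded[OF assms] by blast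
  then show ?thesis by (intro bdd_aboveI2)
qed

text \<open>The assumption concerns functions on the union only. Approximating an arbitrary
  \<open>g\<close> by such a function on the compact set \<open>insert z L\<close> recovers the
  inequality, with a loss of \<open>e / 2\<close> at \<open>z\<close> and another on
  \<open>L\<close>.\<close>

lemma hull_restrict:
  assumes L: "compactin tp L" "L \<noteq> {}" and z: "z \<in> points M"
    and h: "cls r z \<in> holomorphic_hull big_mfd (cls r ` L)"
  shows "z \<in> holomorphic_hull M L"
  unfolding holomorphic_hull_def
proof (intro CollectI conjI allI impI z)
  fix g assume g: "holomorphic_function M g"
  have "cmod (g z) \<le> (SUP y\<in>L. cmod (g y)) + e" if "e > 0" for e
  proof -
    have Kz: "compactin tp (insert z L)"
      using compactin_Un[OF _ L(1), of "{z}"] z by simp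
    have "e / 2 > 0" using that by simp
    then obtain F where F: "holomorphic_function big_mfd F"
      "\<And>x. x \<in> insert z L \<Longrightarrow> cmod (F (cls r x) - g x) \<le> e / 2"
      using big_approximation[OF Kz g] by blast
    have "cmod (F (cls r z)) \<le> (SUP p\<in>cls r ` L. cmod (F p))"
      using h F(1) unfolding holomorphic_hull_def by blast
    also have "\<dots> \<le> (SUP y\<in>L. cmod (g y)) + e / 2"
    proof (rule cSUP_least)
      fix p assume "p \<in> cls r ` L"
      then obtain y where y: "y \<in> L" "p = cls r y" by blast
      have "cmod (g y) \<le> (SUP y\<in>L. cmod (g y))" by (rule cSUP_upper[OF y(1) holo_bdd_above[OF L(1) g]])
      moreover have "cmod (F p) \<le> cmod (g y) + e / 2"
        using F(2)[of y] y norm_triangle_sub[of "F p" "g y"] by simp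
      ultimately show "cmod (F p) \<le> (SUP y\<in>L. cmod (g y)) + e / 2" by simp
    qed (use L(2) in auto)
    finally have "cmod (F (cls r z)) \<le> (SUP y\<in>L. cmod (g y)) + e / 2" .
    moreover have "cmod (g z) \<le> cmod (F (cls r z)) + e / 2"
      using F(2)[of z] norm_triangle_sub[of "g z" "F (cls r z)"] by (simp add: norm_minus_commute)
    ultimately show ?thesis by simp
  qed
  then show "cmod (g z) \<le> (SUP y\<in>L. cmod (g y))" by (rule field_le_epsilon)
qed

text \<open>Every function on the union restricts to copy \<open>r\<close>, where the hull condition
  already covers it.\<close>

lemma hull_extend:
  assumes "z \<in> holomorphic_hull M L"
  shows "cls r z \<in> holomorphic_hull big_mfd (cls r ` L)"
  using assms cls_in_big unfolding holomorphic_hull_def holomorphic_function_big_iff image_image by auto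

text \<open>A point of the hull flows into \<open>cls n ` points M\<close> eventually; while it is there it stays in the
  hull of the compact set swept out by \<open>K\<close>. Hence the set of times at which it is there is both open and
  closed.\<close>

lemma big_convex:
  assumes conv: "holomorphically_convex M"
  shows "holomorphically_convex big_mfd"
  unfolding holomorphically_convex_def
proof (intro allI impI)
  fix K assume K: "compactin (mfd_top big_mfd) K \<and> K \<noteq> {}"
  then have Kc: "compactin big_top K" and Kne: "K \<noteq> {}" by auto
  have Kbig: "K \<subseteq> big_space" using compactin_subset_topspace[OF Kc] by simp
  \<comment> \<open>The copies of natural index form an increasing open cover, so the compact set
    \<open>K\<close> lies in one of them.\<close>
  let ?U = "range (\<lambda>n::nat. cls (real n) ` points M)"
  have "\<forall>V\<in>?U. openin big_top V" using cls_open[OF openin_topspace] by auto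
  moreover have "K \<subseteq> \<Union>?U"
  proof
    fix p assume "p \<in> K"
    then obtain t x where x: "x \<in> points M" "p = cls t x" using Kbig big_spaceE by blast
    obtain n :: nat where "t \<le> real n" using real_arch_simple by blast
    then show "p \<in> \<Union>?U" using cls_image_mono[of t "real n"] x by blast
  qed
  ultimately have "\<exists>\<F>. finite \<F> \<and> \<F> \<subseteq> ?U \<and> K \<subseteq> \<Union>\<F>"
    using Kc[unfolded compactin_def, THEN conjunct2] by simp
  then obtain N where N: "finite N" "K \<subseteq> (\<Union>n\<in>N. cls (real n) ` points M)"
    by (metis finite_subset_image)
  define n where "n = real (Max (insert 0 N))"
  have "cls (real k) ` points M \<subseteq> cls n ` points M" if "k \<in> N" for k
    using that N(1) by (intro cls_image_mono) (simp add: n_def)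
  then have Kn: "K \<subseteq> cls n ` points M" using N(2) by blast
  define K' where "K' = inv_into (points M) (cls n) ` K"
  have K': "compactin tp K'" unfolding K'_def
    by (rule image_compactin[OF _ cls_inverse_continuous]) (use Kc Kn in \<open>simp add: compactin_subtopology\<close>)
  have K'M: "K' \<subseteq> points M" by (rule compactin_subset_topspace[OF K'])
  have KK': "K = cls n ` K'"
  proof
    show "K \<subseteq> cls n ` K'"
    proof
      fix p assume p: "p \<in> K"
      then obtain x where "x \<in> points M" "p = cls n x" using Kn by blast
      then show "p \<in> cls n ` K'" using p by (auto simp: K'_def intro!: image_eqI[of _ _ x] image_eqI[of x _ "cls n x"])
    qed
    show "cls n ` K' \<subseteq> K" using Kn by (auto simp: K'_def)
  qed
  have K'ne: "K' \<noteq> {}" using KK' Kne by auto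
  have "holomorphic_hull big_mfd K \<subseteq> cls n ` points M"
  proof
    fix p assume p: "p \<in> holomorphic_hull big_mfd K"
    then have "p \<in> big_space" by (simp add: holomorphic_hull_def)
    then obtain m y where y: "y \<in> points M" "p = cls m y" "n \<le> m" by (rule big_space_late)
    \<comment> \<open>At time \<open>c\<close> the point has certainly reached copy
      \<open>n\<close>: \<open>shift c p = cls n y\<close>.\<close>
    define c where "c = m - n"
    have c: "0 \<le> c" using y(3) by (simp add: c_def)
    define L where "L = (\<lambda>(t, x). \<theta> t x) ` ({0..c} \<times> K')"
    have L: "compactin tp L" unfolding L_def by (rule compact_orbits[OF K' c])
    have Lne: "L \<noteq> {}" using K'ne c by (auto simp: L_def)
    define L' where "L' = holomorphic_hull M L"
    have L': "compactin tp L'" using conv L Lne unfolding holomorphically_convex_def L'_def by blast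
    have L'M: "L' \<subseteq> points M" by (rule compactin_subset_topspace[OF L'])
    \<comment> \<open>The set \<open>L'\<close> does not depend on \<open>t\<close>. For a test
      function \<open>F\<close>, the function \<open>F \<circ> shift t\<close> bounds the value at
      \<open>p\<close> by values on \<open>K\<close>, and \<open>shift t\<close> maps
      \<open>K\<close> into the image of \<open>L\<close> under \<open>cls n\<close>.\<close>
    have key: "shift t p \<in> cls n ` L'" if t: "t \<in> {0..c}" "shift t p \<in> cls n ` points M" for t
    proof -
      obtain z where z: "z \<in> points M" "shift t p = cls n z" using t(2) by blast
      have "cls n z \<in> holomorphic_hull big_mfd (cls n ` L)"
        unfolding holomorphic_hull_def
      proof (intro CollectI conjI allI impI)
        show "cls n z \<in> points big_mfd" using cls_in_big[OF z(1)] by simp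
        fix F assume F: "holomorphic_function big_mfd F"
        have "holomorphic_function M (\<lambda>x. F (cls n x))"
          using F unfolding holomorphic_function_big_iff by (rule spec)
        then have bdd: "bdd_above ((\<lambda>q. cmod (F q)) ` cls n ` L)"
          unfolding image_image by (rule holo_bdd_above[OF L])
        have "cmod (F (shift t p)) \<le> (SUP q\<in>K. cmod (F (shift t q)))"
          using p holomorphic_function_shift[OF F] unfolding holomorphic_hull_def by blast
        also have "\<dots> \<le> (SUP q\<in>cls n ` L. cmod (F q))"
        proof (rule cSUP_mono[OF Kne bdd])
          fix q assume "q \<in> K"
          then obtain k where k: "k \<in> K'" "q = cls n k" using KK' by blast
          then have "shift t q = cls n (\<theta> t k)"
            using cls_theta[of k "n - t" n] K'M t(1) by (auto simp: shift_cls)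
          moreover have "\<theta> t k \<in> L" using k(1) t(1) by (force simp: L_def)
          ultimately show "\<exists>q'\<in>cls n ` L. cmod (F (shift t q)) \<le> cmod (F q')" by auto
        qed
        finally show "cmod (F (cls n z)) \<le> (SUP q\<in>cls n ` L. cmod (F q))" by (simp only: z(2))
      qed
      then have "z \<in> L'" unfolding L'_def by (rule hull_restrict[OF L Lne z(1)])
      then show ?thesis using z(2) by blast
    qed
    have cont: "continuous_map (top_of_set {0..c}) big_top (\<lambda>t. shift t p)"
    proof -
      have "continuous_map (top_of_set {0..c}) (prod_topology (top_of_set UNIV) big_top) (\<lambda>t. (t, p))"
        using \<open>p \<in> big_space\<close> by (simp add: continuous_map_pairedI)
      moreover have "continuous_map (prod_topology (top_of_set UNIV) big_top) big_top (\<lambda>(s, p). shift s p)"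
        using shift_action unfolding continuous_action_def by (rule conjunct1)
      ultimately show ?thesis using continuous_map_compose by (fastforce simp: o_def)
    qed
    define A where "A = {t \<in> {0..c}. shift t p \<in> cls n ` points M}"
    have "openin (top_of_set {0..c}) A"
      using openin_continuous_map_preimage[OF cont cls_open[OF openin_topspace]] by (simp add: A_def)
    \<comment> \<open>By \<open>key\<close>, lying in the open copy is the same as lying in the
      image of \<open>L'\<close>, which is compact and hence closed in the Hausdorff space.\<close>
    moreover have "closedin (top_of_set {0..c}) A"
    proof -
      have "closedin big_top (cls n ` L')"
        by (rule compactin_imp_closedin[OF Hausdorff_big image_compactin[OF L' cls_continuous]])
      then have "closedin (top_of_set {0..c}) {t \<in> {0..c}. shift t p \<in> cls n ` L'}"
        using closedin_continuous_map_preimage[OF cont] by fastforce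
      moreover have "{t \<in> {0..c}. shift t p \<in> cls n ` L'} = A" using key L'M by (auto simp: A_def)
      ultimately show ?thesis by simp
    qed
    ultimately have "A = {} \<or> A = {0..c}"
      using connected_Icc[of 0 c] unfolding connected_clopen by blast
    moreover have "c \<in> A" using c y(1,2) by (auto simp: A_def shift_cls c_def)
    ultimately have "0 \<in> A" using c by auto
    then show "p \<in> cls n ` points M" by (simp add: A_def shift_0)
  qed
  moreover have "z \<in> holomorphic_hull M K'" if "z \<in> points M" "cls n z \<in> holomorphic_hull big_mfd K" for z
    using hull_restrict[OF K' K'ne that(1)] that(2) unfolding KK' .
  \<comment> \<open>Once the hull is confined to copy \<open>n\<close>, restriction and extension
    identify it with the hull of \<open>K'\<close> in the original manifold.\<close>
  ultimately have "holomorphic_hull big_mfd K = cls n ` holomorphic_hull M K'"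
    using hull_extend[of _ K' n] unfolding KK' by blast
  moreover have "compactin tp (holomorphic_hull M K')"
    using conv K' K'ne unfolding holomorphically_convex_def by blast
  ultimately show "compactin (mfd_top big_mfd) (holomorphic_hull big_mfd K)"
    using image_compactin[OF _ cls_continuous] by simp
qed

end

theorem theorem5p1:
  fixes X :: "'a complex_mfd" and \<theta> :: "real \<Rightarrow> 'a \<Rightarrow> 'a"
  assumes "stein_manifold X"
    and "continuous_action {0..} (mfd_top X) \<theta>"
    and "\<And>t. t \<ge> 0 \<Longrightarrow> holomorphic_map X X (\<theta> t)"
  shows "\<exists>(Y :: (real \<times> 'a) set complex_mfd) (\<eta> :: real \<Rightarrow> (real \<times> 'a) set \<Rightarrow> (real \<times> 'a) set)
           (f :: 'a \<Rightarrow> (real \<times> 'a) set).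
           stein_manifold Y \<and>
           continuous_action UNIV (mfd_top Y) \<eta> \<and>
           holomorphic_map X Y f \<and> inj_on f (points X) \<and>
           (\<forall>t\<ge>0. \<forall>x\<in>points X. \<eta> t (f x) = f (\<theta> t x))"
proof -
  interpret holomorphic_semigroup X \<theta>
    using assms by unfold_locales (auto simp: stein_manifold_def)
  show ?thesis
  proof (intro exI conjI allI ballI impI)
    show "stein_manifold big_mfd"
      using assms(1) big_manifold big_convex big_separable by (simp add: stein_manifold_def)
    show "continuous_action UNIV (mfd_top big_mfd) shift" using shift_action by simp
    show "holomorphic_map X big_mfd (cls 0)" by (rule holomorphic_embedding)
    show "inj_on (cls 0) (points X)" by (rule cls_inj)
    \<comment> \<open>Both sides equal \<open>cls (- t) x\<close>: the shift lowers the index by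
      \<open>t\<close>, and the copy of index \<open>- t\<close> lies in copy 0 by way of
      \<open>\<theta> t\<close>.\<close>
    show "shift t (cls 0 x) = cls 0 (\<theta> t x)" if "t \<ge> 0" "x \<in> points X" for t x
      using cls_theta[of x "- t" 0] that by (simp add: shift_cls)
  qed
qed

end
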